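(* Let $\mathcal{D}$ and $\mathcal{D}'$ be $t$-categories, let $\mathcal{B}$ be an abelian category, and let $u^\bullet:\mathcal{D}\to\mathcal{D}'$, $T:\mathcal{D}\to\mathcal{B}$, $T':\mathcal{D}'\to\mathcal{B}$ form a commutative diagram of functors (a commutative triangle with sides $u^\bullet$, $T$, $T'$, i.e. $T'\circ u^\bullet=T$) such that: 1. $u^\bullet[d]$ is $t$-exact, for a fixed $d\in\mathbb{Z}$; 2. $T$ and $T'$ are cohomological; 3. there exists $u_\bullet:\mathcal{D}'\to\mathcal{D}$ such that $(u^\bullet,u_\bullet)$ is an adjoint pair; and 4. $T\circ u_\bullet=T'$; in particular, $T u_\bullet u^\bullet=T'u^\bullet$. Let $X\in\mathcal{D}$ and let $X_{pq}=\tau_{\ge -q+1}\tau_{\le -p}X$ be the associated spectral object. Then there is a morphism of spectral objects in the category $\mathcal{A}$ of graded objects of $\mathcal{B}$ $$T(X)\longrightarrow [T'(u^\bullet X)](-d)$$ yielding a morphism of spectral sequences $$E_1(T(X))\longrightarrow E_1(T'(u^\bullet X)(-d))$$ with resulting filtered map $$(T^{p+q}(X),L)\longrightarrow (T'^{\,p+q}(u^\bullet X),L(-d)).$$ Analogously, if $(u_\bullet,u^\bullet)$ is an adjoint pair, then the statement with arrows reversed holds true.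
   Context: A $t$-category is a triangulated category with a $t$-structure; $\tau_{\ge a},\tau_{\le b}$ are the truncation functors and $H^l=[l]\circ\tau_{\ge l}\circ\tau_{\le l}$ the cohomology functors. A functor of $t$-categories $v:\mathcal{D}\to\mathcal{D}'$ is an additive functor commuting with translations and sending distinguished triangles to distinguished triangles; $u^\bullet$ is such a functor. One says $v\circ[d]$ is $t$-exact if $v(\tau_{\ge a}X)=\tau_{\ge a+d}(v(X))$ and $v(\tau_{\le a}X)=\tau_{\le a+d}(v(X))$ (equivalently, $v\circ[d]$ commutes with all $\tau_{\ge a}$, $\tau_{\le a}$, $H^a$). A spectral object in a triangulated category $\mathcal{D}$: objects $X_{pq}$ ($p\le q$ integers), morphisms $X_{pq}\to X_{p'q'}$ for $p'\le p,\ q'\le q$ (contravariantly functorial), and coboundaries $\partial:X_{pq}\to X_{qr}[1]$ for $p\le q\le r$, such that the coboundaries commute with the morphisms and $X_{qr}\to X_{pr}\to X_{pq}\xrightarrow{\partial}X_{qr}[1]$ is a distinguished triangle. In the category $\mathcal{A}$ of graded objects of $\mathcal{B}$, a spectral object consists of $X_{pq}^n$ with $\partial:X_{pq}^n\to X_{qr}^{n+1}$ and long exact sequences $\cdots\to X^n_{qr}\to X^n_{pr}\to X^n_{pq}\to X^{n+1}_{qr}\to\cdots$ in place of distinguished triangles. Morphisms are the evident ones. All spectral objects are assumed bounded, i.e. $X_{p,p+1}=0$ for $|p|\gg 0$; for the spectral object associated with an object $X$ of a $t$-category this means $H^l(X)=0$ for $|l|\gg0$. For an object $X$ of a $t$-category,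 $X_{pq}:=\tau_{\ge -q+1}\tau_{\le -p}X$ is a spectral object, and $X_{p,p+1}=H^{-p}(X)[p]$. For a cohomological functor $T$ put $T^n(X)=T(X[n])$ and $T(X)^n_{pq}:=T^n(X_{pq})$, a spectral object in $\mathcal{A}$. The translate by $l\in\mathbb{Z}$ of a spectral object is $X(l)_{pq}:=X_{p+l,q+l}$ (and $X(l)^n_{pq}=X^n_{p+l,q+l}$ in $\mathcal{A}$). There is the spectral sequence $E_1(T(X))$: $E_1^{pq}=T^{p+q}(X_{p,p+1})\Rightarrow T^{p+q}(X)$, with abutment filtration $F^pT^u(X)=\mathrm{Im}\{T^u(\tau_{\le -p}X)\to T^u(X)\}$, and the $L$-filtration is defined by $L^{p+u}T^u:=F^pT^u$. Translation of spectral objects gives $E_1(T(X)(l))^{pq}=E_1(T(X))^{p+l,q-l}$. The translate of a filtration $G$ is $G(l)^s=G^{l+s}$. *)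

theory Defs
  imports "HOL-Algebra.Group"
begin

section \<open>Categories, functors, adjunctions\<close>

record ('o, 'm) cat =
  Obj :: "'o set"
  Arr :: "'m set"
  Dom :: "'m \<Rightarrow> 'o"
  Cod :: "'m \<Rightarrow> 'o"
  Ide :: "'o \<Rightarrow> 'm"
  Comp :: "'m \<Rightarrow> 'm \<Rightarrow> 'm"  (infixr "\<cdot>\<index>" 70)

definition Hom :: "('o, 'm, 'x) cat_scheme \<Rightarrow> 'o \<Rightarrow> 'o \<Rightarrow> 'm set" where
  "Hom C x y = {f \<in> Arr C. Dom C f = x \<and> Cod C f = y}"

locale category =
  fixes C :: "('o, 'm, 'x) cat_scheme" (structure)
  assumes dom_Obj: "f \<in> Arr C \<Longrightarrow> Dom C f \<in> Obj C"
    and cod_Obj: "f \<in> Arr C \<Longrightarrow> Cod C f \<in> Obj C"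
    and ide_Hom: "x \<in> Obj C \<Longrightarrow> Ide C x \<in> Hom C x x"
    and comp_Hom: "\<lbrakk>f \<in> Hom C x y; g \<in> Hom C y z\<rbrakk> \<Longrightarrow> g \<cdot> f \<in> Hom C x z"
    and comp_assoc: "\<lbrakk>f \<in> Hom C w x; g \<in> Hom C x y; h \<in> Hom C y z\<rbrakk> \<Longrightarrow> (h \<cdot> g) \<cdot> f = h \<cdot> (g \<cdot> f)"
    and ide_left: "f \<in> Hom C x y \<Longrightarrow> Ide C y \<cdot> f = f"
    and ide_right: "f \<in> Hom C x y \<Longrightarrow> f \<cdot> Ide C x = f"

definition isomor :: "('o, 'm, 'x) cat_scheme \<Rightarrow> 'm \<Rightarrow> bool" where
  "isomor C f \<longleftrightarrow> f \<in> Arr C \<and> (\<exists>g \<in> Hom C (Cod C f) (Dom C f).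
     g \<cdot>\<^bsub>C\<^esub> f = Ide C (Dom C f) \<and> f \<cdot>\<^bsub>C\<^esub> g = Ide C (Cod C f))"

definition monic :: "('o, 'm, 'x) cat_scheme \<Rightarrow> 'm \<Rightarrow> bool" where
  "monic C f \<longleftrightarrow> f \<in> Arr C \<and> (\<forall>w \<in> Obj C. \<forall>g \<in> Hom C w (Dom C f). \<forall>h \<in> Hom C w (Dom C f).
     f \<cdot>\<^bsub>C\<^esub> g = f \<cdot>\<^bsub>C\<^esub> h \<longrightarrow> g = h)"

definition epic :: "('o, 'm, 'x) cat_scheme \<Rightarrow> 'm \<Rightarrow> bool" where
  "epic C f \<longleftrightarrow> f \<in> Arr C \<and> (\<forall>w \<in> Obj C. \<forall>g \<in> Hom C (Cod C f) w. \<forall>h \<in> Hom C (Cod C f) w.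
     g \<cdot>\<^bsub>C\<^esub> f = h \<cdot>\<^bsub>C\<^esub> f \<longrightarrow> g = h)"

definition zero_object :: "('o, 'm, 'x) cat_scheme \<Rightarrow> 'o \<Rightarrow> bool" where
  "zero_object C z \<longleftrightarrow> z \<in> Obj C \<and>
     (\<forall>x \<in> Obj C. (\<exists>!f. f \<in> Hom C z x) \<and> (\<exists>!f. f \<in> Hom C x z))"

record ('o, 'm, 'p, 'n) functr =
  onO :: "'o \<Rightarrow> 'p"
  onM :: "'m \<Rightarrow> 'n"

definition id_functr :: "('o, 'm, 'o, 'm) functr" where
  "id_functr = \<lparr>onO = (\<lambda>x. x), onM = (\<lambda>f. f)\<rparr>"

definition comp_functr ::
    "('p, 'n, 'q, 'k) functr \<Rightarrow> ('o, 'm, 'p, 'n) functr \<Rightarrow> ('o, 'm, 'q, 'k) functr"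
    (infixr "\<circ>\<^sub>F" 55) where
  "G \<circ>\<^sub>F F = \<lparr>onO = onO G \<circ> onO F, onM = onM G \<circ> onM F\<rparr>"

definition cat_functor ::
    "('o, 'm, 'x) cat_scheme \<Rightarrow> ('p, 'n, 'y) cat_scheme \<Rightarrow> ('o, 'm, 'p, 'n) functr \<Rightarrow> bool" where
  "cat_functor C D F \<longleftrightarrow>
     (\<forall>x \<in> Obj C. onO F x \<in> Obj D \<and> onM F (Ide C x) = Ide D (onO F x)) \<and>
     (\<forall>x \<in> Obj C. \<forall>y \<in> Obj C. \<forall>f \<in> Hom C x y. onM F f \<in> Hom D (onO F x) (onO F y)) \<and>
     (\<forall>x \<in> Obj C. \<forall>y \<in> Obj C. \<forall>z \<in> Obj C. \<forall>f \<in> Hom C x y. \<forall>g \<in> Hom C y z.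
        onM F (g \<cdot>\<^bsub>C\<^esub> f) = onM F g \<cdot>\<^bsub>D\<^esub> onM F f)"

definition natural ::
    "('o, 'm, 'x) cat_scheme \<Rightarrow> ('p, 'n, 'y) cat_scheme \<Rightarrow> ('o, 'm, 'p, 'n) functr
      \<Rightarrow> ('o, 'm, 'p, 'n) functr \<Rightarrow> ('o \<Rightarrow> 'n) \<Rightarrow> bool" where
  "natural C D F G \<alpha> \<longleftrightarrow>
     (\<forall>x \<in> Obj C. \<alpha> x \<in> Hom D (onO F x) (onO G x)) \<and>
     (\<forall>x \<in> Obj C. \<forall>y \<in> Obj C. \<forall>f \<in> Hom C x y. \<alpha> y \<cdot>\<^bsub>D\<^esub> onM F f = onM G f \<cdot>\<^bsub>D\<^esub> \<alpha> x)"

definition natural_iso ::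
    "('o, 'm, 'x) cat_scheme \<Rightarrow> ('p, 'n, 'y) cat_scheme \<Rightarrow> ('o, 'm, 'p, 'n) functr
      \<Rightarrow> ('o, 'm, 'p, 'n) functr \<Rightarrow> ('o \<Rightarrow> 'n) \<Rightarrow> bool" where
  "natural_iso C D F G \<alpha> \<longleftrightarrow> natural C D F G \<alpha> \<and> (\<forall>x \<in> Obj C. isomor D (\<alpha> x))"

text \<open>\<open>adjunction C D L R \<eta> \<epsilon>\<close>: \<open>(L, R)\<close> is an adjoint pair, \<open>L\<close> being the left adjoint,
  with unit \<open>\<eta>\<close> and counit \<open>\<epsilon>\<close>.\<close>

definition adjunction ::
    "('o, 'm, 'x) cat_scheme \<Rightarrow> ('p, 'n, 'y) cat_scheme \<Rightarrow> ('o, 'm, 'p, 'n) functr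
      \<Rightarrow> ('p, 'n, 'o, 'm) functr \<Rightarrow> ('o \<Rightarrow> 'm) \<Rightarrow> ('p \<Rightarrow> 'n) \<Rightarrow> bool" where
  "adjunction C D L R \<eta> \<epsilon> \<longleftrightarrow>
     cat_functor C D L \<and> cat_functor D C R \<and>
     natural C C id_functr (R \<circ>\<^sub>F L) \<eta> \<and> natural D D (L \<circ>\<^sub>F R) id_functr \<epsilon> \<and>
     (\<forall>x \<in> Obj C. \<epsilon> (onO L x) \<cdot>\<^bsub>D\<^esub> onM L (\<eta> x) = Ide D (onO L x)) \<and>
     (\<forall>y \<in> Obj D. onM R (\<epsilon> y) \<cdot>\<^bsub>C\<^esub> \<eta> (onO R y) = Ide C (onO R y))"


section \<open>Additive and abelian categories\<close>

record ('o, 'm) acat = "('o, 'm) cat" +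
  hadd :: "'m \<Rightarrow> 'm \<Rightarrow> 'm"
  hzero :: "'o \<Rightarrow> 'o \<Rightarrow> 'm"

definition hom_group :: "('o, 'm, 'x) acat_scheme \<Rightarrow> 'o \<Rightarrow> 'o \<Rightarrow> 'm monoid" where
  "hom_group C x y = \<lparr>carrier = Hom C x y, mult = hadd C, one = hzero C x y\<rparr>"

definition hneg :: "('o, 'm, 'x) acat_scheme \<Rightarrow> 'm \<Rightarrow> 'm" where
  "hneg C f = inv\<^bsub>hom_group C (Dom C f) (Cod C f)\<^esub> f"

definition biproduct ::
    "('o, 'm, 'x) acat_scheme \<Rightarrow> 'o \<Rightarrow> 'o \<Rightarrow> 'o \<Rightarrow> 'm \<Rightarrow> 'm \<Rightarrow> 'm \<Rightarrow> 'm \<Rightarrow> bool" where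
  "biproduct C x y s i j p q \<longleftrightarrow> s \<in> Obj C \<and>
     i \<in> Hom C x s \<and> j \<in> Hom C y s \<and> p \<in> Hom C s x \<and> q \<in> Hom C s y \<and>
     p \<cdot>\<^bsub>C\<^esub> i = Ide C x \<and> q \<cdot>\<^bsub>C\<^esub> j = Ide C y \<and> q \<cdot>\<^bsub>C\<^esub> i = hzero C x y \<and> p \<cdot>\<^bsub>C\<^esub> j = hzero C y x \<and>
     hadd C (i \<cdot>\<^bsub>C\<^esub> p) (j \<cdot>\<^bsub>C\<^esub> q) = Ide C s"

locale additive_category = category C
  for C :: "('o, 'm, 'x) acat_scheme" (structure) +
  assumes hom_comm_group: "\<lbrakk>x \<in> Obj C; y \<in> Obj C\<rbrakk> \<Longrightarrow> comm_group (hom_group C x y)"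
    and comp_add_left: "\<lbrakk>f \<in> Hom C x y; g \<in> Hom C y z; g' \<in> Hom C y z\<rbrakk>
          \<Longrightarrow> hadd C g g' \<cdot> f = hadd C (g \<cdot> f) (g' \<cdot> f)"
    and comp_add_right: "\<lbrakk>f \<in> Hom C x y; f' \<in> Hom C x y; g \<in> Hom C y z\<rbrakk>
          \<Longrightarrow> g \<cdot> hadd C f f' = hadd C (g \<cdot> f) (g \<cdot> f')"
    and ex_zero_object: "\<exists>z. zero_object C z"
    and ex_biproduct: "\<lbrakk>x \<in> Obj C; y \<in> Obj C\<rbrakk> \<Longrightarrow> \<exists>s i j p q. biproduct C x y s i j p q"

definition additive_functor ::
    "('o, 'm, 'x) acat_scheme \<Rightarrow> ('p, 'n, 'y) acat_scheme \<Rightarrow> ('o, 'm, 'p, 'n) functr \<Rightarrow> bool" where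
  "additive_functor C D F \<longleftrightarrow> cat_functor C D F \<and>
     (\<forall>x \<in> Obj C. \<forall>y \<in> Obj C. \<forall>f \<in> Hom C x y. \<forall>g \<in> Hom C x y.
        onM F (hadd C f g) = hadd D (onM F f) (onM F g))"

definition is_kernel :: "('o, 'm, 'x) acat_scheme \<Rightarrow> 'm \<Rightarrow> 'm \<Rightarrow> bool" where
  "is_kernel C k f \<longleftrightarrow> f \<in> Arr C \<and> k \<in> Arr C \<and> Cod C k = Dom C f \<and>
     f \<cdot>\<^bsub>C\<^esub> k = hzero C (Dom C k) (Cod C f) \<and>
     (\<forall>w \<in> Obj C. \<forall>g \<in> Hom C w (Dom C f). f \<cdot>\<^bsub>C\<^esub> g = hzero C w (Cod C f) \<longrightarrow>
        (\<exists>!h. h \<in> Hom C w (Dom C k) \<and> k \<cdot>\<^bsub>C\<^esub> h = g))"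

definition is_cokernel :: "('o, 'm, 'x) acat_scheme \<Rightarrow> 'm \<Rightarrow> 'm \<Rightarrow> bool" where
  "is_cokernel C k f \<longleftrightarrow> f \<in> Arr C \<and> k \<in> Arr C \<and> Dom C k = Cod C f \<and>
     k \<cdot>\<^bsub>C\<^esub> f = hzero C (Dom C f) (Cod C k) \<and>
     (\<forall>w \<in> Obj C. \<forall>g \<in> Hom C (Cod C f) w. g \<cdot>\<^bsub>C\<^esub> f = hzero C (Dom C f) w \<longrightarrow>
        (\<exists>!h. h \<in> Hom C (Cod C k) w \<and> h \<cdot>\<^bsub>C\<^esub> k = g))"

locale abelian_category = additive_category C
  for C :: "('o, 'm, 'x) acat_scheme" (structure) +
  assumes ex_kernel: "f \<in> Arr C \<Longrightarrow> \<exists>k. is_kernel C k f"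
    and ex_cokernel: "f \<in> Arr C \<Longrightarrow> \<exists>k. is_cokernel C k f"
    and monic_normal: "monic C f \<Longrightarrow> \<exists>g. is_kernel C f g"
    and epic_normal: "epic C f \<Longrightarrow> \<exists>g. is_cokernel C f g"

definition image_fact :: "('o, 'm, 'x) cat_scheme \<Rightarrow> 'm \<Rightarrow> 'm \<Rightarrow> 'm \<Rightarrow> bool" where
  "image_fact C f e m \<longleftrightarrow> epic C e \<and> monic C m \<and> Cod C e = Dom C m \<and> m \<cdot>\<^bsub>C\<^esub> e = f"

text \<open>A chosen image of an arrow: an epimorphism onto the image and its inclusion.\<close>

definition im_epi :: "('o, 'm, 'x) cat_scheme \<Rightarrow> 'm \<Rightarrow> 'm" where
  "im_epi C f = fst (SOME em. image_fact C f (fst em) (snd em))"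

definition im_mono :: "('o, 'm, 'x) cat_scheme \<Rightarrow> 'm \<Rightarrow> 'm" where
  "im_mono C f = snd (SOME em. image_fact C f (fst em) (snd em))"

definition exact_at :: "('o, 'm, 'x) acat_scheme \<Rightarrow> 'm \<Rightarrow> 'm \<Rightarrow> bool" where
  "exact_at C f g \<longleftrightarrow> (\<exists>e k. image_fact C f e k \<and> is_kernel C k g)"


section \<open>Triangulated categories and t-structures\<close>

text \<open>The translation automorphism is recorded through all of its integral powers:
  \<open>onO (Sh D n) X\<close> is \<open>X[n]\<close>.  A triangle is given by its three arrows.\<close>

record ('o, 'm) tricat = "('o, 'm) acat" +
  Sh :: "int \<Rightarrow> ('o, 'm, 'o, 'm) functr"
  Tri :: "('m \<times> 'm \<times> 'm) set"

definition triangle :: "('o, 'm, 'x) tricat_scheme \<Rightarrow> 'm \<Rightarrow> 'm \<Rightarrow> 'm \<Rightarrow> bool" where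
  "triangle D f g h \<longleftrightarrow> f \<in> Arr D \<and> g \<in> Arr D \<and> h \<in> Arr D \<and>
     Cod D f = Dom D g \<and> Cod D g = Dom D h \<and> Cod D h = onO (Sh D 1) (Dom D f)"

definition triangle_morphism ::
    "('o, 'm, 'x) tricat_scheme \<Rightarrow> 'm \<times> 'm \<times> 'm \<Rightarrow> 'm \<times> 'm \<times> 'm \<Rightarrow> 'm \<Rightarrow> 'm \<Rightarrow> 'm \<Rightarrow> bool" where
  "triangle_morphism D t t' a b c \<longleftrightarrow>
     (case t of (f, g, h) \<Rightarrow> case t' of (f', g', h') \<Rightarrow>
        a \<in> Hom D (Dom D f) (Dom D f') \<and> b \<in> Hom D (Dom D g) (Dom D g') \<and>
        c \<in> Hom D (Dom D h) (Dom D h') \<and>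
        b \<cdot>\<^bsub>D\<^esub> f = f' \<cdot>\<^bsub>D\<^esub> a \<and> c \<cdot>\<^bsub>D\<^esub> g = g' \<cdot>\<^bsub>D\<^esub> b \<and> onM (Sh D 1) a \<cdot>\<^bsub>D\<^esub> h = h' \<cdot>\<^bsub>D\<^esub> c)"

locale triangulated_category = additive_category D
  for D :: "('o, 'm, 'x) tricat_scheme" (structure) +
  assumes shift_functor: "additive_functor D D (Sh D n)"
    and shift_0: "x \<in> Obj D \<Longrightarrow> onO (Sh D 0) x = x" "f \<in> Arr D \<Longrightarrow> onM (Sh D 0) f = f"
    and shift_add: "x \<in> Obj D \<Longrightarrow> onO (Sh D (m + n)) x = onO (Sh D m) (onO (Sh D n) x)"
      "f \<in> Arr D \<Longrightarrow> onM (Sh D (m + n)) f = onM (Sh D m) (onM (Sh D n) f)"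
    and tri_triangle: "(f, g, h) \<in> Tri D \<Longrightarrow> triangle D f g h"
    and TR1_iso: "\<lbrakk>(f, g, h) \<in> Tri D; triangle D f' g' h';
          triangle_morphism D (f, g, h) (f', g', h') a b c; isomor D a; isomor D b; isomor D c\<rbrakk>
        \<Longrightarrow> (f', g', h') \<in> Tri D"
    and TR1_ide: "\<lbrakk>x \<in> Obj D; zero_object D z\<rbrakk>
        \<Longrightarrow> (Ide D x, hzero D x z, hzero D z (onO (Sh D 1) x)) \<in> Tri D"
    and TR1_ex: "f \<in> Arr D \<Longrightarrow> \<exists>g h. (f, g, h) \<in> Tri D"
    and TR2: "triangle D f g h
        \<Longrightarrow> (f, g, h) \<in> Tri D \<longleftrightarrow> (g, h, hneg D (onM (Sh D 1) f)) \<in> Tri D"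
    and TR3: "\<lbrakk>(f, g, h) \<in> Tri D; (f', g', h') \<in> Tri D; a \<in> Hom D (Dom D f) (Dom D f');
          b \<in> Hom D (Dom D g) (Dom D g'); b \<cdot> f = f' \<cdot> a\<rbrakk>
        \<Longrightarrow> \<exists>c. triangle_morphism D (f, g, h) (f', g', h') a b c"
    and TR4: "\<lbrakk>(f, f1, f2) \<in> Tri D; (g, g1, g2) \<in> Tri D; Cod D f = Dom D g;
          (g \<cdot> f, k1, k2) \<in> Tri D\<rbrakk>
        \<Longrightarrow> \<exists>a \<in> Hom D (Cod D f1) (Cod D k1). \<exists>b \<in> Hom D (Cod D k1) (Cod D g1).
              (a, b, onM (Sh D 1) f1 \<cdot> g2) \<in> Tri D \<and>
              a \<cdot> f1 = k1 \<cdot> g \<and> k2 \<cdot> a = f2 \<and> b \<cdot> k1 = g1 \<and> g2 \<cdot> b = onM (Sh D 1) f \<cdot> k2"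

record ('o, 'm) tcat = "('o, 'm) tricat" +
  le0 :: "'o set"
  ge0 :: "'o set"

text \<open>\<open>D\<^sup>\<le>\<^sup>n = D\<^sup>\<le>\<^sup>0[-n]\<close> and \<open>D\<^sup>\<ge>\<^sup>n = D\<^sup>\<ge>\<^sup>0[-n]\<close>.\<close>

definition t_le :: "('o, 'm, 'x) tcat_scheme \<Rightarrow> int \<Rightarrow> 'o set" where
  "t_le D n = {X \<in> Obj D. onO (Sh D n) X \<in> le0 D}"

definition t_ge :: "('o, 'm, 'x) tcat_scheme \<Rightarrow> int \<Rightarrow> 'o set" where
  "t_ge D n = {X \<in> Obj D. onO (Sh D n) X \<in> ge0 D}"

locale t_category = triangulated_category D
  for D :: "('o, 'm, 'x) tcat_scheme" (structure) +
  assumes le0_Obj: "le0 D \<subseteq> Obj D"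
    and ge0_Obj: "ge0 D \<subseteq> Obj D"
    and le0_iso: "\<lbrakk>isomor D f; Dom D f \<in> le0 D\<rbrakk> \<Longrightarrow> Cod D f \<in> le0 D"
    and ge0_iso: "\<lbrakk>isomor D f; Dom D f \<in> ge0 D\<rbrakk> \<Longrightarrow> Cod D f \<in> ge0 D"
    and t_orthogonal: "\<lbrakk>X \<in> t_le D 0; Y \<in> t_ge D 1\<rbrakk> \<Longrightarrow> Hom D X Y = {hzero D X Y}"
    and t_le_mono: "t_le D 0 \<subseteq> t_le D 1"
    and t_ge_mono: "t_ge D 1 \<subseteq> t_ge D 0"
    and t_decompose: "X \<in> Obj D \<Longrightarrow> \<exists>i p h. (i, p, h) \<in> Tri D \<and> Cod D i = X \<and>
          Dom D i \<in> t_le D 0 \<and> Cod D p \<in> t_ge D 1"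

text \<open>A chosen triangle \<open>\<tau>\<^sub>\<le>\<^sub>n X \<rightarrow> X \<rightarrow> \<tau>\<^sub>\<ge>\<^sub>n\<^sub>+\<^sub>1 X \<rightarrow>\<close>; it is unique up to unique isomorphism.\<close>

definition trunc_tri :: "('o, 'm, 'x) tcat_scheme \<Rightarrow> int \<Rightarrow> 'o \<Rightarrow> 'm \<times> 'm \<times> 'm" where
  "trunc_tri D n X = (SOME t. t \<in> Tri D \<and> Cod D (fst t) = X \<and>
     Dom D (fst t) \<in> t_le D n \<and> Cod D (fst (snd t)) \<in> t_ge D (n + 1))"

definition tle_in :: "('o, 'm, 'x) tcat_scheme \<Rightarrow> int \<Rightarrow> 'o \<Rightarrow> 'm" where
  "tle_in D n X = fst (trunc_tri D n X)"

definition tau_le :: "('o, 'm, 'x) tcat_scheme \<Rightarrow> int \<Rightarrow> 'o \<Rightarrow> 'o" where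
  "tau_le D n X = Dom D (tle_in D n X)"

definition tge_out :: "('o, 'm, 'x) tcat_scheme \<Rightarrow> int \<Rightarrow> 'o \<Rightarrow> 'm" where
  "tge_out D n X = fst (snd (trunc_tri D (n - 1) X))"

definition tau_ge :: "('o, 'm, 'x) tcat_scheme \<Rightarrow> int \<Rightarrow> 'o \<Rightarrow> 'o" where
  "tau_ge D n X = Cod D (tge_out D n X)"

definition t_coh :: "('o, 'm, 'x) tcat_scheme \<Rightarrow> int \<Rightarrow> 'o \<Rightarrow> 'o" where
  "t_coh D l X = onO (Sh D l) (tau_ge D l (tau_le D l X))"

definition t_bounded :: "('o, 'm, 'x) tcat_scheme \<Rightarrow> 'o \<Rightarrow> bool" where
  "t_bounded D X \<longleftrightarrow> (\<exists>N. \<forall>l. N \<le> \<bar>l\<bar> \<longrightarrow> zero_object D (t_coh D l X))"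

text \<open>The canonical map \<open>\<tau>\<^sub>\<le>\<^sub>m X \<rightarrow> \<tau>\<^sub>\<le>\<^sub>n X\<close> for \<open>m \<le> n\<close>.\<close>

definition tle_map :: "('o, 'm, 'x) tcat_scheme \<Rightarrow> int \<Rightarrow> int \<Rightarrow> 'o \<Rightarrow> 'm" where
  "tle_map D m n X = (THE g. g \<in> Hom D (tau_le D m X) (tau_le D n X) \<and>
     tle_in D n X \<cdot>\<^bsub>D\<^esub> g = tle_in D m X)"

text \<open>A functor \<open>u\<close> commutes with translations through natural isomorphisms
  \<open>\<phi> n X : u(X[n]) \<rightarrow> u(X)[n]\<close>, compatible with addition of the translation degrees.\<close>

definition triangulated_functor ::
    "('o, 'm, 'x) tricat_scheme \<Rightarrow> ('p, 'n, 'y) tricat_scheme \<Rightarrow> ('o, 'm, 'p, 'n) functr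
      \<Rightarrow> (int \<Rightarrow> 'o \<Rightarrow> 'n) \<Rightarrow> bool" where
  "triangulated_functor D D' u \<phi> \<longleftrightarrow> additive_functor D D' u \<and>
     (\<forall>n. natural_iso D D' (u \<circ>\<^sub>F Sh D n) (Sh D' n \<circ>\<^sub>F u) (\<phi> n)) \<and>
     (\<forall>m n. \<forall>X \<in> Obj D. \<phi> (m + n) X = onM (Sh D' m) (\<phi> n X) \<cdot>\<^bsub>D'\<^esub> \<phi> m (onO (Sh D n) X)) \<and>
     (\<forall>f g h. (f, g, h) \<in> Tri D \<longrightarrow>
        (onM u f, onM u g, \<phi> 1 (Dom D f) \<cdot>\<^bsub>D'\<^esub> onM u h) \<in> Tri D')"

text \<open>\<open>u \<circ> [d]\<close> is t-exact: \<open>u(\<tau>\<^sub>\<le>\<^sub>a X) = \<tau>\<^sub>\<le>\<^sub>a\<^sub>+\<^sub>d(u X)\<close> and \<open>u(\<tau>\<^sub>\<ge>\<^sub>a X) = \<tau>\<^sub>\<ge>\<^sub>a\<^sub>+\<^sub>d(u X)\<close>, where, truncations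
  being defined up to unique isomorphism, equality means equality as objects over,
  respectively under, \<open>u X\<close>.\<close>

definition shifted_t_exact ::
    "('o, 'm, 'x) tcat_scheme \<Rightarrow> ('p, 'n, 'y) tcat_scheme \<Rightarrow> ('o, 'm, 'p, 'n) functr
      \<Rightarrow> int \<Rightarrow> bool" where
  "shifted_t_exact D D' u d \<longleftrightarrow> (\<forall>X \<in> Obj D. \<forall>a.
     (\<exists>\<alpha> \<in> Hom D' (onO u (tau_le D a X)) (tau_le D' (a + d) (onO u X)).
        isomor D' \<alpha> \<and> tle_in D' (a + d) (onO u X) \<cdot>\<^bsub>D'\<^esub> \<alpha> = onM u (tle_in D a X)) \<and>
     (\<exists>\<beta> \<in> Hom D' (onO u (tau_ge D a X)) (tau_ge D' (a + d) (onO u X)).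
        isomor D' \<beta> \<and> \<beta> \<cdot>\<^bsub>D'\<^esub> onM u (tge_out D a X) = tge_out D' (a + d) (onO u X)))"

definition cohomological ::
    "('o, 'm, 'x) tricat_scheme \<Rightarrow> ('b, 'c, 'y) acat_scheme \<Rightarrow> ('o, 'm, 'b, 'c) functr \<Rightarrow> bool" where
  "cohomological D B T \<longleftrightarrow> additive_functor D B T \<and>
     (\<forall>f g h. (f, g, h) \<in> Tri D \<longrightarrow> exact_at B (onM T f) (onM T g))"


section \<open>Spectral objects\<close>

text \<open>Data of a spectral object of a triangulated category: \<open>spO p q\<close> is \<open>X\<^sub>p\<^sub>q\<close>,
  \<open>spM p q p' q' : X\<^sub>p\<^sub>q \<rightarrow> X\<^sub>p\<^sub>'\<^sub>q\<^sub>'\<close>, and \<open>spD p q r : X\<^sub>p\<^sub>q \<rightarrow> X\<^sub>q\<^sub>r[1]\<close>.\<close>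

record ('o, 'm) spobj =
  spO :: "int \<Rightarrow> int \<Rightarrow> 'o"
  spM :: "int \<Rightarrow> int \<Rightarrow> int \<Rightarrow> int \<Rightarrow> 'm"
  spD :: "int \<Rightarrow> int \<Rightarrow> int \<Rightarrow> 'm"

definition tspO :: "('o, 'm, 'x) tcat_scheme \<Rightarrow> 'o \<Rightarrow> int \<Rightarrow> int \<Rightarrow> 'o" where
  "tspO D X p q = tau_ge D (- q + 1) (tau_le D (- p) X)"

text \<open>The structural map \<open>\<tau>\<^sub>\<le>\<^sub>-\<^sub>p X \<rightarrow> X\<^sub>p\<^sub>q\<close>.\<close>

definition tsp_out :: "('o, 'm, 'x) tcat_scheme \<Rightarrow> 'o \<Rightarrow> int \<Rightarrow> int \<Rightarrow> 'm" where
  "tsp_out D X p q = tge_out D (- q + 1) (tau_le D (- p) X)"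

definition tspM :: "('o, 'm, 'x) tcat_scheme \<Rightarrow> 'o \<Rightarrow> int \<Rightarrow> int \<Rightarrow> int \<Rightarrow> int \<Rightarrow> 'm" where
  "tspM D X p q p' q' = (THE g. g \<in> Hom D (tspO D X p q) (tspO D X p' q') \<and>
     g \<cdot>\<^bsub>D\<^esub> tsp_out D X p q = tsp_out D X p' q' \<cdot>\<^bsub>D\<^esub> tle_map D (- p) (- p') X)"

text \<open>The coboundary is the only arrow completing \<open>X\<^sub>q\<^sub>r \<rightarrow> X\<^sub>p\<^sub>r \<rightarrow> X\<^sub>p\<^sub>q\<close> to a distinguished
  triangle, because \<open>Hom (X\<^sub>q\<^sub>r[1]) X\<^sub>p\<^sub>q = 0\<close>.\<close>

definition tspD :: "('o, 'm, 'x) tcat_scheme \<Rightarrow> 'o \<Rightarrow> int \<Rightarrow> int \<Rightarrow> int \<Rightarrow> 'm" where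
  "tspD D X p q r = (THE h. (tspM D X q r p r, tspM D X p r p q, h) \<in> Tri D)"

definition t_spobj :: "('o, 'm, 'x) tcat_scheme \<Rightarrow> 'o \<Rightarrow> ('o, 'm) spobj" where
  "t_spobj D X = \<lparr>spO = tspO D X, spM = tspM D X, spD = tspD D X\<rparr>"

text \<open>Data of a spectral object of the category of graded objects: \<open>gO n p q\<close> is \<open>X\<^sup>n\<^sub>p\<^sub>q\<close>,
  \<open>gM n p q p' q' : X\<^sup>n\<^sub>p\<^sub>q \<rightarrow> X\<^sup>n\<^sub>p\<^sub>'\<^sub>q\<^sub>'\<close>, and \<open>gD n p q r : X\<^sup>n\<^sub>p\<^sub>q \<rightarrow> X\<^sup>n\<^sup>+\<^sup>1\<^sub>q\<^sub>r\<close>.\<close>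

record ('b, 'c) gspobj =
  gO :: "int \<Rightarrow> int \<Rightarrow> int \<Rightarrow> 'b"
  gM :: "int \<Rightarrow> int \<Rightarrow> int \<Rightarrow> int \<Rightarrow> int \<Rightarrow> 'c"
  gD :: "int \<Rightarrow> int \<Rightarrow> int \<Rightarrow> int \<Rightarrow> 'c"

definition spectral_object :: "('b, 'c, 'y) acat_scheme \<Rightarrow> ('b, 'c) gspobj \<Rightarrow> bool" where
  "spectral_object B S \<longleftrightarrow>
     (\<forall>n p q. p \<le> q \<longrightarrow> gO S n p q \<in> Obj B \<and> gM S n p q p q = Ide B (gO S n p q)) \<and>
     (\<forall>n p q p' q'. p \<le> q \<and> p' \<le> q' \<and> p' \<le> p \<and> q' \<le> q \<longrightarrow>
        gM S n p q p' q' \<in> Hom B (gO S n p q) (gO S n p' q')) \<and>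
     (\<forall>n p q p' q' p'' q''. p \<le> q \<and> p' \<le> q' \<and> p'' \<le> q'' \<and> p' \<le> p \<and> q' \<le> q \<and> p'' \<le> p' \<and> q'' \<le> q' \<longrightarrow>
        gM S n p' q' p'' q'' \<cdot>\<^bsub>B\<^esub> gM S n p q p' q' = gM S n p q p'' q'') \<and>
     (\<forall>n p q r. p \<le> q \<and> q \<le> r \<longrightarrow> gD S n p q r \<in> Hom B (gO S n p q) (gO S (n + 1) q r)) \<and>
     (\<forall>n p q r p' q' r'. p \<le> q \<and> q \<le> r \<and> p' \<le> q' \<and> q' \<le> r' \<and> p' \<le> p \<and> q' \<le> q \<and> r' \<le> r \<longrightarrow>
        gD S n p' q' r' \<cdot>\<^bsub>B\<^esub> gM S n p q p' q' = gM S (n + 1) q r q' r' \<cdot>\<^bsub>B\<^esub> gD S n p q r) \<and>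
     (\<forall>n p q r. p \<le> q \<and> q \<le> r \<longrightarrow>
        exact_at B (gM S n q r p r) (gM S n p r p q) \<and>
        exact_at B (gM S n p r p q) (gD S n p q r) \<and>
        exact_at B (gD S n p q r) (gM S (n + 1) q r p r)) \<and>
     (\<exists>N. \<forall>n p. N \<le> \<bar>p\<bar> \<longrightarrow> zero_object B (gO S n p (p + 1)))"

definition spectral_object_morphism ::
    "('b, 'c, 'y) acat_scheme \<Rightarrow> ('b, 'c) gspobj \<Rightarrow> ('b, 'c) gspobj
      \<Rightarrow> (int \<Rightarrow> int \<Rightarrow> int \<Rightarrow> 'c) \<Rightarrow> bool" where
  "spectral_object_morphism B S S' f \<longleftrightarrow> spectral_object B S \<and> spectral_object B S' \<and>
     (\<forall>n p q. p \<le> q \<longrightarrow> f n p q \<in> Hom B (gO S n p q) (gO S' n p q)) \<and>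
     (\<forall>n p q p' q'. p \<le> q \<and> p' \<le> q' \<and> p' \<le> p \<and> q' \<le> q \<longrightarrow>
        f n p' q' \<cdot>\<^bsub>B\<^esub> gM S n p q p' q' = gM S' n p q p' q' \<cdot>\<^bsub>B\<^esub> f n p q) \<and>
     (\<forall>n p q r. p \<le> q \<and> q \<le> r \<longrightarrow>
        f (n + 1) q r \<cdot>\<^bsub>B\<^esub> gD S n p q r = gD S' n p q r \<cdot>\<^bsub>B\<^esub> f n p q)"

definition translate :: "('b, 'c) gspobj \<Rightarrow> int \<Rightarrow> ('b, 'c) gspobj" where
  "translate S l = \<lparr>gO = (\<lambda>n p q. gO S n (p + l) (q + l)),
     gM = (\<lambda>n p q p' q'. gM S n (p + l) (q + l) (p' + l) (q' + l)),
     gD = (\<lambda>n p q r. gD S n (p + l) (q + l) (r + l))\<rparr>"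

text \<open>\<open>T\<^sup>n(X) = T(X[n])\<close>, on objects and on arrows.\<close>

definition TO :: "('o, 'm, 'x) tricat_scheme \<Rightarrow> ('o, 'm, 'b, 'c) functr \<Rightarrow> int \<Rightarrow> 'o \<Rightarrow> 'b" where
  "TO D T n X = onO T (onO (Sh D n) X)"

definition TM :: "('o, 'm, 'x) tricat_scheme \<Rightarrow> ('o, 'm, 'b, 'c) functr \<Rightarrow> int \<Rightarrow> 'm \<Rightarrow> 'c" where
  "TM D T n f = onM T (onM (Sh D n) f)"

definition apply_coh ::
    "('o, 'm, 'x) tricat_scheme \<Rightarrow> ('o, 'm, 'b, 'c) functr \<Rightarrow> ('o, 'm) spobj \<Rightarrow> ('b, 'c) gspobj" where
  "apply_coh D T S = \<lparr>gO = (\<lambda>n p q. TO D T n (spO S p q)),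
     gM = (\<lambda>n p q p' q'. TM D T n (spM S p q p' q')),
     gD = (\<lambda>n p q r. TM D T n (spD S p q r))\<rparr>"


section \<open>Spectral sequences\<close>

text \<open>Besides the pages \<open>ssE r p q\<close> and the differentials \<open>ssd r p q\<close>, a spectral sequence
  (starting at \<open>r = 1\<close>) records the identification of the next page with the cohomology of
  the current one: a kernel \<open>ssi r p q : Z \<rightarrow> E\<^sub>r\<^sup>p\<^sup>q\<close> of the outgoing differential, and a cokernel
  \<open>ssp r p q : Z \<rightarrow> E\<^sub>r\<^sub>+\<^sub>1\<^sup>p\<^sup>q\<close> of the map into \<open>Z\<close> induced by the incoming one.\<close>

record ('b, 'c) specseq =
  ssE :: "int \<Rightarrow> int \<Rightarrow> int \<Rightarrow> 'b"
  ssd :: "int \<Rightarrow> int \<Rightarrow> int \<Rightarrow> 'c"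
  ssi :: "int \<Rightarrow> int \<Rightarrow> int \<Rightarrow> 'c"
  ssp :: "int \<Rightarrow> int \<Rightarrow> int \<Rightarrow> 'c"

definition spectral_sequence :: "('b, 'c, 'y) acat_scheme \<Rightarrow> ('b, 'c) specseq \<Rightarrow> bool" where
  "spectral_sequence B E \<longleftrightarrow> (\<forall>r p q. 1 \<le> r \<longrightarrow>
     ssE E r p q \<in> Obj B \<and>
     ssd E r p q \<in> Hom B (ssE E r p q) (ssE E r (p + r) (q - r + 1)) \<and>
     ssd E r (p + r) (q - r + 1) \<cdot>\<^bsub>B\<^esub> ssd E r p q
       = hzero B (ssE E r p q) (ssE E r (p + r + r) (q - r + 1 - r + 1)) \<and>
     is_kernel B (ssi E r p q) (ssd E r p q) \<and>
     (\<exists>b \<in> Hom B (ssE E r (p - r) (q + r - 1)) (Dom B (ssi E r p q)).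
        ssi E r p q \<cdot>\<^bsub>B\<^esub> b = ssd E r (p - r) (q + r - 1) \<and>
        is_cokernel B (ssp E r p q) b \<and> Cod B (ssp E r p q) = ssE E (r + 1) p q))"

definition spectral_sequence_morphism ::
    "('b, 'c, 'y) acat_scheme \<Rightarrow> ('b, 'c) specseq \<Rightarrow> ('b, 'c) specseq
      \<Rightarrow> (int \<Rightarrow> int \<Rightarrow> int \<Rightarrow> 'c) \<Rightarrow> bool" where
  "spectral_sequence_morphism B E E' F \<longleftrightarrow> spectral_sequence B E \<and> spectral_sequence B E' \<and>
     (\<forall>r p q. 1 \<le> r \<longrightarrow>
        F r p q \<in> Hom B (ssE E r p q) (ssE E' r p q) \<and>
        F r (p + r) (q - r + 1) \<cdot>\<^bsub>B\<^esub> ssd E r p q = ssd E' r p q \<cdot>\<^bsub>B\<^esub> F r p q \<and>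
        (\<exists>g \<in> Hom B (Dom B (ssi E r p q)) (Dom B (ssi E' r p q)).
           ssi E' r p q \<cdot>\<^bsub>B\<^esub> g = F r p q \<cdot>\<^bsub>B\<^esub> ssi E r p q \<and>
           ssp E' r p q \<cdot>\<^bsub>B\<^esub> g = F (r + 1) p q \<cdot>\<^bsub>B\<^esub> ssp E r p q))"

text \<open>The spectral sequence of a spectral object \<open>X\<close>: the page \<open>E\<^sub>r\<^sup>p\<^sup>q\<close> is the image of
  \<open>X\<^sup>n\<^sub>p\<^sub>,\<^sub>p\<^sub>+\<^sub>r \<rightarrow> X\<^sup>n\<^sub>p\<^sub>-\<^sub>r\<^sub>+\<^sub>1\<^sub>,\<^sub>p\<^sub>+\<^sub>1\<close> with \<open>n = p + q\<close>, which for \<open>r = 1\<close> is \<open>X\<^sup>n\<^sub>p\<^sub>,\<^sub>p\<^sub>+\<^sub>1\<close> itself, and \<open>d\<^sub>r\<close>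
  is induced by the coboundary \<open>X\<^sup>n\<^sub>p\<^sub>,\<^sub>p\<^sub>+\<^sub>r \<rightarrow> X\<^sup>n\<^sup>+\<^sup>1\<^sub>p\<^sub>+\<^sub>r\<^sub>,\<^sub>p\<^sub>+\<^sub>2\<^sub>r\<close>.  The kernel of \<open>d\<^sub>r\<close> is the image of
  \<open>X\<^sup>n\<^sub>p\<^sub>,\<^sub>p\<^sub>+\<^sub>r\<^sub>+\<^sub>1 \<rightarrow> X\<^sup>n\<^sub>p\<^sub>-\<^sub>r\<^sub>+\<^sub>1\<^sub>,\<^sub>p\<^sub>+\<^sub>1\<close>.\<close>

definition so_epi :: "('b, 'c, 'y) acat_scheme \<Rightarrow> ('b, 'c) gspobj \<Rightarrow> int \<Rightarrow> int \<Rightarrow> int \<Rightarrow> 'c" where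
  "so_epi B S r p q = (if r = 1 then Ide B (gO S (p + q) p (p + 1))
     else im_epi B (gM S (p + q) p (p + r) (p - r + 1) (p + 1)))"

definition so_E :: "('b, 'c, 'y) acat_scheme \<Rightarrow> ('b, 'c) gspobj \<Rightarrow> int \<Rightarrow> int \<Rightarrow> int \<Rightarrow> 'b" where
  "so_E B S r p q = Cod B (so_epi B S r p q)"

definition so_d :: "('b, 'c, 'y) acat_scheme \<Rightarrow> ('b, 'c) gspobj \<Rightarrow> int \<Rightarrow> int \<Rightarrow> int \<Rightarrow> 'c" where
  "so_d B S r p q = (THE d. d \<in> Hom B (so_E B S r p q) (so_E B S r (p + r) (q - r + 1)) \<and>
     d \<cdot>\<^bsub>B\<^esub> so_epi B S r p q
       = so_epi B S r (p + r) (q - r + 1) \<cdot>\<^bsub>B\<^esub> gD S (p + q) p (p + r) (p + r + r))"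

definition so_Z_epi :: "('b, 'c, 'y) acat_scheme \<Rightarrow> ('b, 'c) gspobj \<Rightarrow> int \<Rightarrow> int \<Rightarrow> int \<Rightarrow> 'c" where
  "so_Z_epi B S r p q = im_epi B (gM S (p + q) p (p + r + 1) (p - r + 1) (p + 1))"

definition so_i :: "('b, 'c, 'y) acat_scheme \<Rightarrow> ('b, 'c) gspobj \<Rightarrow> int \<Rightarrow> int \<Rightarrow> int \<Rightarrow> 'c" where
  "so_i B S r p q = (THE i. i \<in> Hom B (Cod B (so_Z_epi B S r p q)) (so_E B S r p q) \<and>
     i \<cdot>\<^bsub>B\<^esub> so_Z_epi B S r p q
       = so_epi B S r p q \<cdot>\<^bsub>B\<^esub> gM S (p + q) p (p + r + 1) p (p + r))"

definition so_p :: "('b, 'c, 'y) acat_scheme \<Rightarrow> ('b, 'c) gspobj \<Rightarrow> int \<Rightarrow> int \<Rightarrow> int \<Rightarrow> 'c" where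
  "so_p B S r p q = (THE j. j \<in> Hom B (Cod B (so_Z_epi B S r p q)) (so_E B S (r + 1) p q) \<and>
     j \<cdot>\<^bsub>B\<^esub> so_Z_epi B S r p q = so_epi B S (r + 1) p q)"

definition E1 :: "('b, 'c, 'y) acat_scheme \<Rightarrow> ('b, 'c) gspobj \<Rightarrow> ('b, 'c) specseq" where
  "E1 B S = \<lparr>ssE = so_E B S, ssd = so_d B S, ssi = so_i B S, ssp = so_p B S\<rparr>"


section \<open>Filtrations\<close>

text \<open>A filtration of an object is a family of monomorphisms into it.\<close>

definition F_filtration ::
    "('o, 'm, 'x) tcat_scheme \<Rightarrow> ('b, 'c, 'y) acat_scheme \<Rightarrow> ('o, 'm, 'b, 'c) functr
      \<Rightarrow> 'o \<Rightarrow> int \<Rightarrow> int \<Rightarrow> 'c" where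
  "F_filtration D B T X n p = im_mono B (TM D T n (tle_in D (- p) X))"

definition L_filtration ::
    "('o, 'm, 'x) tcat_scheme \<Rightarrow> ('b, 'c, 'y) acat_scheme \<Rightarrow> ('o, 'm, 'b, 'c) functr
      \<Rightarrow> 'o \<Rightarrow> int \<Rightarrow> int \<Rightarrow> 'c" where
  "L_filtration D B T X n s = F_filtration D B T X n (s - n)"

definition translate_filtration :: "(int \<Rightarrow> 'c) \<Rightarrow> int \<Rightarrow> int \<Rightarrow> 'c" where
  "translate_filtration G l s = G (l + s)"

definition filtered_map ::
    "('b, 'c, 'y) cat_scheme \<Rightarrow> 'b \<Rightarrow> (int \<Rightarrow> 'c) \<Rightarrow> 'b \<Rightarrow> (int \<Rightarrow> 'c) \<Rightarrow> 'c \<Rightarrow> bool" where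
  "filtered_map B A G A' G' h \<longleftrightarrow> h \<in> Hom B A A' \<and>
     (\<forall>s. monic B (G s) \<and> Cod B (G s) = A \<and> monic B (G' s) \<and> Cod B (G' s) = A' \<and>
        (\<exists>k \<in> Hom B (Dom B (G s)) (Dom B (G' s)). G' s \<cdot>\<^bsub>B\<^esub> k = h \<cdot>\<^bsub>B\<^esub> G s))"

text \<open>Compatibility of a map of abutments \<open>g n\<close> with a morphism \<open>f\<close> of spectral objects:
  both are covered by one and the same map in the diagrams
  \<open>T\<^sup>n(X) \<leftarrow> T\<^sup>n(\<tau>\<^sub>\<le>\<^sub>-\<^sub>p X) \<rightarrow> T\<^sup>n(X\<^sub>p\<^sub>q)\<close>.  The left map defines the abutment filtration; the right one, for
  \<open>q = p + r\<close> with \<open>r\<close> large, links it to \<open>E\<^sub>\<infinity>\<close>.  The integers \<open>l\<close> and \<open>l'\<close> are the amounts by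
  which the spectral objects of \<open>X\<close> and \<open>X'\<close> are translated.\<close>

definition abutment_compatible ::
    "('b, 'c, 'y) cat_scheme
      \<Rightarrow> ('o, 'm, 'x) tcat_scheme \<Rightarrow> ('o, 'm, 'b, 'c) functr \<Rightarrow> 'o \<Rightarrow> int
      \<Rightarrow> ('p, 'n, 'z) tcat_scheme \<Rightarrow> ('p, 'n, 'b, 'c) functr \<Rightarrow> 'p \<Rightarrow> int
      \<Rightarrow> (int \<Rightarrow> int \<Rightarrow> int \<Rightarrow> 'c) \<Rightarrow> (int \<Rightarrow> 'c) \<Rightarrow> bool" where
  "abutment_compatible B D T X l D' T' X' l' f g \<longleftrightarrow> (\<forall>n p.
     \<exists>k \<in> Hom B (TO D T n (tau_le D (- (p + l)) X)) (TO D' T' n (tau_le D' (- (p + l')) X')).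
       TM D' T' n (tle_in D' (- (p + l')) X') \<cdot>\<^bsub>B\<^esub> k = g n \<cdot>\<^bsub>B\<^esub> TM D T n (tle_in D (- (p + l)) X) \<and>
       (\<forall>q \<ge> p. TM D' T' n (tsp_out D' X' (p + l') (q + l')) \<cdot>\<^bsub>B\<^esub> k
          = f n p q \<cdot>\<^bsub>B\<^esub> TM D T n (tsp_out D X (p + l) (q + l))))"


section \<open>The maps induced by an adjunction\<close>

text \<open>The canonical arrows \<open>u(\<tau>\<^sub>\<le>\<^sub>a X) \<rightarrow> \<tau>\<^sub>\<le>\<^sub>a\<^sub>+\<^sub>d(u X)\<close> and \<open>u(X\<^sub>p\<^sub>q) \<rightarrow> (u X)\<^sub>p\<^sub>-\<^sub>d\<^sub>,\<^sub>q\<^sub>-\<^sub>d\<close>, which are isomorphisms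
  when \<open>u \<circ> [d]\<close> is t-exact.\<close>

definition tle_comparison ::
    "('o, 'm, 'x) tcat_scheme \<Rightarrow> ('p, 'n, 'y) tcat_scheme \<Rightarrow> ('o, 'm, 'p, 'n) functr
      \<Rightarrow> int \<Rightarrow> 'o \<Rightarrow> int \<Rightarrow> 'n" where
  "tle_comparison D D' u d X a =
     (THE \<alpha>. \<alpha> \<in> Hom D' (onO u (tau_le D a X)) (tau_le D' (a + d) (onO u X)) \<and>
        tle_in D' (a + d) (onO u X) \<cdot>\<^bsub>D'\<^esub> \<alpha> = onM u (tle_in D a X))"

definition tsp_comparison ::
    "('o, 'm, 'x) tcat_scheme \<Rightarrow> ('p, 'n, 'y) tcat_scheme \<Rightarrow> ('o, 'm, 'p, 'n) functr
      \<Rightarrow> int \<Rightarrow> 'o \<Rightarrow> int \<Rightarrow> int \<Rightarrow> 'n" where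
  "tsp_comparison D D' u d X p q =
     (THE c. c \<in> Hom D' (onO u (tspO D X p q)) (tspO D' (onO u X) (p - d) (q - d)) \<and>
        c \<cdot>\<^bsub>D'\<^esub> onM u (tsp_out D X p q)
          = tsp_out D' (onO u X) (p - d) (q - d) \<cdot>\<^bsub>D'\<^esub> tle_comparison D D' u d X (- p))"

text \<open>For a functor \<open>v : D' \<rightarrow> D\<close> and \<open>\<theta> : T \<circ> v \<cong> T'\<close>, the isomorphism
  \<open>T(v(u(Y[n]))) \<rightarrow> T'(u(Y[n])) \<rightarrow> T'(u(Y)[n]) = T'\<^sup>n(u Y)\<close>.\<close>

definition transfer_iso ::
    "('o, 'm, 'x) tricat_scheme \<Rightarrow> ('b, 'c, 'y) cat_scheme \<Rightarrow> ('p, 'n, 'b, 'c) functr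
      \<Rightarrow> ('o, 'm, 'p, 'n) functr \<Rightarrow> (int \<Rightarrow> 'o \<Rightarrow> 'n) \<Rightarrow> ('p \<Rightarrow> 'c) \<Rightarrow> int \<Rightarrow> 'o \<Rightarrow> 'c" where
  "transfer_iso D B T' u \<phi> \<theta> n Y =
     onM T' (\<phi> n Y) \<cdot>\<^bsub>B\<^esub> \<theta> (onO u (onO (Sh D n) Y))"

end

theory Submission
  imports Defs
begin

text \<open>
  Write \<open>t\<close> for the natural map \<open>T\<^sup>n(Y) \<rightarrow> T\<^sup>n(v u Y) \<cong> T'\<^sup>n(u Y)\<close> given by the unit of the adjunction.  It
  commutes with translations because \<open>\<phi>\<close> is additive in the degree.  Since \<open>u[d]\<close> is t-exact, \<open>u\<close>
  carries the spectral object of \<open>X\<close> to that of \<open>u X\<close> translated by \<open>-d\<close>: the comparison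
  isomorphisms respect the restriction maps because \<open>\<tau>\<^sub>\<le>\<close> and \<open>\<tau>\<^sub>\<ge>\<close> are universal, and they respect the
  coboundaries because a coboundary is the only arrow that completes \<open>X\<^sub>q\<^sub>r \<rightarrow> X\<^sub>p\<^sub>r \<rightarrow> X\<^sub>p\<^sub>q\<close> to a
  distinguished triangle.  Composing the two gives the morphism of spectral objects; evaluating \<open>t\<close>
  at \<open>X\<close> and at \<open>\<tau>\<^sub>\<le>\<^sub>-\<^sub>p X\<close> gives the filtered map.  For the reversed arrows the counit takes the place of
  the unit and the isomorphisms are inverted.

  Exactness in the abelian category is used through generalised elements: a map \<open>x\<close> killed by the
  second arrow of an exact pair lifts along the first one after composition with an epimorphism.
\<close>

section \<open>Categories and functors\<close>

text \<open>As \<open>T\<^sup>n(Y) = T(Y[n])\<close>, the unit is evaluated at \<open>Y[n]\<close>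
  and the translation is afterwards moved out of \<open>u\<close> by \<phi>; translations thus have
  to pass through \<open>u\<close> only, never through \<open>v\<close>. The amount
  \<open>-d\<close> comes from \<open>u(\<tau>\<^sub>\<le>\<^sub>-\<^sub>p X) =
  \<tau>\<^sub>\<le>\<^sub>-\<^sub>(\<^sub>p\<^sub>-\<^sub>d\<^sub>)(u X)\<close>. Truncations and
  images are chosen, so squares never commute by mere equality of objects: each comparison is pinned
  down by a universal property and each square is checked after composition with the arrow that
  determines it. A translate of a distinguished triangle is distinguished only up to the sign of its
  third arrow, whereas the coboundaries of \<open>T(X)\<close> carry no sign; this is harmless
  because exactness does not see signs. For the spectral sequence, differentials, inclusions of
  cycles and projections to the next page are all maps of images induced by commutative squares.
  They are therefore unique and functorial, and real diagram chases are needed only for the kernel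
  and the cokernel of \<open>d_r\<close>.\<close>

lemma mem_Hom [simp]: "f \<in> Hom C x y \<longleftrightarrow> f \<in> Arr C \<and> Dom C f = x \<and> Cod C f = y"
  by (simp add: Hom_def)

definition arr_inv :: "('o, 'm, 'x) cat_scheme \<Rightarrow> 'm \<Rightarrow> 'm" where
  "arr_inv C f = (SOME g. g \<in> Hom C (Cod C f) (Dom C f) \<and>
     g \<cdot>\<^bsub>C\<^esub> f = Ide C (Dom C f) \<and> f \<cdot>\<^bsub>C\<^esub> g = Ide C (Cod C f))"

lemma isomor_arr_inv:
  assumes "isomor C f"
  shows "f \<in> Arr C" "arr_inv C f \<in> Arr C"
    "Dom C (arr_inv C f) = Cod C f" "Cod C (arr_inv C f) = Dom C f"
    "arr_inv C f \<cdot>\<^bsub>C\<^esub> f = Ide C (Dom C f)" "f \<cdot>\<^bsub>C\<^esub> arr_inv C f = Ide C (Cod C f)"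
proof -
  have "\<exists>g. g \<in> Hom C (Cod C f) (Dom C f) \<and>
     g \<cdot>\<^bsub>C\<^esub> f = Ide C (Dom C f) \<and> f \<cdot>\<^bsub>C\<^esub> g = Ide C (Cod C f)"
    using assms unfolding isomor_def by blast
  then have "arr_inv C f \<in> Hom C (Cod C f) (Dom C f) \<and>
     arr_inv C f \<cdot>\<^bsub>C\<^esub> f = Ide C (Dom C f) \<and> f \<cdot>\<^bsub>C\<^esub> arr_inv C f = Ide C (Cod C f)"
    unfolding arr_inv_def by (rule someI_ex)
  then show "f \<in> Arr C" "arr_inv C f \<in> Arr C"
    "Dom C (arr_inv C f) = Cod C f" "Cod C (arr_inv C f) = Dom C f"
    "arr_inv C f \<cdot>\<^bsub>C\<^esub> f = Ide C (Dom C f)" "f \<cdot>\<^bsub>C\<^esub> arr_inv C f = Ide C (Cod C f)"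
    using assms by (auto simp: isomor_def)
qed

context category
begin

lemma Dom_Obj [simp]: "f \<in> Arr C \<Longrightarrow> Dom C f \<in> Obj C"
  by (rule dom_Obj)

lemma Cod_Obj [simp]: "f \<in> Arr C \<Longrightarrow> Cod C f \<in> Obj C"
  by (rule cod_Obj)

lemma Ide_simps [simp]:
  assumes "x \<in> Obj C"
  shows "Ide C x \<in> Arr C" "Dom C (Ide C x) = x" "Cod C (Ide C x) = x"
  using ide_Hom[OF assms] by auto

lemma comp_simps [simp]:
  assumes "f \<in> Arr C" "g \<in> Arr C" "Dom C g = Cod C f"
  shows "g \<cdot> f \<in> Arr C" "Dom C (g \<cdot> f) = Dom C f" "Cod C (g \<cdot> f) = Cod C g"
  using comp_Hom[of f "Dom C f" "Cod C f" g "Cod C g"] assms by auto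

lemma comp_assoc_simp [simp]:
  assumes "f \<in> Arr C" "g \<in> Arr C" "h \<in> Arr C" "Dom C g = Cod C f" "Dom C h = Cod C g"
  shows "(h \<cdot> g) \<cdot> f = h \<cdot> (g \<cdot> f)"
  using comp_assoc[of f "Dom C f" "Cod C f" g "Cod C g" h "Cod C h"] assms by auto

lemma comp_Ide [simp]:
  assumes "f \<in> Arr C"
  shows "Cod C f = x \<Longrightarrow> Ide C x \<cdot> f = f" "Dom C f = x \<Longrightarrow> f \<cdot> Ide C x = f"
  using ide_left[of f "Dom C f" "Cod C f"] ide_right[of f "Dom C f" "Cod C f"] assms by auto

text \<open>Turns \<open>g \<cdot> f = k\<close> into a rewrite rule for right-nested composites.\<close>

lemma comp_reassoc:
  assumes "g \<cdot> f = k" "f \<in> Arr C" "g \<in> Arr C" "Dom C g = Cod C f" "x \<in> Arr C" "Cod C x = Dom C f"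
  shows "g \<cdot> (f \<cdot> x) = k \<cdot> x"
  using assms by (metis comp_assoc_simp)

lemma epicD:
  assumes "epic C f" "g \<cdot> f = h \<cdot> f" "g \<in> Arr C" "h \<in> Arr C"
    "Dom C g = Cod C f" "Dom C h = Cod C f" "Cod C g = Cod C h"
  shows "g = h"
  using assms unfolding epic_def by fastforce

lemma monicD:
  assumes "monic C f" "f \<cdot> g = f \<cdot> h" "g \<in> Arr C" "h \<in> Arr C"
    "Cod C g = Dom C f" "Cod C h = Dom C f" "Dom C g = Dom C h"
  shows "g = h"
  using assms unfolding monic_def by fastforce

lemma epic_Arr: "epic C f \<Longrightarrow> f \<in> Arr C"
  by (simp add: epic_def)

lemma monic_Arr: "monic C f \<Longrightarrow> f \<in> Arr C"
  by (simp add: monic_def)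

lemma monicI:
  assumes "f \<in> Arr C"
    and "\<And>g h. \<lbrakk>g \<in> Arr C; h \<in> Arr C; Cod C g = Dom C f; Cod C h = Dom C f; Dom C g = Dom C h;
      f \<cdot> g = f \<cdot> h\<rbrakk> \<Longrightarrow> g = h"
  shows "monic C f"
  using assms unfolding monic_def by simp

lemma epicI:
  assumes "f \<in> Arr C"
    and "\<And>g h. \<lbrakk>g \<in> Arr C; h \<in> Arr C; Dom C g = Cod C f; Dom C h = Cod C f; Cod C g = Cod C h;
      g \<cdot> f = h \<cdot> f\<rbrakk> \<Longrightarrow> g = h"
  shows "epic C f"
  using assms unfolding epic_def by simp

lemma Ide_monic: "x \<in> Obj C \<Longrightarrow> monic C (Ide C x)"
  by (rule monicI) auto

lemma Ide_epic: "x \<in> Obj C \<Longrightarrow> epic C (Ide C x)"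
  by (rule epicI) auto

lemma monic_comp:
  assumes "monic C f" "monic C g" "Dom C g = Cod C f"
  shows "monic C (g \<cdot> f)"
proof -
  have A: "f \<in> Arr C" "g \<in> Arr C"
    using assms by (auto simp: monic_Arr)
  show ?thesis
  proof (rule monicI)
    fix a b
    assume *: "a \<in> Arr C" "b \<in> Arr C" "Cod C a = Dom C (g \<cdot> f)" "Cod C b = Dom C (g \<cdot> f)"
      "Dom C a = Dom C b" "(g \<cdot> f) \<cdot> a = (g \<cdot> f) \<cdot> b"
    then have "g \<cdot> (f \<cdot> a) = g \<cdot> (f \<cdot> b)"
      using A assms(3) by simp
    then have "f \<cdot> a = f \<cdot> b"
      by (rule monicD[OF assms(2)]) (use A assms(3) * in auto)
    then show "a = b"
      by (rule monicD[OF assms(1)]) (use A assms(3) * in auto)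
  qed (use A assms(3) in auto)
qed

lemma epic_comp:
  assumes "epic C f" "epic C g" "Dom C g = Cod C f"
  shows "epic C (g \<cdot> f)"
proof -
  have A: "f \<in> Arr C" "g \<in> Arr C"
    using assms by (auto simp: epic_Arr)
  show ?thesis
  proof (rule epicI)
    fix a b
    assume *: "a \<in> Arr C" "b \<in> Arr C" "Dom C a = Cod C (g \<cdot> f)" "Dom C b = Cod C (g \<cdot> f)"
      "Cod C a = Cod C b" "a \<cdot> (g \<cdot> f) = b \<cdot> (g \<cdot> f)"
    then have "(a \<cdot> g) \<cdot> f = (b \<cdot> g) \<cdot> f"
      using A assms(3) by simp
    then have "a \<cdot> g = b \<cdot> g"
      by (rule epicD[OF assms(1)]) (use A assms(3) * in auto)
    then show "a = b"
      by (rule epicD[OF assms(2)]) (use A assms(3) * in auto)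
  qed (use A assms(3) in auto)
qed

lemma monic_cancel:
  assumes "monic C (g \<cdot> f)" "f \<in> Arr C" "g \<in> Arr C" "Dom C g = Cod C f"
  shows "monic C f"
proof (rule monicI[OF assms(2)])
  fix a b
  assume *: "a \<in> Arr C" "b \<in> Arr C" "Cod C a = Dom C f" "Cod C b = Dom C f"
    "Dom C a = Dom C b" "f \<cdot> a = f \<cdot> b"
  then have "(g \<cdot> f) \<cdot> a = (g \<cdot> f) \<cdot> b"
    using assms by simp
  then show "a = b"
    by (rule monicD[OF assms(1)]) (use assms * in auto)
qed

lemma epic_cancel:
  assumes "epic C (g \<cdot> f)" "f \<in> Arr C" "g \<in> Arr C" "Dom C g = Cod C f"
  shows "epic C g"
proof (rule epicI[OF assms(3)])
  fix a b
  assume *: "a \<in> Arr C" "b \<in> Arr C" "Dom C a = Cod C g" "Dom C b = Cod C g"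
    "Cod C a = Cod C b" "a \<cdot> g = b \<cdot> g"
  then have "a \<cdot> (g \<cdot> f) = b \<cdot> (g \<cdot> f)"
    using assms by (metis comp_assoc_simp)
  then show "a = b"
    by (rule epicD[OF assms(1)]) (use assms * in auto)
qed

lemma isomorI:
  assumes "f \<in> Arr C" "g \<in> Arr C" "Dom C g = Cod C f" "Cod C g = Dom C f"
    "g \<cdot> f = Ide C (Dom C f)" "f \<cdot> g = Ide C (Cod C f)"
  shows "isomor C f"
  using assms unfolding isomor_def by auto

lemma isomor_arr_inv_isomor: "isomor C f \<Longrightarrow> isomor C (arr_inv C f)"
  by (rule isomorI[where g = f]) (auto simp: isomor_arr_inv)

lemma isomor_epic:
  assumes "isomor C f"
  shows "epic C f"
proof (rule epicI)
  note f = isomor_arr_inv[OF assms]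
  show "f \<in> Arr C"
    by (rule f)
  fix a b
  assume *: "a \<in> Arr C" "b \<in> Arr C" "Dom C a = Cod C f" "Dom C b = Cod C f"
    "Cod C a = Cod C b" "a \<cdot> f = b \<cdot> f"
  have "a = (a \<cdot> f) \<cdot> arr_inv C f"
    using f *(1,3) by simp
  also have "\<dots> = b"
    unfolding *(6) using f *(2,4) by simp
  finally show "a = b" .
qed

lemma isomor_Ide: "x \<in> Obj C \<Longrightarrow> isomor C (Ide C x)"
  by (rule isomorI[where g = "Ide C x"]) auto

lemma isomor_comp:
  assumes "isomor C f" "isomor C g" "Dom C g = Cod C f"
  shows "isomor C (g \<cdot> f)"
proof (rule isomorI[where g = "arr_inv C f \<cdot> arr_inv C g"])
  note [simp] = isomor_arr_inv[OF assms(1)] isomor_arr_inv[OF assms(2)]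
  have "arr_inv C g \<cdot> (g \<cdot> f) = f"
    using comp_reassoc[OF isomor_arr_inv(5)[OF assms(2)], of f] assms(3) by simp
  then show "(arr_inv C f \<cdot> arr_inv C g) \<cdot> (g \<cdot> f) = Ide C (Dom C (g \<cdot> f))"
    using assms(3) by simp
  have "f \<cdot> (arr_inv C f \<cdot> arr_inv C g) = arr_inv C g"
    using comp_reassoc[OF isomor_arr_inv(6)[OF assms(1)], of "arr_inv C g"] assms(3) by simp
  then show "(g \<cdot> f) \<cdot> (arr_inv C f \<cdot> arr_inv C g) = Ide C (Cod C (g \<cdot> f))"
    using assms(3) by simp
qed (use isomor_arr_inv[OF assms(1)] isomor_arr_inv[OF assms(2)] assms(3) in auto)

end

section \<open>Additive categories\<close>

definition hsub :: "('o, 'm, 'x) acat_scheme \<Rightarrow> 'm \<Rightarrow> 'm \<Rightarrow> 'm" where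
  "hsub C f g = hadd C f (hneg C g)"

context additive_category
begin

lemma hzero_simps [simp]:
  assumes "x \<in> Obj C" "y \<in> Obj C"
  shows "hzero C x y \<in> Arr C" "Dom C (hzero C x y) = x" "Cod C (hzero C x y) = y"
proof -
  interpret G: comm_group "hom_group C x y"
    using assms by (rule hom_comm_group)
  show "hzero C x y \<in> Arr C" "Dom C (hzero C x y) = x" "Cod C (hzero C x y) = y"
    using G.one_closed by (auto simp: hom_group_def)
qed

lemma hadd_simps [simp]:
  assumes "f \<in> Arr C" "g \<in> Arr C" "Dom C f = Dom C g" "Cod C f = Cod C g"
  shows "hadd C f g \<in> Arr C" "Dom C (hadd C f g) = Dom C g" "Cod C (hadd C f g) = Cod C g"
proof -
  interpret G: comm_group "hom_group C (Dom C g) (Cod C g)"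
    using assms by (intro hom_comm_group) auto
  show "hadd C f g \<in> Arr C" "Dom C (hadd C f g) = Dom C g" "Cod C (hadd C f g) = Cod C g"
    using G.m_closed[of f g] assms by (auto simp: hom_group_def)
qed

lemma hneg_simps [simp]:
  assumes "f \<in> Arr C"
  shows "hneg C f \<in> Arr C" "Dom C (hneg C f) = Dom C f" "Cod C (hneg C f) = Cod C f"
    "hadd C f (hneg C f) = hzero C (Dom C f) (Cod C f)"
    "hneg C (hneg C f) = f"
proof -
  interpret G: comm_group "hom_group C (Dom C f) (Cod C f)"
    using assms by (intro hom_comm_group) auto
  have f: "f \<in> carrier (hom_group C (Dom C f) (Cod C f))"
    using assms by (simp add: hom_group_def)
  show n: "hneg C f \<in> Arr C" "Dom C (hneg C f) = Dom C f" "Cod C (hneg C f) = Cod C f"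
    using G.inv_closed[OF f] by (auto simp: hom_group_def hneg_def)
  show "hadd C f (hneg C f) = hzero C (Dom C f) (Cod C f)"
    using G.r_inv[OF f] by (auto simp: hom_group_def hneg_def)
  show "hneg C (hneg C f) = f"
    using G.inv_inv[OF f] n by (simp add: hneg_def)
qed

lemma hadd_left_cancel:
  assumes "f \<in> Arr C" "g \<in> Arr C" "h \<in> Arr C" "Dom C f = Dom C g" "Cod C f = Cod C g"
    "Dom C h = Dom C g" "Cod C h = Cod C g" "hadd C f g = hadd C f h"
  shows "g = h"
proof -
  interpret G: comm_group "hom_group C (Dom C g) (Cod C g)"
    using assms by (intro hom_comm_group) auto
  show ?thesis
    using G.Units_l_cancel[of f g h] G.Units_eq assms by (auto simp: hom_group_def)
qed

lemma hadd_hzero: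
  assumes "f \<in> Arr C" "Dom C f = x" "Cod C f = y"
  shows "hadd C f (hzero C x y) = f" "hadd C (hzero C x y) f = f"
proof -
  interpret G: comm_group "hom_group C (Dom C f) (Cod C f)"
    using assms by (intro hom_comm_group) auto
  show "hadd C f (hzero C x y) = f" "hadd C (hzero C x y) f = f"
    using G.r_one[of f] G.l_one[of f] assms by (auto simp: hom_group_def)
qed

lemma comp_hadd:
  "\<lbrakk>f \<in> Arr C; g \<in> Arr C; g' \<in> Arr C; Dom C g = Cod C f; Dom C g' = Dom C g; Cod C g' = Cod C g\<rbrakk>
    \<Longrightarrow> hadd C g g' \<cdot> f = hadd C (g \<cdot> f) (g' \<cdot> f)"
  "\<lbrakk>f \<in> Arr C; f' \<in> Arr C; g \<in> Arr C; Dom C g = Cod C f; Dom C f' = Dom C f; Cod C f' = Cod C f\<rbrakk>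
    \<Longrightarrow> g \<cdot> hadd C f f' = hadd C (g \<cdot> f) (g \<cdot> f')"
  using comp_add_left[of f "Dom C f" "Cod C f" g "Cod C g" g']
    comp_add_right[of f "Dom C f" "Cod C f" f' g "Cod C g"] by auto

text \<open>The unit is the only idempotent of a group. This is how composites with a zero arrow,
  and images of zero arrows under additive functors, are seen to vanish.\<close>

lemma hadd_idem:
  assumes "f \<in> Arr C" "Dom C f = x" "Cod C f = y" "hadd C f f = f"
  shows "f = hzero C x y"
  using hadd_left_cancel[of f f "hzero C x y"] assms by (auto simp: hadd_hzero)

lemma comp_hzero [simp]:
  assumes "f \<in> Arr C" "x \<in> Obj C"
  shows "Cod C f = y \<Longrightarrow> hzero C y x \<cdot> f = hzero C (Dom C f) x"
    "Dom C f = y \<Longrightarrow> f \<cdot> hzero C x y = hzero C x (Cod C f)"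
proof -
  assume y: "Cod C f = y"
  then have "hzero C y x \<cdot> f = hadd C (hzero C y x) (hzero C y x) \<cdot> f"
    using assms by (auto simp: hadd_hzero)
  also have "\<dots> = hadd C (hzero C y x \<cdot> f) (hzero C y x \<cdot> f)"
    using assms y by (intro comp_hadd) auto
  finally have "hadd C (hzero C y x \<cdot> f) (hzero C y x \<cdot> f) = hzero C y x \<cdot> f"
    by (rule sym)
  then show "hzero C y x \<cdot> f = hzero C (Dom C f) x"
    by (intro hadd_idem) (use assms y in auto)
next
  assume y: "Dom C f = y"
  then have "f \<cdot> hzero C x y = f \<cdot> hadd C (hzero C x y) (hzero C x y)"
    using assms by (auto simp: hadd_hzero)
  also have "\<dots> = hadd C (f \<cdot> hzero C x y) (f \<cdot> hzero C x y)"
    using assms y by (intro comp_hadd) auto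
  finally have "hadd C (f \<cdot> hzero C x y) (f \<cdot> hzero C x y) = f \<cdot> hzero C x y"
    by (rule sym)
  then show "f \<cdot> hzero C x y = hzero C x (Cod C f)"
    by (intro hadd_idem) (use assms y in auto)
qed

lemma hneg_unique:
  assumes "f \<in> Arr C" "g \<in> Arr C" "Dom C g = Dom C f" "Cod C g = Cod C f"
    "hadd C f g = hzero C (Dom C f) (Cod C f)"
  shows "g = hneg C f"
  using hadd_left_cancel[of f g "hneg C f"] assms by auto

lemma comp_hneg [simp]:
  assumes "f \<in> Arr C" "g \<in> Arr C" "Dom C g = Cod C f"
  shows "hneg C g \<cdot> f = hneg C (g \<cdot> f)" "g \<cdot> hneg C f = hneg C (g \<cdot> f)"
  by (rule hneg_unique; use assms in \<open>simp flip: comp_hadd\<close>)+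

lemma hsub_simps [simp]:
  assumes "f \<in> Arr C" "g \<in> Arr C" "Dom C f = Dom C g" "Cod C f = Cod C g"
  shows "hsub C f g \<in> Arr C" "Dom C (hsub C f g) = Dom C g" "Cod C (hsub C f g) = Cod C g"
  using assms by (auto simp: hsub_def)

lemma comp_hsub:
  "\<lbrakk>f \<in> Arr C; g \<in> Arr C; g' \<in> Arr C; Dom C g = Cod C f; Dom C g' = Dom C g; Cod C g' = Cod C g\<rbrakk>
    \<Longrightarrow> hsub C g g' \<cdot> f = hsub C (g \<cdot> f) (g' \<cdot> f)"
  "\<lbrakk>f \<in> Arr C; f' \<in> Arr C; g \<in> Arr C; Dom C g = Cod C f; Dom C f' = Dom C f; Cod C f' = Cod C f\<rbrakk>
    \<Longrightarrow> g \<cdot> hsub C f f' = hsub C (g \<cdot> f) (g \<cdot> f')"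
  by (auto simp: hsub_def comp_hadd)

lemma hsub_self: "\<lbrakk>f \<in> Arr C; Dom C f = x; Cod C f = y\<rbrakk> \<Longrightarrow> hsub C f f = hzero C x y"
  by (auto simp: hsub_def)

lemma hsub_hzero: "\<lbrakk>f \<in> Arr C; Dom C f = x; Cod C f = y\<rbrakk> \<Longrightarrow> hsub C f (hzero C x y) = f"
  using hneg_unique[of "hzero C x y" "hzero C x y"] by (auto simp: hsub_def hadd_hzero)

lemma hneg_hzero [simp]: "\<lbrakk>x \<in> Obj C; y \<in> Obj C\<rbrakk> \<Longrightarrow> hneg C (hzero C x y) = hzero C x y"
  using hneg_unique[of "hzero C x y" "hzero C x y"] by (simp add: hadd_hzero)

lemma hsub_eq_hzero:
  assumes "f \<in> Arr C" "g \<in> Arr C" "Dom C f = Dom C g" "Cod C f = Cod C g"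
    "hsub C f g = hzero C (Dom C g) (Cod C g)"
  shows "f = g"
  using hneg_unique[of f "hneg C g"] assms unfolding hsub_def
  by (metis hneg_simps(1,2,3,5))

lemma monicI_zero:
  assumes "f \<in> Arr C"
    and "\<And>g. \<lbrakk>g \<in> Arr C; Cod C g = Dom C f; f \<cdot> g = hzero C (Dom C g) (Cod C f)\<rbrakk>
      \<Longrightarrow> g = hzero C (Dom C g) (Dom C f)"
  shows "monic C f"
proof (rule monicI[OF assms(1)])
  fix g h
  assume *: "g \<in> Arr C" "h \<in> Arr C" "Cod C g = Dom C f" "Cod C h = Dom C f" "Dom C g = Dom C h"
    "f \<cdot> g = f \<cdot> h"
  have s: "hsub C g h \<in> Arr C" "Dom C (hsub C g h) = Dom C h" "Cod C (hsub C g h) = Dom C f"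
    using *(1-5) by auto
  have "f \<cdot> hsub C g h = hsub C (f \<cdot> h) (f \<cdot> h)"
    using comp_hsub(2)[of h g f] comp_hsub(2)[of g h f] *(1-5) assms(1) by (simp add: *(6))
  also have "\<dots> = hzero C (Dom C (hsub C g h)) (Cod C f)"
    unfolding s(2) using assms(1) *(2,4) by (intro hsub_self) auto
  finally have z: "hsub C g h = hzero C (Dom C h) (Cod C h)"
    using assms(2)[OF s(1,3)] s(2) *(4) by simp
  show "g = h"
    by (rule hsub_eq_hzero) (use *(1-5) z in auto)
qed

lemma epicI_zero:
  assumes "f \<in> Arr C"
    and "\<And>g. \<lbrakk>g \<in> Arr C; Dom C g = Cod C f; g \<cdot> f = hzero C (Dom C f) (Cod C g)\<rbrakk>
      \<Longrightarrow> g = hzero C (Cod C f) (Cod C g)"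
  shows "epic C f"
proof (rule epicI[OF assms(1)])
  fix g h
  assume *: "g \<in> Arr C" "h \<in> Arr C" "Dom C g = Cod C f" "Dom C h = Cod C f" "Cod C g = Cod C h"
    "g \<cdot> f = h \<cdot> f"
  have s: "hsub C g h \<in> Arr C" "Dom C (hsub C g h) = Cod C f" "Cod C (hsub C g h) = Cod C h"
    using *(1-5) by auto
  have "hsub C g h \<cdot> f = hsub C (h \<cdot> f) (h \<cdot> f)"
    using comp_hsub(1)[of f h g] comp_hsub(1)[of f g h] *(1-5) assms(1) by (simp add: *(6))
  also have "\<dots> = hzero C (Dom C f) (Cod C (hsub C g h))"
    unfolding s(3) using assms(1) *(2,4) by (intro hsub_self) auto
  finally have z: "hsub C g h = hzero C (Dom C h) (Cod C h)"
    using assms(2)[OF s(1,2)] s(3) *(4) by simp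
  show "g = h"
    by (rule hsub_eq_hzero) (use *(1-5) z in auto)
qed

lemma epicD_zero:
  assumes "epic C f" "g \<cdot> f = hzero C (Dom C f) (Cod C g)" "g \<in> Arr C" "Dom C g = Cod C f"
  shows "g = hzero C (Dom C g) (Cod C g)"
  by (rule epicD[OF assms(1)]) (use assms epic_Arr[OF assms(1)] in auto)

lemma monicD_zero:
  assumes "monic C f" "f \<cdot> g = hzero C (Dom C g) (Cod C f)" "g \<in> Arr C" "Cod C g = Dom C f"
  shows "g = hzero C (Dom C g) (Cod C g)"
  by (rule monicD[OF assms(1)]) (use assms monic_Arr[OF assms(1)] in auto)

lemma is_kernelD:
  assumes "is_kernel C k f"
  shows "f \<in> Arr C" "k \<in> Arr C" "Cod C k = Dom C f" "f \<cdot> k = hzero C (Dom C k) (Cod C f)"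
    "monic C k"
proof -
  show *: "f \<in> Arr C" "k \<in> Arr C" "Cod C k = Dom C f" "f \<cdot> k = hzero C (Dom C k) (Cod C f)"
    using assms by (auto simp: is_kernel_def)
  show "monic C k"
  proof (rule monicI_zero[OF *(2)])
    fix g
    assume g: "g \<in> Arr C" "Cod C g = Dom C k" "k \<cdot> g = hzero C (Dom C g) (Cod C k)"
    have "\<exists>!h. h \<in> Hom C (Dom C g) (Dom C k) \<and> k \<cdot> h = hzero C (Dom C g) (Dom C f)"
      using assms g(1) * unfolding is_kernel_def by auto
    moreover have "hzero C (Dom C g) (Dom C k) \<in> Hom C (Dom C g) (Dom C k) \<and>
        k \<cdot> hzero C (Dom C g) (Dom C k) = hzero C (Dom C g) (Dom C f)"
      "g \<in> Hom C (Dom C g) (Dom C k) \<and> k \<cdot> g = hzero C (Dom C g) (Dom C f)"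
      using g * by auto
    ultimately show "g = hzero C (Dom C g) (Dom C k)"
      by blast
  qed
qed

lemma is_kernel_factor:
  assumes "is_kernel C k f" "g \<in> Arr C" "Cod C g = Dom C f" "f \<cdot> g = hzero C (Dom C g) (Cod C f)"
  obtains h where "h \<in> Arr C" "Dom C h = Dom C g" "Cod C h = Dom C k" "k \<cdot> h = g"
proof -
  have "\<exists>!h. h \<in> Hom C (Dom C g) (Dom C k) \<and> k \<cdot> h = g"
    using assms(1) unfolding is_kernel_def using assms(2-4) by simp
  then show thesis
    using that by auto
qed

lemma is_kernelI:
  assumes "f \<in> Arr C" "monic C k" "Cod C k = Dom C f" "f \<cdot> k = hzero C (Dom C k) (Cod C f)"
    and "\<And>g. \<lbrakk>g \<in> Arr C; Cod C g = Dom C f; f \<cdot> g = hzero C (Dom C g) (Cod C f)\<rbrakk>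
      \<Longrightarrow> \<exists>h \<in> Arr C. Dom C h = Dom C g \<and> Cod C h = Dom C k \<and> k \<cdot> h = g"
  shows "is_kernel C k f"
  unfolding is_kernel_def
proof (intro conjI ballI impI)
  fix w g
  assume "g \<in> Hom C w (Dom C f)" "f \<cdot> g = hzero C w (Cod C f)"
  then have "g \<in> Arr C" "Cod C g = Dom C f" "f \<cdot> g = hzero C (Dom C g) (Cod C f)" "w = Dom C g"
    by auto
  then obtain h where h: "h \<in> Arr C" "Dom C h = w" "Cod C h = Dom C k" "k \<cdot> h = g"
    using assms(5) by metis
  show "\<exists>!h. h \<in> Hom C w (Dom C k) \<and> k \<cdot> h = g"
  proof (rule ex1I[of _ h])
    fix h'
    assume h': "h' \<in> Hom C w (Dom C k) \<and> k \<cdot> h' = g"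
    show "h' = h"
      by (rule monicD[OF assms(2)]) (use h h' in auto)
  qed (use h in auto)
qed (use assms monic_Arr in auto)

lemma is_cokernelD:
  assumes "is_cokernel C k f"
  shows "f \<in> Arr C" "k \<in> Arr C" "Dom C k = Cod C f" "k \<cdot> f = hzero C (Dom C f) (Cod C k)"
    "epic C k"
proof -
  show *: "f \<in> Arr C" "k \<in> Arr C" "Dom C k = Cod C f" "k \<cdot> f = hzero C (Dom C f) (Cod C k)"
    using assms by (auto simp: is_cokernel_def)
  show "epic C k"
  proof (rule epicI_zero[OF *(2)])
    fix g
    assume g: "g \<in> Arr C" "Dom C g = Cod C k" "g \<cdot> k = hzero C (Dom C k) (Cod C g)"
    have "\<exists>!h. h \<in> Hom C (Cod C k) (Cod C g) \<and> h \<cdot> k = hzero C (Cod C f) (Cod C g)"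
      using assms g(1) * unfolding is_cokernel_def by auto
    moreover have "hzero C (Cod C k) (Cod C g) \<in> Hom C (Cod C k) (Cod C g) \<and>
        hzero C (Cod C k) (Cod C g) \<cdot> k = hzero C (Cod C f) (Cod C g)"
      "g \<in> Hom C (Cod C k) (Cod C g) \<and> g \<cdot> k = hzero C (Cod C f) (Cod C g)"
      using g * by auto
    ultimately show "g = hzero C (Cod C k) (Cod C g)"
      by blast
  qed
qed

lemma is_cokernel_factor:
  assumes "is_cokernel C k f" "g \<in> Arr C" "Dom C g = Cod C f" "g \<cdot> f = hzero C (Dom C f) (Cod C g)"
  obtains h where "h \<in> Arr C" "Dom C h = Cod C k" "Cod C h = Cod C g" "h \<cdot> k = g"
proof -
  have "\<exists>!h. h \<in> Hom C (Cod C k) (Cod C g) \<and> h \<cdot> k = g"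
    using assms(1) unfolding is_cokernel_def using assms(2-4) by simp
  then show thesis
    using that by auto
qed

lemma is_cokernelI:
  assumes "f \<in> Arr C" "epic C k" "Dom C k = Cod C f" "k \<cdot> f = hzero C (Dom C f) (Cod C k)"
    and "\<And>g. \<lbrakk>g \<in> Arr C; Dom C g = Cod C f; g \<cdot> f = hzero C (Dom C f) (Cod C g)\<rbrakk>
      \<Longrightarrow> \<exists>h \<in> Arr C. Dom C h = Cod C k \<and> Cod C h = Cod C g \<and> h \<cdot> k = g"
  shows "is_cokernel C k f"
  unfolding is_cokernel_def
proof (intro conjI ballI impI)
  fix w g
  assume "g \<in> Hom C (Cod C f) w" "g \<cdot> f = hzero C (Dom C f) w"
  then have "g \<in> Arr C" "Dom C g = Cod C f" "g \<cdot> f = hzero C (Dom C f) (Cod C g)" "w = Cod C g"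
    by auto
  then obtain h where h: "h \<in> Arr C" "Dom C h = Cod C k" "Cod C h = w" "h \<cdot> k = g"
    using assms(5) by metis
  show "\<exists>!h. h \<in> Hom C (Cod C k) w \<and> h \<cdot> k = g"
  proof (rule ex1I[of _ h])
    fix h'
    assume h': "h' \<in> Hom C (Cod C k) w \<and> h' \<cdot> k = g"
    show "h' = h"
      by (rule epicD[OF assms(2)]) (use h h' in auto)
  qed (use h in auto)
qed (use assms epic_Arr in auto)

text \<open>Every arrow into or out of \<open>x\<close> factors through its identity. In this
  equational form the property passes along isomorphisms and additive functors.\<close>

lemma zero_object_iff_Ide:
  assumes "x \<in> Obj C"
  shows "zero_object C x \<longleftrightarrow> Ide C x = hzero C x x"
proof
  assume "zero_object C x"
  then have "\<exists>!f. f \<in> Hom C x x"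
    using assms by (simp add: zero_object_def)
  moreover have "Ide C x \<in> Hom C x x" "hzero C x x \<in> Hom C x x"
    using assms by auto
  ultimately show "Ide C x = hzero C x x"
    by blast
next
  assume *: "Ide C x = hzero C x x"
  have "f = hzero C x y" if "f \<in> Hom C x y" for f y
    using that comp_Ide(2)[of f x] comp_hzero(2)[of f x x] * assms by auto
  moreover have "f = hzero C y x" if "f \<in> Hom C y x" for f y
    using that comp_Ide(1)[of f x] comp_hzero(1)[of f x x] * assms by auto
  ultimately show "zero_object C x"
    unfolding zero_object_def using assms by (metis hzero_simps mem_Hom)
qed

lemma zero_object_isomor:
  assumes "isomor C f" "zero_object C (Dom C f)"
  shows "zero_object C (Cod C f)"
proof -
  note f = isomor_arr_inv[OF assms(1)]
  have "Ide C (Dom C f) = hzero C (Dom C f) (Dom C f)"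
    using assms f(1) zero_object_iff_Ide[of "Dom C f"] by simp
  moreover have "f \<cdot> (Ide C (Dom C f) \<cdot> arr_inv C f) = Ide C (Cod C f)"
    using f by simp
  ultimately have "Ide C (Cod C f) = hzero C (Cod C f) (Cod C f)"
    using f by simp
  then show ?thesis
    using f by (simp add: zero_object_iff_Ide)
qed

end

section \<open>Abelian categories\<close>

context abelian_category
begin

text \<open>An epimorphism is the cokernel of some \<open>f\<close>, and this \<open>f\<close> is
  one of the arrows \<open>x\<close> killed by \<open>j\<close>. The hypothesis thus gives that
  \<open>g\<close> kills \<open>f\<close>, and \<open>g\<close> descends along
  \<open>j\<close>.\<close>

lemma epic_factor:
  assumes "epic C j" "g \<in> Arr C" "Dom C g = Dom C j"
    and "\<And>x. \<lbrakk>x \<in> Arr C; Cod C x = Dom C j; j \<cdot> x = hzero C (Dom C x) (Cod C j)\<rbrakk>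
      \<Longrightarrow> g \<cdot> x = hzero C (Dom C x) (Cod C g)"
  obtains h where "h \<in> Arr C" "Dom C h = Cod C j" "Cod C h = Cod C g" "h \<cdot> j = g"
proof -
  obtain f where f: "is_cokernel C j f"
    using epic_normal[OF assms(1)] by blast
  note jf = is_cokernelD[OF f]
  have "g \<cdot> f = hzero C (Dom C f) (Cod C g)"
    using assms jf by auto
  then show thesis
    using is_cokernel_factor[OF f assms(2)] assms(3) jf(3) that by metis
qed

text \<open>Factoring through a subobject may be tested on a cover: \<open>i\<close> is the kernel
  of some \<open>c\<close>, and \<open>c \<cdot> g\<close> vanishes because it vanishes after the
  epimorphism \<open>e\<close>. This turns lifts that exist only locally into honest ones.\<close>

lemma monic_factor_locally:
  assumes "monic C i" "epic C e" "g \<in> Arr C" "Cod C g = Cod C i" "Cod C e = Dom C g"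
    "y \<in> Arr C" "Dom C y = Dom C e" "Cod C y = Dom C i" "i \<cdot> y = g \<cdot> e"
  obtains h where "h \<in> Arr C" "Dom C h = Dom C g" "Cod C h = Dom C i" "i \<cdot> h = g"
proof -
  obtain c where c: "is_kernel C i c"
    using monic_normal[OF assms(1)] by blast
  note ic = is_kernelD[OF c] and [simp] = epic_Arr[OF assms(2)]
  have "(c \<cdot> g) \<cdot> e = c \<cdot> (i \<cdot> y)"
    using assms ic(1-4) by simp
  also have "\<dots> = hzero C (Dom C e) (Cod C (c \<cdot> g))"
    using comp_reassoc[OF ic(4), of y] assms ic(1-3) by simp
  finally have "(c \<cdot> g) \<cdot> e = hzero C (Dom C e) (Cod C (c \<cdot> g))" .
  then have "c \<cdot> g = hzero C (Dom C (c \<cdot> g)) (Cod C (c \<cdot> g))"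
    by (rule epicD_zero[OF assms(2)]) (use assms ic in auto)
  then have "c \<cdot> g = hzero C (Dom C g) (Cod C c)"
    using assms ic by simp
  then show thesis
    using is_kernel_factor[OF c assms(3)] assms(4) ic(3) that by metis
qed

text \<open>The image is the kernel \<open>m\<close> of the cokernel \<open>q\<close> of
  \<open>f\<close>. To see that \<open>e\<close> is epic, let \<open>g\<close> kill it and put
  \<open>k\<close> for the kernel of \<open>g\<close>. Then \<open>f\<close> factors through the
  monomorphism \<open>m \<cdot> k\<close>, which is the kernel of some \<open>c\<close>; as
  \<open>c\<close> kills \<open>f\<close> it factors through \<open>q\<close>, hence kills
  \<open>m\<close>. So \<open>m\<close> factors through \<open>m \<cdot> k\<close>, which makes
  \<open>k\<close> split epic and \<open>g\<close> zero.\<close>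

lemma image_fact_exists:
  assumes "f \<in> Arr C"
  shows "\<exists>e m. image_fact C f e m"
proof -
  obtain q where q: "is_cokernel C q f"
    using ex_cokernel[OF assms] by blast
  note qf = is_cokernelD[OF q]
  obtain m where m: "is_kernel C m q"
    using ex_kernel[OF qf(2)] by blast
  note mq = is_kernelD[OF m]
  obtain e where e: "e \<in> Arr C" "Dom C e = Dom C f" "Cod C e = Dom C m" "m \<cdot> e = f"
    using is_kernel_factor[OF m assms] qf by metis
  have "epic C e"
  proof (rule epicI_zero[OF e(1)])
    fix g
    assume g: "g \<in> Arr C" "Dom C g = Cod C e" "g \<cdot> e = hzero C (Dom C e) (Cod C g)"
    obtain k where k: "is_kernel C k g"
      using ex_kernel[OF g(1)] by blast
    note kg = is_kernelD[OF k]
    obtain e' where e': "e' \<in> Arr C" "Dom C e' = Dom C e" "Cod C e' = Dom C k" "k \<cdot> e' = e"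
      using is_kernel_factor[OF k e(1)] g by metis
    have "monic C (m \<cdot> k)"
      using mq kg e g by (intro monic_comp) auto
    then obtain c where c: "is_kernel C (m \<cdot> k) c"
      using monic_normal by blast
    note cm = is_kernelD[OF c]
    have mk: "m \<cdot> k \<in> Arr C" "Cod C (m \<cdot> k) = Cod C m" "Dom C (m \<cdot> k) = Dom C k"
      using mq kg e g by auto
    have "f = (m \<cdot> k) \<cdot> e'"
      using mq(1-3) kg(1-3) e e' g(1,2) by simp
    then have "c \<cdot> f = (c \<cdot> (m \<cdot> k)) \<cdot> e'"
      using cm(1-3) mk e'(1-3) by simp
    also have "\<dots> = hzero C (Dom C f) (Cod C c)"
      using cm(1-4) mk e'(1-3) e(2) by simp
    finally have cf: "c \<cdot> f = hzero C (Dom C f) (Cod C c)" .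
    have dc: "Dom C c = Cod C f"
      using cm(3) mk(2) mq(3) qf(3) by simp
    obtain c' where c': "c' \<in> Arr C" "Dom C c' = Cod C q" "Cod C c' = Cod C c" "c' \<cdot> q = c"
      by (rule is_cokernel_factor[OF q cm(1) dc cf])
    have "c \<cdot> m = (c' \<cdot> q) \<cdot> m"
      by (simp only: c'(4))
    also have "\<dots> = hzero C (Dom C m) (Cod C c)"
      using mq(1-4) c'(1-3) qf(2) by simp
    finally have cm0: "c \<cdot> m = hzero C (Dom C m) (Cod C c)" .
    have dm: "Cod C m = Dom C c"
      using cm(3) mk(2) by simp
    obtain s where s: "s \<in> Arr C" "Dom C s = Dom C m" "Cod C s = Dom C (m \<cdot> k)"
        "(m \<cdot> k) \<cdot> s = m"
      by (rule is_kernel_factor[OF c mq(2) dm cm0])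
    have "m \<cdot> (k \<cdot> s) = m \<cdot> Ide C (Dom C m)"
      using s mq(1-3) kg(1-3) mk e g(1,2) by simp
    then have "k \<cdot> s = Ide C (Dom C m)"
      by (rule monicD[OF mq(5)]) (use s mq kg mk e g in auto)
    then have "g = g \<cdot> (k \<cdot> s)"
      using g e by simp
    also have "\<dots> = (g \<cdot> k) \<cdot> s"
      using s kg(1-3) mk by simp
    also have "\<dots> = hzero C (Cod C e) (Cod C g)"
      using s kg(1-4) mk e by simp
    finally show "g = hzero C (Cod C e) (Cod C g)" .
  qed
  then show ?thesis
    using e mq by (auto simp: image_fact_def)
qed

lemma image_fact_im:
  assumes "f \<in> Arr C"
  shows "image_fact C f (im_epi C f) (im_mono C f)"
proof -
  have "\<exists>em. image_fact C f (fst em) (snd em)"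
    using image_fact_exists[OF assms] by auto
  then show ?thesis
    unfolding im_epi_def im_mono_def by (rule someI_ex)
qed

lemma image_factD:
  assumes "image_fact C f e m"
  shows "epic C e" "monic C m" "e \<in> Arr C" "m \<in> Arr C" "Dom C m = Cod C e" "m \<cdot> e = f"
    "Dom C e = Dom C f" "Cod C m = Cod C f"
proof -
  show *: "epic C e" "monic C m" "e \<in> Arr C" "m \<in> Arr C" "Dom C m = Cod C e" "m \<cdot> e = f"
    using assms by (auto simp: image_fact_def epic_Arr monic_Arr)
  show "Dom C e = Dom C f" "Cod C m = Cod C f"
    using comp_simps(2,3)[OF *(3-5)] *(6) by auto
qed

text \<open>The fibre product is the kernel \<open>k\<close> of the difference \<open>t\<close> of
  \<open>e\<close> and \<open>x\<close> on the direct sum. Now \<open>t\<close> is epic because its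
  restriction to the first summand is \<open>e\<close>. If \<open>g\<close> kills
  \<open>q \<cdot> k\<close>, then \<open>g \<cdot> q\<close> kills the kernel of \<open>t\<close>
  and equals some \<open>h \<cdot> t\<close>; restricting to the first summand gives
  \<open>h \<cdot> e = 0\<close>, so \<open>h = 0\<close>, and restricting to the second gives
  \<open>g = 0\<close>.\<close>

lemma epic_pullback:
  assumes "epic C e" "x \<in> Arr C" "Cod C x = Cod C e"
  obtains \<pi> y where "epic C \<pi>" "Cod C \<pi> = Dom C x" "y \<in> Arr C" "Dom C y = Dom C \<pi>"
    "Cod C y = Dom C e" "e \<cdot> y = x \<cdot> \<pi>"
proof -
  note [simp] = epic_Arr[OF assms(1)] assms(2,3)
  obtain s i j p q where "biproduct C (Dom C e) (Dom C x) s i j p q"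
    using ex_biproduct by (metis assms(1,2) dom_Obj epic_Arr)
  then have bi [simp]: "i \<in> Arr C" "Dom C i = Dom C e" "Cod C i = s"
      "j \<in> Arr C" "Dom C j = Dom C x" "Cod C j = s"
      "p \<in> Arr C" "Dom C p = s" "Cod C p = Dom C e"
      "q \<in> Arr C" "Dom C q = s" "Cod C q = Dom C x"
    and bi_eq: "p \<cdot> i = Ide C (Dom C e)" "q \<cdot> j = Ide C (Dom C x)"
      "q \<cdot> i = hzero C (Dom C e) (Dom C x)" "p \<cdot> j = hzero C (Dom C x) (Dom C e)"
    by (auto simp: biproduct_def)
  define t where "t = hsub C (e \<cdot> p) (x \<cdot> q)"
  have t [simp]: "t \<in> Arr C" "Dom C t = s" "Cod C t = Cod C e"
    by (simp_all add: t_def)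
  have ti: "t \<cdot> i = e"
    by (simp add: t_def comp_hsub bi_eq hsub_hzero)
  have "epic C t"
    using assms(1) by (intro epic_cancel[of t i]) (auto simp: ti)
  obtain k where k: "is_kernel C k t"
    using ex_kernel[OF t(1)] by blast
  note kt [simp] = is_kernelD(2,3)[OF k]
  have "(e \<cdot> p) \<cdot> k = (x \<cdot> q) \<cdot> k"
    by (rule hsub_eq_hzero)
      (use is_kernelD(4)[OF k] in \<open>simp_all add: t_def comp_hsub del: comp_assoc_simp\<close>)
  then have eq: "e \<cdot> (p \<cdot> k) = x \<cdot> (q \<cdot> k)"
    by simp
  have "epic C (q \<cdot> k)"
  proof (rule epicI_zero)
    fix g
    assume g: "g \<in> Arr C" "Dom C g = Cod C (q \<cdot> k)"
      "g \<cdot> (q \<cdot> k) = hzero C (Dom C (q \<cdot> k)) (Cod C g)"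
    obtain h where h: "h \<in> Arr C" "Dom C h = Cod C t" "Cod C h = Cod C (g \<cdot> q)" "h \<cdot> t = g \<cdot> q"
    proof (rule epic_factor[OF \<open>epic C t\<close>, of "g \<cdot> q"])
      fix y
      assume y: "y \<in> Arr C" "Cod C y = Dom C t" "t \<cdot> y = hzero C (Dom C y) (Cod C t)"
      then obtain z where z: "z \<in> Arr C" "Dom C z = Dom C y" "Cod C z = Dom C k" "k \<cdot> z = y"
        using is_kernel_factor[OF k] by metis
      have "(g \<cdot> q) \<cdot> (k \<cdot> z) = (g \<cdot> (q \<cdot> k)) \<cdot> z"
        using g(1,2) z(1-3) by simp
      then show "(g \<cdot> q) \<cdot> y = hzero C (Dom C y) (Cod C (g \<cdot> q))"
        unfolding z(4) using g z(1-3) by simp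
    qed (use g in auto)
    have "h \<cdot> e = (h \<cdot> t) \<cdot> i"
      using h(1,2) by (simp add: ti)
    also have "\<dots> = hzero C (Dom C e) (Cod C h)"
      using h g(1,2) by (simp add: bi_eq)
    finally have "h = hzero C (Dom C h) (Cod C h)"
      by (rule epicD_zero[OF assms(1)]) (use h in auto)
    then have "h = hzero C (Cod C t) (Cod C g)"
      using h g(1,2) by simp
    then have "g \<cdot> q = hzero C s (Cod C g)"
      using h(4) g(1) by simp
    then have "(g \<cdot> q) \<cdot> j = hzero C (Dom C x) (Cod C g)"
      using g(1) by simp
    then show "g = hzero C (Cod C (q \<cdot> k)) (Cod C g)"
      using g(1,2) by (simp add: bi_eq)
  qed auto
  then show thesis
    using that[of "q \<cdot> k" "p \<cdot> k"] eq by simp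
qed

lemma exact_at_zero:
  assumes "exact_at C f g"
  shows "f \<in> Arr C" "g \<in> Arr C" "Dom C g = Cod C f" "g \<cdot> f = hzero C (Dom C f) (Cod C g)"
proof -
  obtain e k where ek: "image_fact C f e k" "is_kernel C k g"
    using assms unfolding exact_at_def by blast
  note e = image_factD[OF ek(1)] and k = is_kernelD[OF ek(2)]
  show f: "f \<in> Arr C" "g \<in> Arr C" "Dom C g = Cod C f"
    using comp_simps(1)[OF e(3-5)] e(6) k e(8) by auto
  have "g \<cdot> (k \<cdot> e) = (g \<cdot> k) \<cdot> e"
    using e(1-5) k(1-3) by simp
  also have "\<dots> = hzero C (Dom C f) (Cod C g)"
    using e k by simp
  finally show "g \<cdot> f = hzero C (Dom C f) (Cod C g)"
    using e(6) by simp
qed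

text \<open>The kernel \<open>k\<close> of \<open>g\<close> is also the image of \<open>f\<close>,
  so \<open>x\<close> factors through it; pulling back the epimorphism \<open>e\<close> onto this
  image produces the cover \<pi> and the lift \<open>y\<close>.\<close>

lemma exact_at_lift:
  assumes "exact_at C f g" "x \<in> Arr C" "Cod C x = Cod C f" "g \<cdot> x = hzero C (Dom C x) (Cod C g)"
  obtains \<pi> y where "epic C \<pi>" "Cod C \<pi> = Dom C x" "y \<in> Arr C" "Dom C y = Dom C \<pi>"
    "Cod C y = Dom C f" "f \<cdot> y = x \<cdot> \<pi>"
proof -
  obtain e k where ek: "image_fact C f e k" "is_kernel C k g"
    using assms unfolding exact_at_def by blast
  note e = image_factD[OF ek(1)] and k = is_kernelD[OF ek(2)]
  obtain z where z: "z \<in> Arr C" "Dom C z = Dom C x" "Cod C z = Dom C k" "k \<cdot> z = x"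
    using is_kernel_factor[OF ek(2) assms(2)] assms(3,4) k(3) e(8) by metis
  obtain \<pi> y where y: "epic C \<pi>" "Cod C \<pi> = Dom C z" "y \<in> Arr C" "Dom C y = Dom C \<pi>"
    "Cod C y = Dom C e" "e \<cdot> y = z \<cdot> \<pi>"
    using epic_pullback[OF e(1) z(1)] z(3) e(5) by metis
  note [simp] = epic_Arr[OF y(1)]
  have "f \<cdot> y = k \<cdot> (e \<cdot> y)"
    using comp_reassoc[OF e(6), of y] e(3-5) y(3-5) by simp
  also have "\<dots> = x \<cdot> \<pi>"
    unfolding y(6) using comp_reassoc[OF z(4), of \<pi>] y(2) e(4) k(2) z(1-3) by simp
  finally show thesis
    using that y z e by metis
qed

text \<open>A sign changes neither kernels nor images. It is needed since rotated and translated
  triangles carry signs that the exact sequences of a spectral object do not.\<close>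

lemma exact_at_hneg:
  assumes "exact_at C f g"
  shows "exact_at C f (hneg C g)" "exact_at C (hneg C f) g"
proof -
  obtain e k where ek: "image_fact C f e k" "is_kernel C k g"
    using assms unfolding exact_at_def by blast
  note e = image_factD[OF ek(1)] and k = is_kernelD[OF ek(2)]
  have "is_kernel C k (hneg C g)"
  proof (rule is_kernelI)
    fix x
    assume x: "x \<in> Arr C" "Cod C x = Dom C (hneg C g)"
      "hneg C g \<cdot> x = hzero C (Dom C x) (Cod C (hneg C g))"
    then have "g \<cdot> x = hneg C (hzero C (Dom C x) (Cod C g))"
      using k(1) by (metis comp_hneg(1) comp_simps(1) hneg_simps(2,3,5))
    then have "g \<cdot> x = hzero C (Dom C x) (Cod C g)"
      using x k(1) by simp
    then show "\<exists>h\<in>Arr C. Dom C h = Dom C x \<and> Cod C h = Dom C k \<and> k \<cdot> h = x"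
      using is_kernel_factor[OF ek(2) x(1)] x(2) k(1) by (metis hneg_simps(2))
  qed (use k in auto)
  then show "exact_at C f (hneg C g)"
    using ek(1) unfolding exact_at_def by blast
  have "epic C (hneg C e)"
  proof (rule epicI_zero)
    fix x
    assume x: "x \<in> Arr C" "Dom C x = Cod C (hneg C e)"
      "x \<cdot> hneg C e = hzero C (Dom C (hneg C e)) (Cod C x)"
    then have "x \<cdot> e = hneg C (hzero C (Dom C e) (Cod C x))"
      using e(3) by (metis comp_hneg(2) comp_simps(1) hneg_simps(2,3,5))
    then have "x \<cdot> e = hzero C (Dom C e) (Cod C x)"
      using x e(3) by simp
    then show "x = hzero C (Cod C (hneg C e)) (Cod C x)"
      using epicD_zero[OF e(1)] x e(3) by simp
  qed (use e in auto)
  then have "image_fact C (hneg C f) (hneg C e) k"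
    unfolding image_fact_def using e by simp
  then show "exact_at C (hneg C f) g"
    using ek(2) unfolding exact_at_def by blast
qed

text \<open>Images are functorial for commutative squares: whatever \<open>e\<close> kills is killed
  by \<open>m' \<cdot> e' \<cdot> a\<close>, and \<open>m'\<close> is monic, so
  \<open>e' \<cdot> a\<close> descends along \<open>e\<close>.\<close>

lemma image_fact_map:
  assumes "image_fact C f e m" "image_fact C f' e' m'"
    "a \<in> Arr C" "Dom C a = Dom C f" "Cod C a = Dom C f'"
    "b \<in> Arr C" "Dom C b = Cod C f" "Cod C b = Cod C f'"
    "f' \<cdot> a = b \<cdot> f"
  obtains h where "h \<in> Arr C" "Dom C h = Cod C e" "Cod C h = Cod C e'" "h \<cdot> e = e' \<cdot> a"
    "m' \<cdot> h = b \<cdot> m"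
proof -
  note e = image_factD[OF assms(1)] and e' = image_factD[OF assms(2)]
  have eq: "m' \<cdot> (e' \<cdot> a) = b \<cdot> (m \<cdot> e)"
    using comp_reassoc[OF e'(6), of a] e'(3-5,7) assms(3-5,9) e(6) by simp
  obtain h where h: "h \<in> Arr C" "Dom C h = Cod C e" "Cod C h = Cod C (e' \<cdot> a)" "h \<cdot> e = e' \<cdot> a"
  proof (rule epic_factor[OF e(1), of "e' \<cdot> a"])
    fix x
    assume x: "x \<in> Arr C" "Cod C x = Dom C e" "e \<cdot> x = hzero C (Dom C x) (Cod C e)"
    note t = e(3-5,7,8) e'(3-5,7,8) x(1,2) assms(3-8)
    have "m' \<cdot> ((e' \<cdot> a) \<cdot> x) = (m' \<cdot> (e' \<cdot> a)) \<cdot> x"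
      using t by simp
    also have "\<dots> = b \<cdot> (m \<cdot> (e \<cdot> x))"
      unfolding eq using t by simp
    also have "\<dots> = hzero C (Dom C x) (Cod C m')"
      unfolding x(3) using t by simp
    finally have "m' \<cdot> ((e' \<cdot> a) \<cdot> x) = hzero C (Dom C ((e' \<cdot> a) \<cdot> x)) (Cod C m')"
      using t by simp
    from monicD_zero[OF e'(2) this]
    show "(e' \<cdot> a) \<cdot> x = hzero C (Dom C x) (Cod C (e' \<cdot> a))"
      using t by simp
  qed (use e(3-5,7,8) e'(3-5,7,8) assms(3-8) in auto)
  have "(m' \<cdot> h) \<cdot> e = (b \<cdot> m) \<cdot> e"
    using h eq e(3-5,7,8) e'(3-5,7,8) assms(3-8) by simp
  then have "m' \<cdot> h = b \<cdot> m"
    by (rule epicD[OF e(1)]) (use h e(3-5,7,8) e'(3-5,7,8) assms(3-8) in auto)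
  then show thesis
    using that[of h] h e' assms(3-8) by simp
qed

end

section \<open>The spectral sequence of a spectral object\<close>

context abelian_category
begin

text \<open>Uniqueness holds because \<open>e\<close> is epic. The definite descriptions
  \<open>so_d\<close>, \<open>so_i\<close> and \<open>so_p\<close> all have the shape of
  \<open>h\<close>, so this one lemma evaluates every arrow of the spectral sequence, and later the
  action of morphisms on it.\<close>

lemma image_fact_map_THE:
  assumes "image_fact C f e m" "image_fact C f' e' m'"
    "a \<in> Arr C" "Dom C a = Dom C f" "Cod C a = Dom C f'"
    "b \<in> Arr C" "Dom C b = Cod C f" "Cod C b = Cod C f'"
    "f' \<cdot> a = b \<cdot> f"
    and h: "h = (THE h. h \<in> Hom C (Cod C e) (Cod C e') \<and> h \<cdot> e = e' \<cdot> a)"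
  shows "h \<in> Arr C" "Dom C h = Cod C e" "Cod C h = Cod C e'" "h \<cdot> e = e' \<cdot> a" "m' \<cdot> h = b \<cdot> m"
proof -
  note e = image_factD[OF assms(1)]
  obtain k where k: "k \<in> Arr C" "Dom C k = Cod C e" "Cod C k = Cod C e'" "k \<cdot> e = e' \<cdot> a"
      "m' \<cdot> k = b \<cdot> m"
    by (rule image_fact_map[OF assms(1-9)])
  have "h = k"
    unfolding h
  proof (rule the_equality)
    fix k'
    assume k': "k' \<in> Hom C (Cod C e) (Cod C e') \<and> k' \<cdot> e = e' \<cdot> a"
    show "k' = k"
      by (rule epicD[OF e(1)]) (use k k' in auto)
  qed (use k in auto)
  then show "h \<in> Arr C" "Dom C h = Cod C e" "Cod C h = Cod C e'" "h \<cdot> e = e' \<cdot> a"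
    "m' \<cdot> h = b \<cdot> m"
    using k by auto
qed

end

section \<open>Pages, cycles and differentials of a spectral object of graded objects\<close>

locale graded_spectral_object = abelian_category B
  for B :: "('b, 'c, 'y) acat_scheme" (structure) +
  fixes S :: "('b, 'c) gspobj"
  assumes spectral: "spectral_object B S"
begin

text \<open>Indices such as \<open>p + r + r\<close> are to keep the shape in which they occur in
  \<open>so_d\<close>, and must not be collected to \<open>p + 2 * r\<close>.\<close>

declare [[simproc del: int_combine_numerals]]

abbreviation "Ob \<equiv> gO S"
abbreviation "M \<equiv> gM S"
abbreviation "\<Delta> \<equiv> gD S"

lemmas spectral_conj = spectral[unfolded spectral_object_def]

lemma O_Obj [simp]: "p \<le> q \<Longrightarrow> Ob n p q \<in> Obj B"
  using spectral_conj[THEN conjunct1] by blast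

lemma M_Ide: "p \<le> q \<Longrightarrow> M n p q p q = Ide B (Ob n p q)"
  using spectral_conj[THEN conjunct1] by blast

lemma M_simps [simp]:
  assumes "p \<le> q" "p' \<le> q'" "p' \<le> p" "q' \<le> q"
  shows "M n p q p' q' \<in> Arr B" "Dom B (M n p q p' q') = Ob n p q" "Cod B (M n p q p' q') = Ob n p' q'"
proof -
  have "M n p q p' q' \<in> Hom B (Ob n p q) (Ob n p' q')"
    using spectral_conj[THEN conjunct2, THEN conjunct1] assms by blast
  then show "M n p q p' q' \<in> Arr B" "Dom B (M n p q p' q') = Ob n p q"
    "Cod B (M n p q p' q') = Ob n p' q'"
    by auto
qed

lemma M_comp:
  assumes "p \<le> q" "p' \<le> q'" "p'' \<le> q''" "p' \<le> p" "q' \<le> q" "p'' \<le> p'" "q'' \<le> q'"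
  shows "M n p' q' p'' q'' \<cdot> M n p q p' q' = M n p q p'' q''"
  using spectral_conj[THEN conjunct2, THEN conjunct2, THEN conjunct1] assms by blast

lemma \<Delta>_simps [simp]:
  assumes "p \<le> q" "q \<le> r"
  shows "\<Delta> n p q r \<in> Arr B" "Dom B (\<Delta> n p q r) = Ob n p q" "Cod B (\<Delta> n p q r) = Ob (n + 1) q r"
proof -
  have "\<Delta> n p q r \<in> Hom B (Ob n p q) (Ob (n + 1) q r)"
    using spectral_conj[THEN conjunct2, THEN conjunct2, THEN conjunct2, THEN conjunct1] assms by blast
  then show "\<Delta> n p q r \<in> Arr B" "Dom B (\<Delta> n p q r) = Ob n p q"
    "Cod B (\<Delta> n p q r) = Ob (n + 1) q r"
    by auto
qed

lemma \<Delta>_M: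
  assumes "p \<le> q" "q \<le> r" "p' \<le> q'" "q' \<le> r'" "p' \<le> p" "q' \<le> q" "r' \<le> r"
  shows "\<Delta> n p' q' r' \<cdot> M n p q p' q' = M (n + 1) q r q' r' \<cdot> \<Delta> n p q r"
  using spectral_conj[THEN conjunct2, THEN conjunct2, THEN conjunct2, THEN conjunct2, THEN conjunct1] assms by blast

lemma \<Delta>_M_left:
  assumes "p \<le> q" "q \<le> r" "p' \<le> p" "p' \<le> q"
  shows "\<Delta> n p' q r \<cdot> M n p q p' q = \<Delta> n p q r"
  using \<Delta>_M[of p q r p' q r n] assms by (simp add: M_Ide)

lemma M_\<Delta>_right:
  assumes "p \<le> q" "q \<le> r" "q \<le> r'" "r' \<le> r"
  shows "M (n + 1) q r q r' \<cdot> \<Delta> n p q r = \<Delta> n p q r'"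
  using \<Delta>_M[of p q r p q r' n] assms by (simp add: M_Ide)

lemma exact:
  assumes "p \<le> q" "q \<le> r"
  shows "exact_at B (M n q r p r) (M n p r p q)" "exact_at B (M n p r p q) (\<Delta> n p q r)"
    "exact_at B (\<Delta> n p q r) (M (n + 1) q r p r)"
  using spectral_conj[THEN conjunct2, THEN conjunct2, THEN conjunct2, THEN conjunct2, THEN conjunct2, THEN conjunct1] assms by blast+

text \<open>For \<open>p = q = r\<close> both arrows of the exact pair are the identity of
  \<open>Ob n p p\<close>, and their composite vanishes.\<close>

lemma O_zero: "Ide B (Ob n p p) = hzero B (Ob n p p) (Ob n p p)"
  using exact_at_zero(4)[OF exact(1)[of p p p n]] by (simp add: M_Ide)

text \<open>Because of \<open>q' \<le> p\<close> the arrow passes through \<open>Ob n p p\<close>,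
  which is zero.\<close>

lemma M_zero:
  assumes "p \<le> q" "p' \<le> q'" "q' \<le> p"
  shows "M n p q p' q' = hzero B (Ob n p q) (Ob n p' q')"
proof -
  have "M n p q p' q' = M n p p p' q' \<cdot> (Ide B (Ob n p p) \<cdot> M n p q p p)"
    using assms M_comp[of p q p p p' q' n] by simp
  also have "\<dots> = hzero B (Ob n p q) (Ob n p' q')"
    unfolding O_zero using assms by simp
  finally show ?thesis .
qed

text \<open>In this locale pages are indexed by the total degree \<open>n\<close> instead of \<open>q = n - p\<close>.\<close>

definition "E_epi r n p = so_epi B S r p (n - p)"
definition "E_mono r n p = (if r = 1 then Ide B (Ob n p (p + 1))
  else im_mono B (M n p (p + r) (p - r + 1) (p + 1)))"
definition "E r n p = so_E B S r p (n - p)"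
definition "E_diff r n p = so_d B S r p (n - p)"
definition "Z_epi r n p = so_Z_epi B S r p (n - p)"
definition "Z_mono r n p = im_mono B (M n p (p + r + 1) (p - r + 1) (p + 1))"
definition "Z_incl r n p = so_i B S r p (n - p)"
definition "Z_proj r n p = so_p B S r p (n - p)"

lemma E_eq: "E r n p = Cod B (E_epi r n p)"
  by (simp add: E_def E_epi_def so_E_def)

text \<open>For \<open>r = 1\<close> the arrow is an identity, and \<open>so_epi\<close> prescribes
  its trivial factorisation. The first page is therefore \<open>Ob n p (p + 1)\<close> itself and
  not a chosen isomorphic image.\<close>

lemma image_fact_E:
  assumes "1 \<le> r"
  shows "image_fact B (M n p (p + r) (p - r + 1) (p + 1)) (E_epi r n p) (E_mono r n p)"
proof (cases "r = 1")
  case True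
  then show ?thesis
    by (simp add: E_epi_def E_mono_def so_epi_def image_fact_def M_Ide Ide_monic Ide_epic)
next
  case False
  then show ?thesis
    using assms by (simp add: E_epi_def E_mono_def so_epi_def image_fact_im)
qed

lemma E_simps [simp]:
  assumes "1 \<le> r"
  shows "E_epi r n p \<in> Arr B" "Dom B (E_epi r n p) = Ob n p (p + r)" "Cod B (E_epi r n p) = E r n p"
    "E_mono r n p \<in> Arr B" "Dom B (E_mono r n p) = E r n p" "Cod B (E_mono r n p) = Ob n (p - r + 1) (p + 1)"
    "E_mono r n p \<cdot> E_epi r n p = M n p (p + r) (p - r + 1) (p + 1)"
    "E r n p \<in> Obj B"
proof -
  note i = image_factD[OF image_fact_E[OF assms, of n p]]
  show "E_epi r n p \<in> Arr B" "Dom B (E_epi r n p) = Ob n p (p + r)" "Cod B (E_epi r n p) = E r n p"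
    "E_mono r n p \<in> Arr B" "Dom B (E_mono r n p) = E r n p" "Cod B (E_mono r n p) = Ob n (p - r + 1) (p + 1)"
    "E_mono r n p \<cdot> E_epi r n p = M n p (p + r) (p - r + 1) (p + 1)"
    "E r n p \<in> Obj B"
    using i assms by (auto simp: E_eq)
qed

lemma image_fact_Z:
  assumes "1 \<le> r"
  shows "image_fact B (M n p (p + r + 1) (p - r + 1) (p + 1)) (Z_epi r n p) (Z_mono r n p)"
  using assms by (simp add: Z_epi_def Z_mono_def so_Z_epi_def image_fact_im)

definition "Z r n p = Cod B (Z_epi r n p)"

lemma Z_simps [simp]:
  assumes "1 \<le> r"
  shows "Z_epi r n p \<in> Arr B" "Dom B (Z_epi r n p) = Ob n p (p + r + 1)" "Cod B (Z_epi r n p) = Z r n p"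
    "Z_mono r n p \<in> Arr B" "Dom B (Z_mono r n p) = Z r n p" "Cod B (Z_mono r n p) = Ob n (p - r + 1) (p + 1)"
    "Z_mono r n p \<cdot> Z_epi r n p = M n p (p + r + 1) (p - r + 1) (p + 1)"
    "Z r n p \<in> Obj B"
proof -
  note i = image_factD[OF image_fact_Z[OF assms, of n p]]
  show "Z_epi r n p \<in> Arr B" "Dom B (Z_epi r n p) = Ob n p (p + r + 1)" "Cod B (Z_epi r n p) = Z r n p"
    "Z_mono r n p \<in> Arr B" "Dom B (Z_mono r n p) = Z r n p" "Cod B (Z_mono r n p) = Ob n (p - r + 1) (p + 1)"
    "Z_mono r n p \<cdot> Z_epi r n p = M n p (p + r + 1) (p - r + 1) (p + 1)"
    "Z r n p \<in> Obj B"
    using i assms by (auto simp: Z_def)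
qed

text \<open>Coboundaries commute with the structure maps, so they carry the arrow with image
  \<open>E r n p\<close> to the arrow with image \<open>E r (n + 1) (p + r)\<close>, and
  \<open>d_r\<close> is the induced map of images. The equation with \<open>E_epi\<close> computes
  it on representatives; the one with \<open>E_mono\<close> shows it as the restriction of a
  coboundary to a subobject.\<close>

lemma
  assumes "1 \<le> r"
  shows E_diff_simps [simp]: "E_diff r n p \<in> Arr B" "Dom B (E_diff r n p) = E r n p" "Cod B (E_diff r n p) = E r (n + 1) (p + r)"
    and E_diff_E_epi: "E_diff r n p \<cdot> E_epi r n p = E_epi r (n + 1) (p + r) \<cdot> \<Delta> n p (p + r) (p + r + r)"
    and E_mono_E_diff: "E_mono r (n + 1) (p + r) \<cdot> E_diff r n p
      = \<Delta> n (p - r + 1) (p + 1) (p + r + 1) \<cdot> E_mono r n p"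
proof -
  have i': "image_fact B (M (n + 1) (p + r) (p + r + r) (p + 1) (p + r + 1))
      (E_epi r (n + 1) (p + r)) (E_mono r (n + 1) (p + r))"
    using image_fact_E[OF assms, of "n + 1" "p + r"] by simp
  have q: "n - p - r + 1 = n + 1 - (p + r)"
    by simp
  have eq: "M (n + 1) (p + r) (p + r + r) (p + 1) (p + r + 1) \<cdot> \<Delta> n p (p + r) (p + r + r)
      = \<Delta> n (p - r + 1) (p + 1) (p + r + 1) \<cdot> M n p (p + r) (p - r + 1) (p + 1)"
    using assms by (intro \<Delta>_M[symmetric]) auto
  have "E_diff r n p = (THE h. h \<in> Hom B (Cod B (E_epi r n p)) (Cod B (E_epi r (n + 1) (p + r))) \<and>
      h \<cdot> E_epi r n p = E_epi r (n + 1) (p + r) \<cdot> \<Delta> n p (p + r) (p + r + r))"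
    unfolding E_diff_def so_d_def so_E_def q E_epi_def[symmetric] by simp
  note h = image_fact_map_THE[OF image_fact_E[OF assms] i' _ _ _ _ _ _ eq this]
  show "E_diff r n p \<in> Arr B" "Dom B (E_diff r n p) = E r n p" "Cod B (E_diff r n p) = E r (n + 1) (p + r)"
    "E_diff r n p \<cdot> E_epi r n p = E_epi r (n + 1) (p + r) \<cdot> \<Delta> n p (p + r) (p + r + r)"
    "E_mono r (n + 1) (p + r) \<cdot> E_diff r n p = \<Delta> n (p - r + 1) (p + 1) (p + r + 1) \<cdot> E_mono r n p"
    using h assms by simp_all
qed

text \<open>The two images lie in the same object \<open>Ob n (p - r + 1) (p + 1)\<close>. The arrow
  with image \<open>Z r n p\<close> factors through the source \<open>Ob n p (p + r)\<close> of the
  other one, whence the inclusion.\<close>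

lemma
  assumes "1 \<le> r"
  shows Z_incl_simps [simp]: "Z_incl r n p \<in> Arr B" "Dom B (Z_incl r n p) = Z r n p" "Cod B (Z_incl r n p) = E r n p"
    and Z_incl_Z_epi: "Z_incl r n p \<cdot> Z_epi r n p = E_epi r n p \<cdot> M n p (p + r + 1) p (p + r)"
    and E_mono_Z_incl: "E_mono r n p \<cdot> Z_incl r n p = Z_mono r n p"
proof -
  have eq: "M n p (p + r) (p - r + 1) (p + 1) \<cdot> M n p (p + r + 1) p (p + r)
      = Ide B (Ob n (p - r + 1) (p + 1)) \<cdot> M n p (p + r + 1) (p - r + 1) (p + 1)"
    using assms by (simp add: M_comp)
  have "Z_incl r n p = (THE h. h \<in> Hom B (Cod B (Z_epi r n p)) (Cod B (E_epi r n p)) \<and>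
      h \<cdot> Z_epi r n p = E_epi r n p \<cdot> M n p (p + r + 1) p (p + r))"
    unfolding Z_incl_def so_i_def so_E_def Z_epi_def E_epi_def[symmetric] by simp
  note h = image_fact_map_THE[OF image_fact_Z[OF assms] image_fact_E[OF assms] _ _ _ _ _ _ eq this]
  show "Z_incl r n p \<in> Arr B" "Dom B (Z_incl r n p) = Z r n p" "Cod B (Z_incl r n p) = E r n p"
    "Z_incl r n p \<cdot> Z_epi r n p = E_epi r n p \<cdot> M n p (p + r + 1) p (p + r)"
    "E_mono r n p \<cdot> Z_incl r n p = Z_mono r n p"
    using h assms by simp_all
qed

text \<open>Here the source stays the same and the target is pushed on from
  \<open>Ob n (p - r + 1) (p + 1)\<close> to \<open>Ob n (p - r) (p + 1)\<close>. The image of the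
  longer composite is a quotient of \<open>Z r n p\<close>, and it is the next page.\<close>

lemma
  assumes "1 \<le> r"
  shows Z_proj_simps [simp]: "Z_proj r n p \<in> Arr B" "Dom B (Z_proj r n p) = Z r n p" "Cod B (Z_proj r n p) = E (r + 1) n p"
    and Z_proj_Z_epi: "Z_proj r n p \<cdot> Z_epi r n p = E_epi (r + 1) n p"
    and E_mono_Z_proj: "E_mono (r + 1) n p \<cdot> Z_proj r n p = M n (p - r + 1) (p + 1) (p - r) (p + 1) \<cdot> Z_mono r n p"
proof -
  have i': "image_fact B (M n p (p + r + 1) (p - r) (p + 1)) (E_epi (r + 1) n p) (E_mono (r + 1) n p)"
    using image_fact_E[of "r + 1" n p] assms by (simp add: add.assoc)
  have eq: "M n p (p + r + 1) (p - r) (p + 1) \<cdot> Ide B (Ob n p (p + r + 1))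
      = M n (p - r + 1) (p + 1) (p - r) (p + 1) \<cdot> M n p (p + r + 1) (p - r + 1) (p + 1)"
    using assms by (simp add: M_comp)
  have D: "Dom B (E_epi (r + 1) n p) = Ob n p (p + r + 1)"
    using E_simps(2)[of "r + 1" n p] assms by (simp add: add.assoc)
  have "Z_proj r n p = (THE h. h \<in> Hom B (Cod B (Z_epi r n p)) (Cod B (E_epi (r + 1) n p)) \<and>
      h \<cdot> Z_epi r n p = E_epi (r + 1) n p \<cdot> Ide B (Ob n p (p + r + 1)))"
    unfolding Z_proj_def so_p_def so_E_def Z_epi_def E_epi_def[symmetric]
    using D E_simps(1)[of "r + 1" n p] assms by simp
  note h = image_fact_map_THE[OF image_fact_Z[OF assms] i' _ _ _ _ _ _ eq this]
  show "Z_proj r n p \<in> Arr B" "Dom B (Z_proj r n p) = Z r n p" "Cod B (Z_proj r n p) = E (r + 1) n p"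
    "Z_proj r n p \<cdot> Z_epi r n p = E_epi (r + 1) n p"
    "E_mono (r + 1) n p \<cdot> Z_proj r n p = M n (p - r + 1) (p + 1) (p - r) (p + 1) \<cdot> Z_mono r n p"
    using h assms D by simp_all
qed

lemma E_epi_epic: "1 \<le> r \<Longrightarrow> epic B (E_epi r n p)"
  and E_mono_monic: "1 \<le> r \<Longrightarrow> monic B (E_mono r n p)"
  and Z_epi_epic: "1 \<le> r \<Longrightarrow> epic B (Z_epi r n p)"
  and Z_mono_monic: "1 \<le> r \<Longrightarrow> monic B (Z_mono r n p)"
  using image_factD(1,2)[OF image_fact_E, of r n p] image_factD(1,2)[OF image_fact_Z, of r n p]
  by blast+

lemma Z_incl_monic:
  assumes "1 \<le> r"
  shows "monic B (Z_incl r n p)"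
  by (rule monic_cancel[of "E_mono r n p"]) (use assms in \<open>simp_all add: E_mono_Z_incl Z_mono_monic\<close>)

lemma Z_proj_epic:
  assumes "1 \<le> r"
  shows "epic B (Z_proj r n p)"
  by (rule epic_cancel[of _ "Z_epi r n p"]) (use assms in \<open>simp_all add: Z_proj_Z_epi E_epi_epic\<close>)

text \<open>The inner coboundary lifts to \<open>Ob (n + 1) q s\<close>, the lift being the
  coboundary for \<open>p \<le> q \<le> s\<close>. The remaining two arrows are consecutive in the
  exact sequence of \<open>q \<le> r \<le> s\<close>.\<close>

lemma \<Delta>_\<Delta>:
  assumes "p \<le> q" "q \<le> r" "r \<le> s"
  shows "\<Delta> (n + 1) q r s \<cdot> \<Delta> n p q r = hzero B (Ob n p q) (Ob (n + 1 + 1) r s)"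
proof -
  have "\<Delta> (n + 1) q r s \<cdot> \<Delta> n p q r = \<Delta> (n + 1) q r s \<cdot> (M (n + 1) q s q r \<cdot> \<Delta> n p q s)"
    using assms by (simp add: M_\<Delta>_right)
  also have "\<dots> = hzero B (Ob n p q) (Ob (n + 1 + 1) r s)"
    using comp_reassoc[OF exact_at_zero(4)[OF exact(2)[of q r s "n + 1"]], of "\<Delta> n p q s"] assms
    by simp
  finally show ?thesis .
qed

text \<open>Inside the objects that contain the pages, the two differentials are restrictions of
  consecutive coboundaries.\<close>

lemma E_diff_E_diff:
  assumes "1 \<le> r"
  shows "E_diff r (n + 1) (p + r) \<cdot> E_diff r n p = hzero B (E r n p) (E r (n + 1 + 1) (p + r + r))"
proof -
  have "E_mono r (n + 1 + 1) (p + r + r) \<cdot> (E_diff r (n + 1) (p + r) \<cdot> E_diff r n p)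
      = \<Delta> (n + 1) (p + 1) (p + r + 1) (p + r + r + 1) \<cdot> (E_mono r (n + 1) (p + r) \<cdot> E_diff r n p)"
    using comp_reassoc[OF E_mono_E_diff[OF assms, of "n + 1" "p + r"], of "E_diff r n p"] assms by simp
  also have "\<dots> = \<Delta> (n + 1) (p + 1) (p + r + 1) (p + r + r + 1) \<cdot>
      (\<Delta> n (p - r + 1) (p + 1) (p + r + 1) \<cdot> E_mono r n p)"
    using assms by (simp add: E_mono_E_diff)
  also have "\<dots> = hzero B (E r n p) (Ob (n + 1 + 1) (p + r + 1) (p + r + r + 1))"
    using comp_reassoc[OF \<Delta>_\<Delta>[of "p - r + 1" "p + 1" "p + r + 1" "p + r + r + 1" n], of "E_mono r n p"]
      assms by simp
  finally have *: "E_mono r (n + 1 + 1) (p + r + r) \<cdot> (E_diff r (n + 1) (p + r) \<cdot> E_diff r n p)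
    = hzero B (E r n p) (Ob (n + 1 + 1) (p + r + 1) (p + r + r + 1))" .
  show ?thesis
    using monicD_zero[OF E_mono_monic[OF assms], of "n + 1 + 1" "p + r + r"
        "E_diff r (n + 1) (p + r) \<cdot> E_diff r n p"] * assms by simp
qed

text \<open>The chase: an element of the page killed by \<open>d_r\<close> is represented by
  \<open>x\<close> in \<open>Ob n p (p + r)\<close>, whose coboundary dies in
  \<open>Ob (n + 1) (p + 1) (p + r + 1)\<close>. Hence this coboundary is also that of some
  \<open>y\<close> in \<open>Ob n (p + 1) (p + r)\<close>. Subtracting \<open>y\<close> from
  \<open>x\<close> does not change the class in the page, and the difference lifts to
  \<open>Ob n p (p + r + 1)\<close>, which maps onto \<open>Z r n p\<close>.\<close>

lemma kernel_E_diff: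
  assumes "1 \<le> r"
  shows "is_kernel B (Z_incl r n p) (E_diff r n p)"
proof (rule is_kernelI)
  have [simp]: "1 \<le> r" "0 \<le> r" "p \<le> p + r + 1" "p - r \<le> p"
    using assms by auto
  let ?\<mu> = "M (n + 1) (p + r) (p + r + 1) (p + 1) (p + r + 1)"
  let ?\<delta> = "\<Delta> n p (p + r) (p + r + 1)"
  \<comment> \<open>Seen in the object containing the target page, \<open>d_r\<close> of a
    representative is its coboundary in the single step from \<open>p + r\<close> to
    \<open>p + r + 1\<close>, pushed along \<open>?\<mu>\<close>. The kernel of
    \<open>?\<mu>\<close> is then controlled by exactness for
    \<open>p + 1 \<le> p + r \<le> p + r + 1\<close>.\<close>
  have E_mono_d_E_epi: "E_mono r (n + 1) (p + r) \<cdot> (E_diff r n p \<cdot> E_epi r n p) = ?\<mu> \<cdot> ?\<delta>"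
  proof -
    have "E_mono r (n + 1) (p + r) \<cdot> (E_diff r n p \<cdot> E_epi r n p)
        = \<Delta> n (p - r + 1) (p + 1) (p + r + 1) \<cdot> M n p (p + r) (p - r + 1) (p + 1)"
      using comp_reassoc[OF E_mono_E_diff[of r n p], of "E_epi r n p"] assms by simp
    also have "\<dots> = ?\<mu> \<cdot> ?\<delta>"
      by (intro \<Delta>_M) auto
    finally show ?thesis .
  qed
  show "monic B (Z_incl r n p)"
    by (rule Z_incl_monic) simp
  have \<delta>0: "?\<delta> \<cdot> M n p (p + r + 1) p (p + r)
      = hzero B (Ob n p (p + r + 1)) (Ob (n + 1) (p + r) (p + r + 1))"
    using exact_at_zero(4)[OF exact(2)[of p "p + r" "p + r + 1" n]] by simp
  have "E_mono r (n + 1) (p + r) \<cdot> ((E_diff r n p \<cdot> Z_incl r n p) \<cdot> Z_epi r n p)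
      = (E_mono r (n + 1) (p + r) \<cdot> (E_diff r n p \<cdot> E_epi r n p)) \<cdot> M n p (p + r + 1) p (p + r)"
    by (simp add: Z_incl_Z_epi)
  also have "\<dots> = hzero B (Ob n p (p + r + 1)) (Ob (n + 1) (p + 1) (p + r + 1))"
    unfolding E_mono_d_E_epi by (simp add: \<delta>0)
  finally have "(E_diff r n p \<cdot> Z_incl r n p) \<cdot> Z_epi r n p = hzero B (Ob n p (p + r + 1)) (E r (n + 1) (p + r))"
    using monicD_zero[OF E_mono_monic[of r "n + 1" "p + r"], of "(E_diff r n p \<cdot> Z_incl r n p) \<cdot> Z_epi r n p"]
    by simp
  then have "E_diff r n p \<cdot> Z_incl r n p = hzero B (Z r n p) (E r (n + 1) (p + r))"
    using epicD_zero[OF Z_epi_epic[of r n p], of "E_diff r n p \<cdot> Z_incl r n p"] by simp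
  then show "E_diff r n p \<cdot> Z_incl r n p = hzero B (Dom B (Z_incl r n p)) (Cod B (E_diff r n p))"
    by simp
  fix g
  assume g: "g \<in> Arr B" "Cod B g = Dom B (E_diff r n p)"
    "E_diff r n p \<cdot> g = hzero B (Dom B g) (Cod B (E_diff r n p))"
  have g' [simp]: "g \<in> Arr B" "Cod B g = E r n p"
    and dg: "E_diff r n p \<cdot> g = hzero B (Dom B g) (E r (n + 1) (p + r))"
    using g by simp_all
  have Cg: "Cod B g = Cod B (E_epi r n p)"
    by simp
  obtain \<pi> x where x: "epic B \<pi>" "Cod B \<pi> = Dom B g" "x \<in> Arr B" "Dom B x = Dom B \<pi>"
    "Cod B x = Dom B (E_epi r n p)" "E_epi r n p \<cdot> x = g \<cdot> \<pi>"
    by (rule epic_pullback[OF E_epi_epic[of r n p] g'(1) Cg]) simp_all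
  have [simp]: "\<pi> \<in> Arr B" "Cod B \<pi> = Dom B g" "x \<in> Arr B" "Dom B x = Dom B \<pi>"
    "Cod B x = Ob n p (p + r)"
    using x epic_Arr by simp_all
  have "?\<mu> \<cdot> (?\<delta> \<cdot> x) = (E_mono r (n + 1) (p + r) \<cdot> (E_diff r n p \<cdot> E_epi r n p)) \<cdot> x"
    unfolding E_mono_d_E_epi by simp
  also have "\<dots> = E_mono r (n + 1) (p + r) \<cdot> (E_diff r n p \<cdot> (g \<cdot> \<pi>))"
    by (simp add: x(6))
  also have "\<dots> = hzero B (Dom B \<pi>) (Ob (n + 1) (p + 1) (p + r + 1))"
    using comp_reassoc[OF dg, of \<pi>] by simp
  finally have \<mu>0: "?\<mu> \<cdot> (?\<delta> \<cdot> x) = hzero B (Dom B (?\<delta> \<cdot> x)) (Cod B ?\<mu>)"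
    by simp
  obtain \<pi>1 y where y: "epic B \<pi>1" "Cod B \<pi>1 = Dom B (?\<delta> \<cdot> x)" "y \<in> Arr B" "Dom B y = Dom B \<pi>1"
    "Cod B y = Dom B (\<Delta> n (p + 1) (p + r) (p + r + 1))"
    "\<Delta> n (p + 1) (p + r) (p + r + 1) \<cdot> y = (?\<delta> \<cdot> x) \<cdot> \<pi>1"
    by (rule exact_at_lift[OF exact(3)[of "p + 1" "p + r" "p + r + 1" n] _ _ \<mu>0]) simp_all
  have [simp]: "\<pi>1 \<in> Arr B" "Cod B \<pi>1 = Dom B \<pi>" "y \<in> Arr B" "Dom B y = Dom B \<pi>1"
    "Cod B y = Ob n (p + 1) (p + r)"
    using y epic_Arr by simp_all
  let ?\<nu> = "M n (p + 1) (p + r) p (p + r)"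
  \<comment> \<open>The corrected representative: \<open>?\<delta>\<close> takes equal values on
    \<open>x\<close> and on the image of \<open>y\<close>, so \<open>w\<close> has coboundary
    zero.\<close>
  define w where "w = hsub B (x \<cdot> \<pi>1) (?\<nu> \<cdot> y)"
  have [simp]: "w \<in> Arr B" "Dom B w = Dom B \<pi>1" "Cod B w = Ob n p (p + r)"
    by (simp_all add: w_def)
  have "?\<delta> \<cdot> (?\<nu> \<cdot> y) = ?\<delta> \<cdot> (x \<cdot> \<pi>1)"
    using comp_reassoc[OF \<Delta>_M_left[of "p + 1" "p + r" "p + r + 1" p n], of y] y(6) by simp
  then have \<delta>w: "?\<delta> \<cdot> w = hzero B (Dom B w) (Cod B ?\<delta>)"
    by (simp add: w_def comp_hsub hsub_self)
  obtain \<pi>2 z where z: "epic B \<pi>2" "Cod B \<pi>2 = Dom B w" "z \<in> Arr B" "Dom B z = Dom B \<pi>2"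
    "Cod B z = Dom B (M n p (p + r + 1) p (p + r))" "M n p (p + r + 1) p (p + r) \<cdot> z = w \<cdot> \<pi>2"
    by (rule exact_at_lift[OF exact(2)[of p "p + r" "p + r + 1" n] _ _ \<delta>w]) simp_all
  have [simp]: "\<pi>2 \<in> Arr B" "Cod B \<pi>2 = Dom B \<pi>1" "z \<in> Arr B" "Dom B z = Dom B \<pi>2"
    "Cod B z = Ob n p (p + r + 1)"
    using z epic_Arr by simp_all
  \<comment> \<open>The correction is invisible in the page, because its path to
    \<open>Ob n (p - r + 1) (p + 1)\<close> starts at index \<open>p + 1\<close> and is covered by
    \<open>M_zero\<close>.\<close>
  have "E_mono r n p \<cdot> (E_epi r n p \<cdot> ?\<nu>) = M n (p + 1) (p + r) (p - r + 1) (p + 1)"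
    using comp_reassoc[OF E_simps(7)[of r n p], of ?\<nu>] by (simp add: M_comp)
  also have "\<dots> = hzero B (Ob n (p + 1) (p + r)) (Ob n (p - r + 1) (p + 1))"
    by (rule M_zero) simp_all
  finally have \<nu>0: "E_epi r n p \<cdot> ?\<nu> = hzero B (Ob n (p + 1) (p + r)) (E r n p)"
    using monicD_zero[OF E_mono_monic[of r n p], of "E_epi r n p \<cdot> ?\<nu>"] by simp
  have "E_epi r n p \<cdot> w = hsub B (E_epi r n p \<cdot> (x \<cdot> \<pi>1)) (E_epi r n p \<cdot> (?\<nu> \<cdot> y))"
    by (simp add: w_def comp_hsub)
  also have "\<dots> = g \<cdot> (\<pi> \<cdot> \<pi>1)"
    using comp_reassoc[OF \<nu>0, of y] comp_reassoc[OF x(6), of \<pi>1] by (simp add: hsub_hzero)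
  finally have epw: "E_epi r n p \<cdot> w = g \<cdot> (\<pi> \<cdot> \<pi>1)" .
  have "Z_incl r n p \<cdot> (Z_epi r n p \<cdot> z) = E_epi r n p \<cdot> (w \<cdot> \<pi>2)"
    using comp_reassoc[OF Z_incl_Z_epi[of r n p], of z] z(6) by simp
  also have "\<dots> = g \<cdot> ((\<pi> \<cdot> \<pi>1) \<cdot> \<pi>2)"
    using comp_reassoc[OF epw, of \<pi>2] by simp
  finally have eq: "Z_incl r n p \<cdot> (Z_epi r n p \<cdot> z) = g \<cdot> ((\<pi> \<cdot> \<pi>1) \<cdot> \<pi>2)" .
  \<comment> \<open>The three covers chosen on the way compose to one epimorphism, along which the
    local factorisation descends.\<close>
  have epi: "epic B ((\<pi> \<cdot> \<pi>1) \<cdot> \<pi>2)"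
    using x(1) y(1) z(1) by (intro epic_comp) simp_all
  obtain h where "h \<in> Arr B" "Dom B h = Dom B g" "Cod B h = Dom B (Z_incl r n p)" "Z_incl r n p \<cdot> h = g"
    by (rule monic_factor_locally[OF Z_incl_monic[of r n p] epi _ _ _ _ _ _ eq]) simp_all
  then show "\<exists>h\<in>Arr B. Dom B h = Dom B g \<and> Cod B h = Dom B (Z_incl r n p) \<and> Z_incl r n p \<cdot> h = g"
    by blast
qed (use assms in auto)

text \<open>The arrow \<open>b\<close> is the incoming differential factored through the kernel of
  the outgoing one. For the cokernel property take \<open>x\<close> in \<open>Z r n p\<close> killed
  by \<open>Z_proj\<close> and a representative \<open>y\<close>: its class
  \<open>?m2 \<cdot> y\<close> in \<open>Ob n p (p + 1)\<close> dies in
  \<open>Ob n (p - r) (p + 1)\<close>, hence is the coboundary of some \<open>z\<close>. Then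
  \<open>y\<close> and \<open>?\<delta> \<cdot> z\<close> have the same class in
  \<open>Z r n p\<close>, so \<open>x\<close> comes from \<open>b\<close>, and every
  \<open>g\<close> killing \<open>b\<close> kills \<open>x\<close>.\<close>

lemma cokernel_E_diff:
  assumes "1 \<le> r"
  shows "\<exists>b \<in> Hom B (E r (n - 1) (p - r)) (Z r n p).
    Z_incl r n p \<cdot> b = E_diff r (n - 1) (p - r) \<and> is_cokernel B (Z_proj r n p) b"
proof -
  have [simp]: "1 \<le> r" "0 \<le> r" "p \<le> p + r + 1" "p - r \<le> p"
    using assms by auto
  let ?e = "E_epi r (n - 1) (p - r)"
  let ?d = "E_diff r (n - 1) (p - r)"
  let ?\<delta> = "\<Delta> (n - 1) (p - r) p (p + r + 1)"
  have [simp]: "Cod B ?d = E r n p" "?e \<in> Arr B" "Dom B ?e = Ob (n - 1) (p - r) p"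
    using E_diff_simps(3)[of r "n - 1" "p - r"] E_simps(2)[of r "n - 1" "p - r"] by simp_all
  have \<delta> [simp]: "?\<delta> \<in> Arr B" "Dom B ?\<delta> = Ob (n - 1) (p - r) p" "Cod B ?\<delta> = Ob n p (p + r + 1)"
    using \<Delta>_simps[of "p - r" p "p + r + 1" "n - 1"] by simp_all
  have dd: "E_diff r n p \<cdot> ?d = hzero B (Dom B ?d) (Cod B (E_diff r n p))"
    using E_diff_E_diff[of r "n - 1" "p - r"] by simp
  obtain b where b: "b \<in> Arr B" "Dom B b = Dom B ?d" "Cod B b = Dom B (Z_incl r n p)"
      "Z_incl r n p \<cdot> b = ?d"
    by (rule is_kernel_factor[OF kernel_E_diff[of r n p] _ _ dd]) simp_all
  then have [simp]: "b \<in> Arr B" "Dom B b = E r (n - 1) (p - r)" "Cod B b = Z r n p"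
    by simp_all
  \<comment> \<open>On representatives \<open>b\<close> is the coboundary \<open>?\<delta>\<close>
    into the larger object \<open>Ob n p (p + r + 1)\<close>, which covers the cycles. This can be
    tested in the page because the cycles are a subobject of it.\<close>
  have be: "b \<cdot> ?e = Z_epi r n p \<cdot> ?\<delta>"
  proof (rule monicD[OF Z_incl_monic[of r n p]])
    have "Z_incl r n p \<cdot> (b \<cdot> ?e) = E_epi r n p \<cdot> \<Delta> (n - 1) (p - r) p (p + r)"
      using comp_reassoc[OF b(4), of ?e] E_diff_E_epi[of r "n - 1" "p - r"] by simp
    also have "\<Delta> (n - 1) (p - r) p (p + r) = M n p (p + r + 1) p (p + r) \<cdot> ?\<delta>"
      using M_\<Delta>_right[of "p - r" p "p + r + 1" "p + r" "n - 1"] by simp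
    also have "E_epi r n p \<cdot> (M n p (p + r + 1) p (p + r) \<cdot> ?\<delta>) = Z_incl r n p \<cdot> (Z_epi r n p \<cdot> ?\<delta>)"
      using comp_reassoc[OF Z_incl_Z_epi[of r n p], of ?\<delta>] by simp
    finally show "Z_incl r n p \<cdot> (b \<cdot> ?e) = Z_incl r n p \<cdot> (Z_epi r n p \<cdot> ?\<delta>)" .
  qed simp_all
  have e_r1 [simp]: "E_epi (r + 1) n p \<in> Arr B" "Dom B (E_epi (r + 1) n p) = Ob n p (p + r + 1)"
    "Cod B (E_epi (r + 1) n p) = E (r + 1) n p"
    "E_mono (r + 1) n p \<in> Arr B" "Dom B (E_mono (r + 1) n p) = E (r + 1) n p"
    "Cod B (E_mono (r + 1) n p) = Ob n (p - r) (p + 1)" "E (r + 1) n p \<in> Obj B"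
    using E_simps[of "r + 1" n p] by (simp_all add: add.assoc)
  let ?m1 = "M n p (p + 1) (p - r) (p + 1)"
  let ?m2 = "M n p (p + r + 1) p (p + 1)"
  have "p \<le> p + 1" "p - r \<le> p + 1" "p + 1 \<le> p + r + 1"
    using assms by linarith+
  note [simp] = M_simps[OF this(1,2) \<open>p - r \<le> p\<close> order.refl]
    M_simps[OF \<open>p \<le> p + r + 1\<close> this(1) order.refl this(3)]
  \<comment> \<open>The arrow defining page \<open>r + 1\<close> is split at
    \<open>Ob n p (p + 1)\<close>: \<open>?m1\<close> is the arrow next to the coboundary from
    \<open>Ob (n - 1) (p - r) p\<close> in an exact sequence, while \<open>?m2\<close> only
    restricts.\<close>
  have me: "E_mono (r + 1) n p \<cdot> E_epi (r + 1) n p = ?m1 \<cdot> ?m2"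
  proof -
    have "?m1 \<cdot> ?m2 = M n p (p + r + 1) (p - r) (p + 1)"
      by (rule M_comp) (use assms in linarith)+
    moreover have "p + (r + 1) = p + r + 1" "p - (r + 1) + 1 = p - r"
      by simp_all
    ultimately show ?thesis
      using E_simps(7)[of "r + 1" n p] assms by (simp only:)
  qed
  have ex: "exact_at B (\<Delta> (n - 1) (p - r) p (p + 1)) ?m1"
    using exact(3)[of "p - r" p "p + 1" "n - 1"] by simp
  have m2\<delta>: "?m2 \<cdot> ?\<delta> = \<Delta> (n - 1) (p - r) p (p + 1)"
    using M_\<Delta>_right[of "p - r" p "p + r + 1" "p + 1" "n - 1"] by simp
  have [simp]: "\<Delta> (n - 1) (p - r) p (p + 1) \<in> Arr B"
    "Dom B (\<Delta> (n - 1) (p - r) p (p + 1)) = Ob (n - 1) (p - r) p"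
    "Cod B (\<Delta> (n - 1) (p - r) p (p + 1)) = Ob n p (p + 1)"
    using \<Delta>_simps[of "p - r" p "p + 1" "n - 1"] by simp_all
  have "E_mono (r + 1) n p \<cdot> (E_epi (r + 1) n p \<cdot> ?\<delta>) = ?m1 \<cdot> (?m2 \<cdot> ?\<delta>)"
    using comp_reassoc[OF me, of ?\<delta>] by simp
  also have "\<dots> = hzero B (Ob (n - 1) (p - r) p) (Ob n (p - r) (p + 1))"
    unfolding m2\<delta> using exact_at_zero(4)[OF ex] by simp
  finally have e\<delta>: "E_epi (r + 1) n p \<cdot> ?\<delta> = hzero B (Ob (n - 1) (p - r) p) (E (r + 1) n p)"
    using monicD_zero[OF E_mono_monic[of "r + 1" n p], of "E_epi (r + 1) n p \<cdot> ?\<delta>"] by simp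
  have "(Z_proj r n p \<cdot> b) \<cdot> ?e = Z_proj r n p \<cdot> (Z_epi r n p \<cdot> ?\<delta>)"
    by (simp add: be)
  also have "\<dots> = hzero B (Ob (n - 1) (p - r) p) (E (r + 1) n p)"
    using comp_reassoc[OF Z_proj_Z_epi[of r n p], of ?\<delta>] e\<delta> by simp
  finally have pb: "Z_proj r n p \<cdot> b = hzero B (E r (n - 1) (p - r)) (E (r + 1) n p)"
    using epicD_zero[OF E_epi_epic[of r "n - 1" "p - r"], of "Z_proj r n p \<cdot> b"] by simp
  have "is_cokernel B (Z_proj r n p) b"
  proof (rule is_cokernelI)
    fix g
    assume g: "g \<in> Arr B" "Dom B g = Cod B b" "g \<cdot> b = hzero B (Dom B b) (Cod B g)"
    then have [simp]: "g \<in> Arr B" "Dom B g = Z r n p"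
      and gb: "g \<cdot> b = hzero B (E r (n - 1) (p - r)) (Cod B g)"
      by simp_all
    obtain h where "h \<in> Arr B" "Dom B h = Cod B (Z_proj r n p)" "Cod B h = Cod B g" "h \<cdot> Z_proj r n p = g"
    proof (rule epic_factor[OF Z_proj_epic[of r n p], of g])
      fix x
      assume x: "x \<in> Arr B" "Cod B x = Dom B (Z_proj r n p)"
        "Z_proj r n p \<cdot> x = hzero B (Dom B x) (Cod B (Z_proj r n p))"
      then have [simp]: "x \<in> Arr B" "Cod B x = Z r n p"
        and px: "Z_proj r n p \<cdot> x = hzero B (Dom B x) (E (r + 1) n p)"
        by simp_all
      obtain \<pi> y where y: "epic B \<pi>" "Cod B \<pi> = Dom B x" "y \<in> Arr B" "Dom B y = Dom B \<pi>"
        "Cod B y = Dom B (Z_epi r n p)" "Z_epi r n p \<cdot> y = x \<cdot> \<pi>"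
        by (rule epic_pullback[OF Z_epi_epic[of r n p], of x]) simp_all
      then have [simp]: "\<pi> \<in> Arr B" "Cod B \<pi> = Dom B x" "y \<in> Arr B" "Dom B y = Dom B \<pi>"
        "Cod B y = Ob n p (p + r + 1)"
        using epic_Arr by simp_all
      have "E_epi (r + 1) n p \<cdot> y = Z_proj r n p \<cdot> (x \<cdot> \<pi>)"
        using comp_reassoc[OF Z_proj_Z_epi[of r n p], of y] y(6) by simp
      also have "\<dots> = hzero B (Dom B \<pi>) (E (r + 1) n p)"
        using comp_reassoc[OF px, of \<pi>] by simp
      finally have ey: "E_epi (r + 1) n p \<cdot> y = hzero B (Dom B \<pi>) (E (r + 1) n p)" .
      have "?m1 \<cdot> (?m2 \<cdot> y) = E_mono (r + 1) n p \<cdot> (E_epi (r + 1) n p \<cdot> y)"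
        using comp_reassoc[OF me, of y] by simp
      then have my: "?m1 \<cdot> (?m2 \<cdot> y) = hzero B (Dom B (?m2 \<cdot> y)) (Cod B ?m1)"
        using ey by simp
      obtain \<pi>1 z where z: "epic B \<pi>1" "Cod B \<pi>1 = Dom B (?m2 \<cdot> y)" "z \<in> Arr B"
        "Dom B z = Dom B \<pi>1" "Cod B z = Dom B (\<Delta> (n - 1) (p - r) p (p + 1))"
        "\<Delta> (n - 1) (p - r) p (p + 1) \<cdot> z = (?m2 \<cdot> y) \<cdot> \<pi>1"
        by (rule exact_at_lift[OF ex _ _ my]) simp_all
      then have [simp]: "\<pi>1 \<in> Arr B" "Cod B \<pi>1 = Dom B \<pi>" "z \<in> Arr B" "Dom B z = Dom B \<pi>1"
        "Cod B z = Ob (n - 1) (p - r) p"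
        using epic_Arr by simp_all
      define w where "w = hsub B (y \<cdot> \<pi>1) (?\<delta> \<cdot> z)"
      have [simp]: "w \<in> Arr B" "Dom B w = Dom B \<pi>1" "Cod B w = Ob n p (p + r + 1)"
        by (simp_all add: w_def)
      have "?m2 \<cdot> (?\<delta> \<cdot> z) = ?m2 \<cdot> (y \<cdot> \<pi>1)"
        using comp_reassoc[OF m2\<delta>, of z] z(6) by simp
      then have m2w: "?m2 \<cdot> w = hzero B (Dom B \<pi>1) (Ob n p (p + 1))"
        by (simp add: w_def comp_hsub hsub_self)
      \<comment> \<open>The arrow defining the cycles also begins with \<open>?m2\<close>, so what
        \<open>?m2\<close> kills is zero in \<open>Z r n p\<close>.\<close>
      have "M n p (p + r + 1) (p - r + 1) (p + 1) = M n p (p + 1) (p - r + 1) (p + 1) \<cdot> ?m2"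
        by (simp add: M_comp)
      then have "Z_mono r n p \<cdot> (Z_epi r n p \<cdot> w) = M n p (p + 1) (p - r + 1) (p + 1) \<cdot> (?m2 \<cdot> w)"
        using comp_reassoc[OF Z_simps(7)[of r n p], of w] by simp
      then have zw: "Z_epi r n p \<cdot> w = hzero B (Dom B \<pi>1) (Z r n p)"
        using monicD_zero[OF Z_mono_monic[of r n p], of "Z_epi r n p \<cdot> w"] m2w by simp
      have "Z_epi r n p \<cdot> (y \<cdot> \<pi>1) = Z_epi r n p \<cdot> (?\<delta> \<cdot> z)"
        by (rule hsub_eq_hzero) (use zw in \<open>simp_all add: w_def comp_hsub\<close>)
      then have xb: "x \<cdot> (\<pi> \<cdot> \<pi>1) = b \<cdot> (?e \<cdot> z)"
        using comp_reassoc[OF y(6), of \<pi>1] comp_reassoc[OF be, of z] by simp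
      have "(g \<cdot> x) \<cdot> (\<pi> \<cdot> \<pi>1) = g \<cdot> (b \<cdot> (?e \<cdot> z))"
        by (simp add: xb)
      also have "\<dots> = hzero B (Dom B \<pi>1) (Cod B g)"
        using comp_reassoc[OF gb, of "?e \<cdot> z"] by simp
      finally have "(g \<cdot> x) \<cdot> (\<pi> \<cdot> \<pi>1) = hzero B (Dom B (\<pi> \<cdot> \<pi>1)) (Cod B (g \<cdot> x))"
        by simp
      moreover have "epic B (\<pi> \<cdot> \<pi>1)"
        using y(1) z(1) by (intro epic_comp) simp_all
      ultimately show "g \<cdot> x = hzero B (Dom B x) (Cod B g)"
        using epicD_zero[of "\<pi> \<cdot> \<pi>1" "g \<cdot> x"] by simp
    qed simp_all
    then show "\<exists>h\<in>Arr B. Dom B h = Cod B (Z_proj r n p) \<and> Cod B h = Cod B g \<and> h \<cdot> Z_proj r n p = g"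
      by blast
  qed (use pb in \<open>simp_all add: Z_proj_epic\<close>)
  then show ?thesis
    using b by (intro bexI[of _ b]) simp_all
qed

theorem spectral_sequence_E1: "spectral_sequence B (E1 B S)"
  unfolding spectral_sequence_def
proof (intro allI impI)
  fix r p q :: int
  assume r: "1 \<le> r"
  have conv: "so_E B S r p q = E r (p + q) p" "so_d B S r p q = E_diff r (p + q) p"
    "so_i B S r p q = Z_incl r (p + q) p" "so_p B S r p q = Z_proj r (p + q) p"
    "so_E B S (r + 1) p q = E (r + 1) (p + q) p" for r p q
    by (simp_all add: E_def E_diff_def Z_incl_def Z_proj_def)
  \<comment> \<open>Differentials raise the total degree by one; these identities pass from
    bidegrees to pairs of total degree and \<open>p\<close>.\<close>
  have s: "p + r + (q - r + 1) = p + q + 1" "p + r + r + (q - r + 1 - r + 1) = p + q + 1 + 1"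
    "p - r + (q + r - 1) = p + q - 1"
    by simp_all
  show "ssE (E1 B S) r p q \<in> Obj B \<and>
     ssd (E1 B S) r p q \<in> Hom B (ssE (E1 B S) r p q) (ssE (E1 B S) r (p + r) (q - r + 1)) \<and>
     ssd (E1 B S) r (p + r) (q - r + 1) \<cdot> ssd (E1 B S) r p q
       = hzero B (ssE (E1 B S) r p q) (ssE (E1 B S) r (p + r + r) (q - r + 1 - r + 1)) \<and>
     is_kernel B (ssi (E1 B S) r p q) (ssd (E1 B S) r p q) \<and>
     (\<exists>b \<in> Hom B (ssE (E1 B S) r (p - r) (q + r - 1)) (Dom B (ssi (E1 B S) r p q)).
        ssi (E1 B S) r p q \<cdot> b = ssd (E1 B S) r (p - r) (q + r - 1) \<and>
        is_cokernel B (ssp (E1 B S) r p q) b \<and> Cod B (ssp (E1 B S) r p q) = ssE (E1 B S) (r + 1) p q)"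
    using r E_diff_E_diff[OF r, of "p + q" p] kernel_E_diff[OF r, of "p + q" p] cokernel_E_diff[OF r, of "p + q" p]
    unfolding E1_def specseq.simps conv s by simp
qed

end

text \<open>Pages and cycles are images of structure maps, with which \<open>f\<close> commutes, so
  \<open>f\<close> induces maps of images on both. Each required square is then verified on
  representatives, that is after composition with the epimorphism defining its source.\<close>

lemma (in abelian_category) spectral_sequence_morphism_E1:
  assumes f: "spectral_object_morphism C S S' f"
  shows "\<exists>F. (\<forall>p q. F 1 p q = f (p + q) p (p + 1)) \<and>
    spectral_sequence_morphism C (E1 C S) (E1 C S') F"
proof -
  have "spectral_object C S" "spectral_object C S'"
    using f by (auto simp: spectral_object_morphism_def)
  then interpret S: graded_spectral_object C S + S': graded_spectral_object C S'
    by unfold_locales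
  have f_simps [simp]: "f n p q \<in> Arr C" "Dom C (f n p q) = S.Ob n p q" "Cod C (f n p q) = S'.Ob n p q"
    if "p \<le> q" for n p q
    using f that by (auto simp: spectral_object_morphism_def)
  have f_M: "f n p' q' \<cdot> S.M n p q p' q' = S'.M n p q p' q' \<cdot> f n p q"
    if "p \<le> q" "p' \<le> q'" "p' \<le> p" "q' \<le> q" for n p q p' q'
    using f that by (auto simp: spectral_object_morphism_def)
  have f_\<Delta>: "f (n + 1) q r \<cdot> S.\<Delta> n p q r = S'.\<Delta> n p q r \<cdot> f n p q"
    if "p \<le> q" "q \<le> r" for n p q r
    using f that by (auto simp: spectral_object_morphism_def)
  \<comment> \<open>\<open>G\<close> acts on the pages and \<open>H\<close> on the cycles;
    \<open>H\<close> serves as the witness \<open>g\<close> in the definition of a morphism of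
    spectral sequences.\<close>
  define G where "G r n p = (THE h. h \<in> Hom C (Cod C (S.E_epi r n p)) (Cod C (S'.E_epi r n p)) \<and>
    h \<cdot> S.E_epi r n p = S'.E_epi r n p \<cdot> f n p (p + r))" for r n p
  define H where "H r n p = (THE h. h \<in> Hom C (Cod C (S.Z_epi r n p)) (Cod C (S'.Z_epi r n p)) \<and>
    h \<cdot> S.Z_epi r n p = S'.Z_epi r n p \<cdot> f n p (p + r + 1))" for r n p
  have G [simp]: "G r n p \<in> Arr C" "Dom C (G r n p) = S.E r n p" "Cod C (G r n p) = S'.E r n p"
    and G_E_epi: "G r n p \<cdot> S.E_epi r n p = S'.E_epi r n p \<cdot> f n p (p + r)" if r: "1 \<le> r" for r n p
  proof -
    have "S'.M n p (p + r) (p - r + 1) (p + 1) \<cdot> f n p (p + r)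
        = f n (p - r + 1) (p + 1) \<cdot> S.M n p (p + r) (p - r + 1) (p + 1)"
      using r by (intro f_M[symmetric]) auto
    note h = image_fact_map_THE[OF S.image_fact_E[OF r] S'.image_fact_E[OF r] _ _ _ _ _ _ this G_def]
    show "G r n p \<in> Arr C" "Dom C (G r n p) = S.E r n p" "Cod C (G r n p) = S'.E r n p"
      "G r n p \<cdot> S.E_epi r n p = S'.E_epi r n p \<cdot> f n p (p + r)"
      using h r by simp_all
  qed
  have H [simp]: "H r n p \<in> Arr C" "Dom C (H r n p) = S.Z r n p" "Cod C (H r n p) = S'.Z r n p"
    and H_Z_epi: "H r n p \<cdot> S.Z_epi r n p = S'.Z_epi r n p \<cdot> f n p (p + r + 1)" if r: "1 \<le> r" for r n p
  proof -
    have "S'.M n p (p + r + 1) (p - r + 1) (p + 1) \<cdot> f n p (p + r + 1)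
        = f n (p - r + 1) (p + 1) \<cdot> S.M n p (p + r + 1) (p - r + 1) (p + 1)"
      using r by (intro f_M[symmetric]) auto
    note h = image_fact_map_THE[OF S.image_fact_Z[OF r] S'.image_fact_Z[OF r] _ _ _ _ _ _ this H_def]
    show "H r n p \<in> Arr C" "Dom C (H r n p) = S.Z r n p" "Cod C (H r n p) = S'.Z r n p"
      "H r n p \<cdot> S.Z_epi r n p = S'.Z_epi r n p \<cdot> f n p (p + r + 1)"
      using h r by simp_all
  qed
  \<comment> \<open>On the first page the defining epimorphisms are identities, so the induced map
    is \<open>f\<close> itself.\<close>
  have G1: "G 1 n p = f n p (p + 1)" for n p
  proof (rule epicD[OF S.E_epi_epic[of 1 n p]])
    have "S.E_epi 1 n p = Ide C (S.Ob n p (p + 1))" "S'.E_epi 1 n p = Ide C (S'.Ob n p (p + 1))"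
      by (simp_all add: S.E_epi_def S'.E_epi_def so_epi_def)
    then show "G 1 n p \<cdot> S.E_epi 1 n p = f n p (p + 1) \<cdot> S.E_epi 1 n p"
      using G_E_epi[of 1 n p] by simp
  qed (simp_all add: S.E_epi_def so_epi_def S.E_eq S'.E_eq S'.E_epi_def)
  have G_d: "G r (n + 1) (p + r) \<cdot> S.E_diff r n p = S'.E_diff r n p \<cdot> G r n p" if r: "1 \<le> r" for r n p
  proof (rule epicD[OF S.E_epi_epic[OF r, of n p]])
    have "(G r (n + 1) (p + r) \<cdot> S.E_diff r n p) \<cdot> S.E_epi r n p
        = (G r (n + 1) (p + r) \<cdot> S.E_epi r (n + 1) (p + r)) \<cdot> S.\<Delta> n p (p + r) (p + r + r)"
      using r by (simp add: S.E_diff_E_epi)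
    also have "\<dots> = S'.E_epi r (n + 1) (p + r) \<cdot> (S'.\<Delta> n p (p + r) (p + r + r) \<cdot> f n p (p + r))"
      using r by (simp add: G_E_epi f_\<Delta>)
    also have "\<dots> = (S'.E_diff r n p \<cdot> S'.E_epi r n p) \<cdot> f n p (p + r)"
      using r by (simp add: S'.E_diff_E_epi)
    also have "\<dots> = (S'.E_diff r n p \<cdot> G r n p) \<cdot> S.E_epi r n p"
      using r by (simp add: G_E_epi)
    finally show "(G r (n + 1) (p + r) \<cdot> S.E_diff r n p) \<cdot> S.E_epi r n p
        = (S'.E_diff r n p \<cdot> G r n p) \<cdot> S.E_epi r n p" .
  qed (use r in simp_all)
  have H_i: "S'.Z_incl r n p \<cdot> H r n p = G r n p \<cdot> S.Z_incl r n p" if r: "1 \<le> r" for r n p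
  proof (rule epicD[OF S.Z_epi_epic[OF r, of n p]])
    have "(S'.Z_incl r n p \<cdot> H r n p) \<cdot> S.Z_epi r n p = (S'.Z_incl r n p \<cdot> S'.Z_epi r n p) \<cdot> f n p (p + r + 1)"
      using r by (simp add: H_Z_epi)
    also have "\<dots> = S'.E_epi r n p \<cdot> (f n p (p + r) \<cdot> S.M n p (p + r + 1) p (p + r))"
      using r by (simp add: S'.Z_incl_Z_epi f_M)
    also have "\<dots> = (G r n p \<cdot> S.E_epi r n p) \<cdot> S.M n p (p + r + 1) p (p + r)"
      using r by (simp add: G_E_epi)
    also have "\<dots> = (G r n p \<cdot> S.Z_incl r n p) \<cdot> S.Z_epi r n p"
      using r by (simp add: S.Z_incl_Z_epi)
    finally show "(S'.Z_incl r n p \<cdot> H r n p) \<cdot> S.Z_epi r n p = (G r n p \<cdot> S.Z_incl r n p) \<cdot> S.Z_epi r n p" .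
  qed (use r in simp_all)
  have H_p: "S'.Z_proj r n p \<cdot> H r n p = G (r + 1) n p \<cdot> S.Z_proj r n p" if r: "1 \<le> r" for r n p
  proof (rule epicD[OF S.Z_epi_epic[OF r, of n p]])
    have "(S'.Z_proj r n p \<cdot> H r n p) \<cdot> S.Z_epi r n p = (S'.Z_proj r n p \<cdot> S'.Z_epi r n p) \<cdot> f n p (p + r + 1)"
      using r by (simp add: H_Z_epi)
    also have "\<dots> = G (r + 1) n p \<cdot> S.E_epi (r + 1) n p"
      using r G_E_epi[of "r + 1" n p] by (simp add: S'.Z_proj_Z_epi add.assoc)
    also have "\<dots> = (G (r + 1) n p \<cdot> S.Z_proj r n p) \<cdot> S.Z_epi r n p"
      using r by (simp add: S.Z_proj_Z_epi)
    finally show "(S'.Z_proj r n p \<cdot> H r n p) \<cdot> S.Z_epi r n p = (G (r + 1) n p \<cdot> S.Z_proj r n p) \<cdot> S.Z_epi r n p" .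
  qed (use r in simp_all)
  have conv: "so_E C S r p q = S.E r (p + q) p" "so_d C S r p q = S.E_diff r (p + q) p"
    "so_i C S r p q = S.Z_incl r (p + q) p" "so_p C S r p q = S.Z_proj r (p + q) p"
    "so_E C S' r p q = S'.E r (p + q) p" "so_d C S' r p q = S'.E_diff r (p + q) p"
    "so_i C S' r p q = S'.Z_incl r (p + q) p" "so_p C S' r p q = S'.Z_proj r (p + q) p" for r p q
    by (simp_all add: S.E_def S.E_diff_def S.Z_incl_def S.Z_proj_def S'.E_def S'.E_diff_def S'.Z_incl_def S'.Z_proj_def)
  have s: "p + r + (q - r + 1) = p + q + 1" for p q r :: int
    by simp
  have "spectral_sequence_morphism C (E1 C S) (E1 C S') (\<lambda>r p q. G r (p + q) p)"
    unfolding spectral_sequence_morphism_def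
  proof (intro conjI allI impI S.spectral_sequence_E1 S'.spectral_sequence_E1)
    fix r p q :: int
    assume r: "1 \<le> r"
    show "G r (p + q) p \<in> Hom C (ssE (E1 C S) r p q) (ssE (E1 C S') r p q)"
      using r unfolding E1_def specseq.simps conv by simp
    show "G r (p + r + (q - r + 1)) (p + r) \<cdot> ssd (E1 C S) r p q
        = ssd (E1 C S') r p q \<cdot> G r (p + q) p"
      using G_d[OF r] unfolding E1_def specseq.simps conv s by simp
    show "\<exists>g \<in> Hom C (Dom C (ssi (E1 C S) r p q)) (Dom C (ssi (E1 C S') r p q)).
           ssi (E1 C S') r p q \<cdot> g = G r (p + q) p \<cdot> ssi (E1 C S) r p q \<and>
           ssp (E1 C S') r p q \<cdot> g = G (r + 1) (p + q) p \<cdot> ssp (E1 C S) r p q"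
      using r H_i[OF r, of "p + q" p] H_p[OF r, of "p + q" p] unfolding E1_def specseq.simps conv
      by (intro bexI[of _ "H r (p + q) p"]) simp_all
  qed
  then show ?thesis
    using G1 by (intro exI[of _ "\<lambda>r p q. G r (p + q) p"]) simp
qed

section \<open>Additive functors\<close>

locale additive_functor_between = C: additive_category C + D: additive_category D
  for C :: "('o, 'm, 'x) acat_scheme" and D :: "('p, 'n, 'y) acat_scheme" +
  fixes F :: "('o, 'm, 'p, 'n) functr"
  assumes additive: "additive_functor C D F"
begin

lemma map_Obj [simp]: "x \<in> Obj C \<Longrightarrow> onO F x \<in> Obj D"
  and map_Ide [simp]: "x \<in> Obj C \<Longrightarrow> onM F (Ide C x) = Ide D (onO F x)"
  using additive unfolding additive_functor_def cat_functor_def by blast+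

lemma map_Arr [simp]:
  assumes "f \<in> Arr C"
  shows "onM F f \<in> Arr D" "Dom D (onM F f) = onO F (Dom C f)" "Cod D (onM F f) = onO F (Cod C f)"
proof -
  have "f \<in> Hom C (Dom C f) (Cod C f)" "Dom C f \<in> Obj C" "Cod C f \<in> Obj C"
    using assms by auto
  then have "onM F f \<in> Hom D (onO F (Dom C f)) (onO F (Cod C f))"
    using additive unfolding additive_functor_def cat_functor_def by blast
  then show "onM F f \<in> Arr D" "Dom D (onM F f) = onO F (Dom C f)"
    "Cod D (onM F f) = onO F (Cod C f)"
    by auto
qed

lemma map_comp [simp]:
  assumes "f \<in> Arr C" "g \<in> Arr C" "Dom C g = Cod C f"
  shows "onM F (g \<cdot>\<^bsub>C\<^esub> f) = onM F g \<cdot>\<^bsub>D\<^esub> onM F f"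
proof -
  have "f \<in> Hom C (Dom C f) (Cod C f)" "g \<in> Hom C (Cod C f) (Cod C g)"
    "Dom C f \<in> Obj C" "Cod C f \<in> Obj C" "Cod C g \<in> Obj C"
    using assms by auto
  then show ?thesis
    using additive unfolding additive_functor_def cat_functor_def by blast
qed

lemma map_comp_eq:
  assumes "g \<cdot>\<^bsub>C\<^esub> f = k" "f \<in> Arr C" "g \<in> Arr C" "Dom C g = Cod C f"
  shows "onM F g \<cdot>\<^bsub>D\<^esub> onM F f = onM F k"
  using assms by auto

lemma map_hadd [simp]:
  assumes "f \<in> Arr C" "g \<in> Arr C" "Dom C f = Dom C g" "Cod C f = Cod C g"
  shows "onM F (hadd C f g) = hadd D (onM F f) (onM F g)"
proof -
  have "f \<in> Hom C (Dom C g) (Cod C g)" "g \<in> Hom C (Dom C g) (Cod C g)"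
    "Dom C g \<in> Obj C" "Cod C g \<in> Obj C"
    using assms by auto
  then show ?thesis
    using additive unfolding additive_functor_def by blast
qed

lemma map_hzero [simp]:
  assumes "x \<in> Obj C" "y \<in> Obj C"
  shows "onM F (hzero C x y) = hzero D (onO F x) (onO F y)"
proof (rule D.hadd_idem)
  have "hadd C (hzero C x y) (hzero C x y) = hzero C x y"
    using assms by (simp add: C.hadd_hzero)
  then show "hadd D (onM F (hzero C x y)) (onM F (hzero C x y)) = onM F (hzero C x y)"
    using map_hadd[of "hzero C x y" "hzero C x y"] assms by simp
qed (use assms in auto)

lemma map_hneg [simp]:
  assumes "f \<in> Arr C"
  shows "onM F (hneg C f) = hneg D (onM F f)"
proof (rule D.hneg_unique)
  show "hadd D (onM F f) (onM F (hneg C f))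
      = hzero D (Dom D (onM F f)) (Cod D (onM F f))"
    using map_hadd[of f "hneg C f"] assms by simp
qed (use assms in auto)

lemma map_isomor:
  assumes "isomor C f"
  shows "isomor D (onM F f)"
proof -
  note f = isomor_arr_inv[OF assms]
  show ?thesis
    by (rule D.isomorI[where g = "onM F (arr_inv C f)"])
      (use f map_comp_eq[OF f(5)] map_comp_eq[OF f(6)] in simp_all)
qed

lemma map_zero_object:
  assumes "zero_object C x"
  shows "zero_object D (onO F x)"
proof -
  have x: "x \<in> Obj C"
    using assms by (simp add: zero_object_def)
  then have "Ide C x = hzero C x x"
    using assms C.zero_object_iff_Ide by blast
  then show ?thesis
    using map_Ide[OF x] x by (simp add: D.zero_object_iff_Ide)
qed

end

section \<open>Triangulated categories\<close>

context additive_category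
begin

lemma isomor_hneg_Ide: "x \<in> Obj C \<Longrightarrow> isomor C (hneg C (Ide C x))"
  by (rule isomorI[where g = "hneg C (Ide C x)"]) simp_all

end

section \<open>Weak kernels, weak cokernels and translates of distinguished triangles\<close>

context triangulated_category
begin

sublocale Sh: additive_functor_between D D "Sh D n" for n
  using shift_functor by unfold_locales

lemma Sh_Sh [simp]:
  "x \<in> Obj D \<Longrightarrow> onO (Sh D m) (onO (Sh D n) x) = onO (Sh D (m + n)) x"
  "f \<in> Arr D \<Longrightarrow> onM (Sh D m) (onM (Sh D n) f) = onM (Sh D (m + n)) f"
  by (simp_all add: shift_add)

lemmas Sh_0 [simp] = shift_0

lemma Sh_cancel:
  assumes "f \<in> Arr D" "g \<in> Arr D" "onM (Sh D n) f = onM (Sh D n) g"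
  shows "f = g"
proof -
  have "onM (Sh D (- n)) (onM (Sh D n) f) = onM (Sh D (- n)) (onM (Sh D n) g)"
    by (simp only: assms(3))
  then show ?thesis
    using assms(1,2) by simp
qed

lemma Sh_zero_cancel:
  assumes "f \<in> Arr D" "onM (Sh D n) f = hzero D (onO (Sh D n) (Dom D f)) (onO (Sh D n) (Cod D f))"
  shows "f = hzero D (Dom D f) (Cod D f)"
  by (rule Sh_cancel[of _ _ n]) (use assms in auto)

lemma triD:
  assumes "(f, g, h) \<in> Tri D"
  shows "f \<in> Arr D" "g \<in> Arr D" "h \<in> Arr D" "Dom D g = Cod D f" "Dom D h = Cod D g"
    "Cod D h = onO (Sh D 1) (Dom D f)"
  using tri_triangle[OF assms] by (auto simp: triangle_def)

lemma tri_rotate: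
  assumes "(f, g, h) \<in> Tri D"
  shows "(g, h, hneg D (onM (Sh D 1) f)) \<in> Tri D"
  using TR2[OF tri_triangle[OF assms]] assms by blast

lemma TR3_ex:
  assumes t: "(f, g, h) \<in> Tri D" "(f', g', h') \<in> Tri D"
    and "a \<in> Arr D" "Dom D a = Dom D f" "Cod D a = Dom D f'"
    "b \<in> Arr D" "Dom D b = Cod D f" "Cod D b = Cod D f'" "b \<cdot> f = f' \<cdot> a"
  obtains c where "c \<in> Arr D" "Dom D c = Cod D g" "Cod D c = Cod D g'"
    "c \<cdot> g = g' \<cdot> b" "onM (Sh D 1) a \<cdot> h = h' \<cdot> c"
proof -
  note t1 = triD[OF t(1)] and t2 = triD[OF t(2)]
  have "a \<in> Hom D (Dom D f) (Dom D f')" "b \<in> Hom D (Dom D g) (Dom D g')"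
    using assms t1 t2 by auto
  then obtain c where "triangle_morphism D (f, g, h) (f', g', h') a b c"
    using TR3[OF t] assms(9) by blast
  then show thesis
    using that[of c] t1 t2 unfolding triangle_morphism_def by auto
qed

lemma TR1_iso_tri:
  assumes t: "(f, g, h) \<in> Tri D"
    and "f' \<in> Arr D" "g' \<in> Arr D" "h' \<in> Arr D" "Dom D g' = Cod D f'" "Dom D h' = Cod D g'"
      "Cod D h' = onO (Sh D 1) (Dom D f')"
    and "isomor D a" "isomor D b" "isomor D c"
    and "Dom D a = Dom D f" "Cod D a = Dom D f'" "Dom D b = Cod D f" "Cod D b = Cod D f'"
      "Dom D c = Cod D g" "Cod D c = Cod D g'"
    and "b \<cdot> f = f' \<cdot> a" "c \<cdot> g = g' \<cdot> b" "onM (Sh D 1) a \<cdot> h = h' \<cdot> c"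
  shows "(f', g', h') \<in> Tri D"
proof (rule TR1_iso[OF t, of f' g' h' a b c])
  note t1 = triD[OF t]
  show "triangle D f' g' h'"
    using assms by (simp add: triangle_def)
  show "triangle_morphism D (f, g, h) (f', g', h') a b c"
    using assms t1 isomor_arr_inv(1)[OF assms(8)] isomor_arr_inv(1)[OF assms(9)]
      isomor_arr_inv(1)[OF assms(10)] by (simp add: triangle_morphism_def)
qed (use assms in auto)

text \<open>Since \<open>k\<close> kills \<open>f\<close>, it is the middle component of a map from
  the first arrow of the triangle to the zero arrow \<open>z \<rightarrow> Cod D k\<close>. TR3
  completes this to a map into the triangle \<open>z \<rightarrow> Cod D k = Cod D k\<close>, and
  the third component is \<open>l\<close>.\<close>

lemma tri_weak_cokernel:
  assumes t: "(f, g, h) \<in> Tri D" and k: "k \<in> Arr D" "Dom D k = Cod D f"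
    "k \<cdot> f = hzero D (Dom D f) (Cod D k)"
  obtains l where "l \<in> Arr D" "Dom D l = Cod D g" "Cod D l = Cod D k" "l \<cdot> g = k"
proof -
  note t1 = triD[OF t]
  obtain z where z: "zero_object D z"
    using ex_zero_object by blast
  then have [simp]: "z \<in> Obj D"
    by (simp add: zero_object_def)
  \<comment> \<open>The zero object is taken to be \<open>z[1]\<close>, so that undoing one rotation
    puts \<open>z\<close> in first place.\<close>
  have "(Ide D (Cod D k), hzero D (Cod D k) (onO (Sh D 1) z),
      hzero D (onO (Sh D 1) z) (onO (Sh D 1) (Cod D k))) \<in> Tri D"
    using k Sh.map_zero_object[OF z] by (intro TR1_ide) auto
  moreover have "triangle D (hzero D z (Cod D k)) (Ide D (Cod D k)) (hzero D (Cod D k) (onO (Sh D 1) z))"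
    using k by (simp add: triangle_def)
  ultimately have i: "(hzero D z (Cod D k), Ide D (Cod D k), hzero D (Cod D k) (onO (Sh D 1) z)) \<in> Tri D"
    using TR2[of "hzero D z (Cod D k)" "Ide D (Cod D k)" "hzero D (Cod D k) (onO (Sh D 1) z)"] k
    by simp
  obtain c where c: "c \<in> Arr D" "Dom D c = Cod D g" "Cod D c = Cod D (Ide D (Cod D k))"
    "c \<cdot> g = Ide D (Cod D k) \<cdot> k"
    by (rule TR3_ex[OF t i, of "hzero D (Dom D f) z" k]) (use t1 k in simp_all)
  then show thesis
    using that[of c] k by simp
qed

text \<open>TR3 is applied to the rotated triangle and to the triangle
  \<open>?W \<rightarrow> 0 \<rightarrow> ?W[1]\<close>. The third component \<open>c\<close> goes
  from \<open>?W[1]\<close> to the translate of the source of \<open>f\<close>, so \<open>l\<close>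
  is \<open>c[-1]\<close>. The signs introduced by the two rotations cancel.\<close>

lemma tri_weak_kernel:
  assumes t: "(f, g, h) \<in> Tri D" and k: "k \<in> Arr D" "Cod D k = Cod D f"
    "g \<cdot> k = hzero D (Dom D k) (Cod D g)"
  obtains l where "l \<in> Arr D" "Dom D l = Dom D k" "Cod D l = Dom D f" "f \<cdot> l = k"
proof -
  note t1 = triD[OF t]
  let ?W = "Dom D k"
  obtain z where z: "zero_object D z"
    using ex_zero_object by blast
  then have [simp]: "z \<in> Obj D"
    by (simp add: zero_object_def)
  have "(Ide D ?W, hzero D ?W z, hzero D z (onO (Sh D 1) ?W)) \<in> Tri D"
    using k z by (intro TR1_ide) auto
  from tri_rotate[OF this]
  have i: "(hzero D ?W z, hzero D z (onO (Sh D 1) ?W), hneg D (Ide D (onO (Sh D 1) ?W))) \<in> Tri D"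
    using k by simp
  obtain c where c: "c \<in> Arr D" "Dom D c = onO (Sh D 1) ?W" "Cod D c = onO (Sh D 1) (Dom D f)"
    "onM (Sh D 1) k \<cdot> hneg D (Ide D (onO (Sh D 1) ?W)) = hneg D (onM (Sh D 1) f) \<cdot> c"
    by (rule TR3_ex[OF i tri_rotate[OF t], of k "hzero D z (Cod D g)"]) (use t1 k in simp_all)
  define l where "l = onM (Sh D (- 1)) c"
  have l: "l \<in> Arr D" "Dom D l = ?W" "Cod D l = Dom D f"
    using c(1-3) t1 k by (simp_all add: l_def)
  have "hneg D (onM (Sh D 1) k) = hneg D (onM (Sh D 1) f \<cdot> c)"
    using c t1 k by simp
  then have "hneg D (hneg D (onM (Sh D 1) k)) = hneg D (hneg D (onM (Sh D 1) f \<cdot> c))"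
    by (rule arg_cong)
  then have "onM (Sh D 1) k = onM (Sh D 1) f \<cdot> c"
    using c(1-3) t1 k(1,2) by simp
  moreover have "onM (Sh D 1) l = c"
    using c(1) by (simp add: l_def)
  ultimately have "onM (Sh D 1) (f \<cdot> l) = onM (Sh D 1) k"
    using l t1 by simp
  then have "f \<cdot> l = k"
    by (rule Sh_cancel[rotated 2]) (use l t1 k in auto)
  then show thesis
    using that l by blast
qed

text \<open>Changing two of the three signs is an isomorphism of triangles, given by minus the
  identity on the middle object.\<close>

lemma tri_hneg:
  assumes t: "(f, g, h) \<in> Tri D"
  shows "(hneg D f, hneg D g, h) \<in> Tri D"
proof -
  note t1 = triD[OF t]
  show ?thesis
    by (rule TR1_iso_tri[OF t, where a = "Ide D (Dom D f)" and b = "hneg D (Ide D (Cod D f))"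
          and c = "Ide D (Cod D g)"])
      (use t1 in \<open>simp_all add: isomor_Ide isomor_hneg_Ide\<close>)
qed

text \<open>Three rotations produce the translate with a minus sign on each arrow;
  \<open>tri_hneg\<close> removes two of them.\<close>

lemma tri_shift_succ:
  assumes t: "(f, g, h) \<in> Tri D"
  shows "(onM (Sh D 1) f, onM (Sh D 1) g, hneg D (onM (Sh D 1) h)) \<in> Tri D"
  using tri_hneg[OF tri_rotate[OF tri_rotate[OF tri_rotate[OF t]]]] triD[OF t] by simp

text \<open>Three rotations of the candidate lead to \<open>f\<close> and \<open>g\<close> with
  minus signs and \<open>h\<close> without, which is distinguished by \<open>tri_hneg\<close>; TR2
  is then read backwards.\<close>

lemma tri_shift_pred:
  assumes t: "(f, g, h) \<in> Tri D"
  shows "(onM (Sh D (- 1)) f, onM (Sh D (- 1)) g, hneg D (onM (Sh D (- 1)) h)) \<in> Tri D"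
proof -
  note t1 = triD[OF t]
  let ?a = "onM (Sh D (- 1)) f" and ?b = "onM (Sh D (- 1)) g"
    and ?c = "hneg D (onM (Sh D (- 1)) h)"
  have "triangle D ?a ?b ?c" "triangle D ?b ?c (hneg D f)" "triangle D ?c (hneg D f) (hneg D g)"
    using t1 by (simp_all add: triangle_def)
  from this[THEN TR2] show ?thesis
    using tri_hneg[OF t] t1 by simp
qed

text \<open>The sign alternates with the parity of \<open>n\<close>. Leaving it open suffices,
  because \<open>exact_at_hneg\<close> removes it wherever a cohomological functor is
  applied.\<close>

lemma tri_shift:
  assumes t: "(f, g, h) \<in> Tri D"
  shows "\<exists>h'. (onM (Sh D n) f, onM (Sh D n) g, h') \<in> Tri D \<and>
    (h' = onM (Sh D n) h \<or> h' = hneg D (onM (Sh D n) h))"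
proof (induction n rule: int_induct[of _ 0])
  case base
  then show ?case
    using t triD[OF t] by auto
next
  case (step1 i)
  then obtain h' where h': "(onM (Sh D i) f, onM (Sh D i) g, h') \<in> Tri D"
    "h' = onM (Sh D i) h \<or> h' = hneg D (onM (Sh D i) h)"
    by blast
  then show ?case
    using tri_shift_succ[OF h'(1)] triD[OF t]
    by (intro exI[of _ "hneg D (onM (Sh D 1) h')"]) (auto simp: add.commute)
next
  case (step2 i)
  then obtain h' where h': "(onM (Sh D i) f, onM (Sh D i) g, h') \<in> Tri D"
    "h' = onM (Sh D i) h \<or> h' = hneg D (onM (Sh D i) h)"
    by blast
  then show ?case
    using tri_shift_pred[OF h'(1)] triD[OF t]
    by (intro exI[of _ "hneg D (onM (Sh D (- 1)) h')"]) auto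
qed

end

section \<open>t-structures\<close>

context t_category
begin

lemma t_le_Obj: "X \<in> t_le D n \<Longrightarrow> X \<in> Obj D"
  and t_ge_Obj: "X \<in> t_ge D n \<Longrightarrow> X \<in> Obj D"
  by (auto simp: t_le_def t_ge_def)

lemma Sh_t_le: "X \<in> Obj D \<Longrightarrow> onO (Sh D k) X \<in> t_le D n \<longleftrightarrow> X \<in> t_le D (n + k)"
  and Sh_t_ge: "X \<in> Obj D \<Longrightarrow> onO (Sh D k) X \<in> t_ge D n \<longleftrightarrow> X \<in> t_ge D (n + k)"
  by (auto simp: t_le_def t_ge_def)

lemma t_le_subset:
  assumes "m \<le> n"
  shows "t_le D m \<subseteq> t_le D n"
  using assms
proof (induction n rule: int_ge_induct)
  case (step i)
  have "X \<in> t_le D (i + 1)" if "X \<in> t_le D i" for X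
    using that t_le_mono Sh_t_le[of X i 0] Sh_t_le[of X i 1] t_le_Obj[OF that]
    by (auto simp: add.commute)
  then show ?case
    using step by blast
qed auto

lemma t_ge_subset:
  assumes "m \<le> n"
  shows "t_ge D n \<subseteq> t_ge D m"
  using assms
proof (induction n rule: int_ge_induct)
  case (step i)
  have "X \<in> t_ge D i" if "X \<in> t_ge D (i + 1)" for X
    using that t_ge_mono Sh_t_ge[of X i 0] Sh_t_ge[of X i 1] t_ge_Obj[OF that]
    by (auto simp: add.commute)
  then show ?case
    using step by blast
qed auto

text \<open>Translation by \<open>m\<close> reduces this to the axiom for \<open>t_le D 0\<close>
  and \<open>t_ge D 1\<close>.\<close>

lemma orthogonal:
  assumes "f \<in> Arr D" "Dom D f \<in> t_le D m" "Cod D f \<in> t_ge D n" "m < n"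
  shows "f = hzero D (Dom D f) (Cod D f)"
proof (rule Sh_zero_cancel[OF assms(1), of m])
  have "onO (Sh D m) (Dom D f) \<in> t_le D 0"
    using assms by (simp add: Sh_t_le)
  moreover have "Cod D f \<in> t_ge D (1 + m)"
    using assms t_ge_subset[of "1 + m" n] by auto
  then have "onO (Sh D m) (Cod D f) \<in> t_ge D 1"
    using assms by (simp add: Sh_t_ge)
  ultimately have "Hom D (onO (Sh D m) (Dom D f)) (onO (Sh D m) (Cod D f))
      = {hzero D (onO (Sh D m) (Dom D f)) (onO (Sh D m) (Cod D f))}"
    by (rule t_orthogonal)
  moreover have "onM (Sh D m) f \<in> Hom D (onO (Sh D m) (Dom D f)) (onO (Sh D m) (Cod D f))"
    using assms(1) by simp
  ultimately show "onM (Sh D m) f = hzero D (onO (Sh D m) (Dom D f)) (onO (Sh D m) (Cod D f))"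
    by blast
qed

text \<open>The triangle of \<open>X[n]\<close> at level zero is translated back by
  \<open>- n\<close>; the sign of its third arrow is irrelevant here.\<close>

lemma trunc_tri_exists:
  assumes "X \<in> Obj D"
  shows "\<exists>t. t \<in> Tri D \<and> Cod D (fst t) = X \<and>
    Dom D (fst t) \<in> t_le D n \<and> Cod D (fst (snd t)) \<in> t_ge D (n + 1)"
proof -
  obtain i p h where t: "(i, p, h) \<in> Tri D" "Cod D i = onO (Sh D n) X"
    "Dom D i \<in> t_le D 0" "Cod D p \<in> t_ge D 1"
    using t_decompose[of "onO (Sh D n) X"] assms by auto
  note t1 = triD[OF t(1)]
  obtain h' where "(onM (Sh D (- n)) i, onM (Sh D (- n)) p, h') \<in> Tri D"
    using tri_shift[OF t(1), of "- n"] by blast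
  then show ?thesis
    using t t1 assms
    by (intro exI[of _ "(onM (Sh D (- n)) i, onM (Sh D (- n)) p, h')"])
      (auto simp: Sh_t_le Sh_t_ge)
qed

section \<open>Universal properties of the truncations\<close>

context
  fixes X
  assumes X [simp]: "X \<in> Obj D"
begin

lemma trunc_tri_Tri: "(tle_in D n X, tge_out D (n + 1) X, snd (snd (trunc_tri D n X))) \<in> Tri D"
  and Cod_tle_in [simp]: "Cod D (tle_in D n X) = X"
  and tau_le_t_le: "tau_le D n X \<in> t_le D n"
  and tau_ge_t_ge: "tau_ge D n X \<in> t_ge D n"
proof -
  have *: "trunc_tri D n X \<in> Tri D \<and> Cod D (fst (trunc_tri D n X)) = X \<and>
    Dom D (fst (trunc_tri D n X)) \<in> t_le D n \<and> Cod D (fst (snd (trunc_tri D n X))) \<in> t_ge D (n + 1)"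
    for n
    unfolding trunc_tri_def by (rule someI_ex[OF trunc_tri_exists[OF X]])
  from *[of n] show "(tle_in D n X, tge_out D (n + 1) X, snd (snd (trunc_tri D n X))) \<in> Tri D"
    "Cod D (tle_in D n X) = X" "tau_le D n X \<in> t_le D n"
    by (simp_all add: tle_in_def tge_out_def tau_le_def)
  \<comment> \<open>The object \<open>tau_ge D n X\<close> belongs to the chosen triangle with index
    \<open>n - 1\<close>.\<close>
  from *[of "n - 1"] show "tau_ge D n X \<in> t_ge D n"
    by (simp add: tau_ge_def tge_out_def)
qed

lemma trunc_simps [simp]:
  "tle_in D n X \<in> Arr D" "Dom D (tle_in D n X) = tau_le D n X"
  "tge_out D n X \<in> Arr D" "Dom D (tge_out D n X) = X" "Cod D (tge_out D n X) = tau_ge D n X"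
  "tau_le D n X \<in> Obj D" "tau_ge D n X \<in> Obj D"
proof -
  note t = triD[OF trunc_tri_Tri]
  show "tle_in D n X \<in> Arr D" "tge_out D n X \<in> Arr D" "Dom D (tge_out D n X) = X"
    using t(1)[of n] t(2)[of "n - 1"] t(4)[of "n - 1"] by simp_all
  show "Dom D (tle_in D n X) = tau_le D n X" "Cod D (tge_out D n X) = tau_ge D n X"
    by (simp_all add: tau_le_def tau_ge_def)
  show "tau_le D n X \<in> Obj D" "tau_ge D n X \<in> Obj D"
    using tau_le_t_le tau_ge_t_ge t_le_Obj t_ge_Obj by blast+
qed

text \<open>By orthogonality the composite of \<open>f\<close> with
  \<open>X \<rightarrow> tau_ge D (n + 1) X\<close> is zero, so \<open>f\<close> lifts to the weak
  kernel.\<close>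

lemma tle_factor:
  assumes f: "f \<in> Arr D" "Cod D f = X" "Dom D f \<in> t_le D n"
  obtains g where "g \<in> Arr D" "Dom D g = Dom D f" "Cod D g = tau_le D n X" "tle_in D n X \<cdot> g = f"
proof -
  have "tge_out D (n + 1) X \<cdot> f = hzero D (Dom D f) (Cod D (tge_out D (n + 1) X))"
    using orthogonal[of "tge_out D (n + 1) X \<cdot> f" n "n + 1"] f tau_ge_t_ge[of "n + 1"] by simp
  from tri_weak_kernel[OF trunc_tri_Tri f(1) _ this] show thesis
    using f that by auto
qed

text \<open>After translation, the difference of two factorisations lifts along the third arrow
  \<open>?h\<close> of the triangle. The lift goes from \<open>t_le D (n - 1)\<close> to
  \<open>t_ge D (n + 1)\<close> and vanishes.\<close>

lemma tle_unique:
  assumes "tle_in D n X \<cdot> f = tle_in D n X \<cdot> g"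
    and f: "f \<in> Arr D" "Cod D f = tau_le D n X" "Dom D f \<in> t_le D n"
    and g: "g \<in> Arr D" "Cod D g = tau_le D n X" "Dom D g = Dom D f"
  shows "f = g"
proof (rule hsub_eq_hzero)
  let ?h = "snd (snd (trunc_tri D n X))" and ?d = "hsub D f g"
  note t = trunc_tri_Tri[of n]
  note t1 = triD[OF t]
  have d: "?d \<in> Arr D" "Dom D ?d = Dom D f" "Cod D ?d = tau_le D n X"
    using f g by simp_all
  have "tle_in D n X \<cdot> ?d = hzero D (Dom D f) X"
    using f g assms(1) by (simp add: comp_hsub hsub_self)
  then have "onM (Sh D 1) (tle_in D n X \<cdot> ?d) = onM (Sh D 1) (hzero D (Dom D f) X)"
    by (rule arg_cong)
  then have "hneg D (onM (Sh D 1) (tle_in D n X)) \<cdot> onM (Sh D 1) ?d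
      = hzero D (Dom D (onM (Sh D 1) ?d)) (Cod D (hneg D (onM (Sh D 1) (tle_in D n X))))"
    using d f(1) by simp
  then obtain l where l: "l \<in> Arr D" "Dom D l = Dom D (onM (Sh D 1) ?d)" "Cod D l = Dom D ?h"
      "?h \<cdot> l = onM (Sh D 1) ?d"
    by (rule tri_weak_kernel[OF tri_rotate[OF tri_rotate[OF t]], rotated 2]) (use d t1 in simp_all)
  have "l = hzero D (Dom D l) (Cod D l)"
    by (rule orthogonal[of l "n - 1" "n + 1"])
      (use l(1-3) d f t1 tau_ge_t_ge[of "n + 1"] in \<open>simp_all add: Sh_t_le\<close>)
  then have "?h \<cdot> l = hzero D (Dom D l) (Cod D ?h)"
    using t1 l(1,3) by (metis comp_hzero(2) dom_Obj)
  then have "onM (Sh D 1) ?d = hzero D (onO (Sh D 1) (Dom D ?d)) (onO (Sh D 1) (Cod D ?d))"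
    using l t1 d by simp
  from Sh_zero_cancel[OF d(1) this] show "hsub D f g = hzero D (Dom D g) (Cod D g)"
    using d f g by simp
qed (use f g in simp_all)

lemma tge_factor:
  assumes f: "f \<in> Arr D" "Dom D f = X" "Cod D f \<in> t_ge D n"
  obtains g where "g \<in> Arr D" "Dom D g = tau_ge D n X" "Cod D g = Cod D f" "g \<cdot> tge_out D n X = f"
proof -
  have t: "(tle_in D (n - 1) X, tge_out D n X, snd (snd (trunc_tri D (n - 1) X))) \<in> Tri D"
    using trunc_tri_Tri[of "n - 1"] by simp
  have "f \<cdot> tle_in D (n - 1) X = hzero D (Dom D (tle_in D (n - 1) X)) (Cod D f)"
    using orthogonal[of "f \<cdot> tle_in D (n - 1) X" "n - 1" n] f tau_le_t_le[of "n - 1"] by simp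
  from tri_weak_cokernel[OF t f(1) _ this] show thesis
    using f that by auto
qed

text \<open>Dually, the difference factors through the translate of
  \<open>tau_le D (n - 1) X\<close>, an object of \<open>t_le D (n - 2)\<close>, which has no
  nonzero arrow to an object of \<open>t_ge D n\<close>.\<close>

lemma tge_unique:
  assumes "f \<cdot> tge_out D n X = g \<cdot> tge_out D n X"
    and f: "f \<in> Arr D" "Dom D f = tau_ge D n X" "Cod D f \<in> t_ge D n"
    and g: "g \<in> Arr D" "Dom D g = tau_ge D n X" "Cod D g = Cod D f"
  shows "f = g"
proof (rule hsub_eq_hzero)
  let ?h = "snd (snd (trunc_tri D (n - 1) X))" and ?d = "hsub D f g"
  have t: "(tle_in D (n - 1) X, tge_out D n X, ?h) \<in> Tri D"
    using trunc_tri_Tri[of "n - 1"] by simp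
  note t1 = triD[OF t]
  have d: "?d \<in> Arr D" "Dom D ?d = tau_ge D n X" "Cod D ?d = Cod D f"
    using f g by simp_all
  have "?d \<cdot> tge_out D n X = hzero D (Dom D (tge_out D n X)) (Cod D ?d)"
    using f g assms(1) by (simp add: comp_hsub hsub_self)
  then obtain l where l: "l \<in> Arr D" "Dom D l = Cod D ?h" "Cod D l = Cod D ?d" "l \<cdot> ?h = ?d"
    by (rule tri_weak_cokernel[OF tri_rotate[OF t], rotated 2]) (use d t1 in simp_all)
  have "onO (Sh D 1) (tau_le D (n - 1) X) \<in> t_le D (n - 2)"
    using tau_le_t_le[of "n - 1"] by (simp add: Sh_t_le)
  then have "l = hzero D (Dom D l) (Cod D l)"
    using orthogonal[of l "n - 2" n] l(1-3) d f(3) t1 by simp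
  then have "l \<cdot> ?h = hzero D (Dom D ?h) (Cod D l)"
    using t1 l(1,2) by (metis comp_hzero(1) cod_Obj)
  then show "hsub D f g = hzero D (Dom D g) (Cod D g)"
    using l t1 d g by simp
qed (use f g in simp_all)

lemma tle_map_props:
  assumes "m \<le> n"
  shows tle_map_simps [simp]: "tle_map D m n X \<in> Arr D" "Dom D (tle_map D m n X) = tau_le D m X"
      "Cod D (tle_map D m n X) = tau_le D n X"
    and tle_in_tle_map: "tle_in D n X \<cdot> tle_map D m n X = tle_in D m X"
proof -
  have le: "tau_le D m X \<in> t_le D n"
    using tau_le_t_le[of m] t_le_subset[OF assms] by blast
  obtain g where g: "g \<in> Arr D" "Dom D g = tau_le D m X" "Cod D g = tau_le D n X"
      "tle_in D n X \<cdot> g = tle_in D m X"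
    by (rule tle_factor[of "tle_in D m X" n]) (use le in simp_all)
  have "tle_map D m n X = g"
    unfolding tle_map_def
  proof (rule the_equality)
    fix g'
    assume g': "g' \<in> Hom D (tau_le D m X) (tau_le D n X) \<and> tle_in D n X \<cdot> g' = tle_in D m X"
    show "g' = g"
      by (rule tle_unique[of n]) (use g g' le in auto)
  qed (use g in auto)
  then show "tle_map D m n X \<in> Arr D" "Dom D (tle_map D m n X) = tau_le D m X"
    "Cod D (tle_map D m n X) = tau_le D n X" "tle_in D n X \<cdot> tle_map D m n X = tle_in D m X"
    using g by auto
qed

lemma tle_map_Ide: "tle_map D n n X = Ide D (tau_le D n X)"
  by (rule tle_unique[of n]) (simp_all add: tle_in_tle_map tau_le_t_le)

lemma tle_map_comp:
  assumes "l \<le> m" "m \<le> n"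
  shows "tle_map D m n X \<cdot> tle_map D l m X = tle_map D l n X"
proof (rule tle_unique[of n])
  show "tle_in D n X \<cdot> (tle_map D m n X \<cdot> tle_map D l m X) = tle_in D n X \<cdot> tle_map D l n X"
    using comp_reassoc[OF tle_in_tle_map[of m n], of "tle_map D l m X"] assms
    by (simp add: tle_in_tle_map)
  show "Dom D (tle_map D m n X \<cdot> tle_map D l m X) \<in> t_le D n"
    using tau_le_t_le[of l] t_le_subset[of l n] assms by auto
qed (use assms in simp_all)

end

text \<open>Both objects are universal for arrows from \<open>t_le D m\<close> to \<open>X\<close>,
  since for \<open>m \<le> n\<close> such arrows pass through \<open>tau_le D n X\<close>. It allows
  the truncation triangle of \<open>tau_le D n X\<close> to be rewritten with the canonical map
  \<open>tle_map\<close>.\<close>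

lemma isomor_tle_map:
  assumes X: "X \<in> Obj D" and "m \<le> n"
  obtains \<alpha> where "isomor D \<alpha>" "Dom D \<alpha> = tau_le D m X"
    "Cod D \<alpha> = tau_le D m (tau_le D n X)"
    "tle_in D m (tau_le D n X) \<cdot> \<alpha> = tle_map D m n X"
proof -
  note [simp] = X assms(2)
  let ?Y = "tau_le D n X"
  have le: "tau_le D m X \<in> t_le D m" "tau_le D m ?Y \<in> t_le D m"
    using tau_le_t_le by simp_all
  obtain \<alpha> where \<alpha>: "\<alpha> \<in> Arr D" "Dom D \<alpha> = tau_le D m X" "Cod D \<alpha> = tau_le D m ?Y"
      "tle_in D m ?Y \<cdot> \<alpha> = tle_map D m n X"
    by (rule tle_factor[of ?Y "tle_map D m n X" m]) (use le in simp_all)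
  obtain \<beta> where \<beta>: "\<beta> \<in> Arr D" "Dom D \<beta> = tau_le D m ?Y" "Cod D \<beta> = tau_le D m X"
      "tle_in D m X \<cdot> \<beta> = tle_in D n X \<cdot> tle_in D m ?Y"
    by (rule tle_factor[of X "tle_in D n X \<cdot> tle_in D m ?Y" m]) (use le in simp_all)
  have 1: "\<beta> \<cdot> \<alpha> = Ide D (tau_le D m X)"
  proof (rule tle_unique[of X m])
    show "tle_in D m X \<cdot> (\<beta> \<cdot> \<alpha>) = tle_in D m X \<cdot> Ide D (tau_le D m X)"
      using comp_reassoc[OF \<beta>(4), of \<alpha>] \<alpha> \<beta>(1-3) by (simp add: tle_in_tle_map)
  qed (use \<alpha> \<beta> le in simp_all)
  have 2: "\<alpha> \<cdot> \<beta> = Ide D (tau_le D m ?Y)"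
  proof (rule tle_unique[of ?Y m])
    have "tle_map D m n X \<cdot> \<beta> = tle_in D m ?Y"
    proof (rule tle_unique[of X n])
      show "tle_in D n X \<cdot> (tle_map D m n X \<cdot> \<beta>) = tle_in D n X \<cdot> tle_in D m ?Y"
        using comp_reassoc[OF tle_in_tle_map[of X m n], of \<beta>] \<beta> by simp
      show "Dom D (tle_map D m n X \<cdot> \<beta>) \<in> t_le D n"
        using \<beta> le(2) t_le_subset[of m n] by auto
    qed (use \<beta> in simp_all)
    then show "tle_in D m ?Y \<cdot> (\<alpha> \<cdot> \<beta>) = tle_in D m ?Y \<cdot> Ide D (tau_le D m ?Y)"
      using comp_reassoc[OF \<alpha>(4), of \<beta>] \<alpha>(1-3) \<beta>(1-3) by simp
  qed (use \<alpha> \<beta> le in simp_all)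
  have "isomor D \<alpha>"
    by (rule isomorI[of _ \<beta>]) (use \<alpha> \<beta> 1 2 in simp_all)
  then show thesis
    using that \<alpha> by blast
qed

section \<open>The spectral object of an object of a t-category\<close>

context
  fixes X
  assumes X [simp]: "X \<in> Obj D"
begin

lemma tsp_simps [simp]:
  "tsp_out D X p q \<in> Arr D" "Dom D (tsp_out D X p q) = tau_le D (- p) X"
  "Cod D (tsp_out D X p q) = tspO D X p q" "tspO D X p q \<in> Obj D"
  unfolding tsp_out_def tspO_def by (rule trunc_simps, simp)+

lemma tspO_t_ge:
  assumes "q' \<le> q"
  shows "tspO D X p q' \<in> t_ge D (- q + 1)"
  using tau_ge_t_ge[of "tau_le D (- p) X" "- q' + 1"] t_ge_subset[of "- q + 1" "- q' + 1"] assms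
  unfolding tspO_def by auto

lemma tsp_unique:
  assumes "f \<cdot> tsp_out D X p q = g \<cdot> tsp_out D X p q"
    "f \<in> Arr D" "Dom D f = tspO D X p q" "Cod D f \<in> t_ge D (- q + 1)"
    "g \<in> Arr D" "Dom D g = tspO D X p q" "Cod D g = Cod D f"
  shows "f = g"
  by (rule tge_unique[of "tau_le D (- p) X" f "- q + 1" g])
    (use assms in \<open>simp_all only: tsp_out_def tspO_def trunc_simps X\<close>)

text \<open>The target lies in \<open>t_ge D (- q' + 1)\<close>, hence in
  \<open>t_ge D (- q + 1)\<close>, so the arrow on the truncations from above extends uniquely over
  \<open>tspO D X p q\<close>.\<close>

lemma tspM_props:
  assumes "p' \<le> p" "q' \<le> q"
  shows tspM_simps [simp]: "tspM D X p q p' q' \<in> Arr D" "Dom D (tspM D X p q p' q') = tspO D X p q"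
      "Cod D (tspM D X p q p' q') = tspO D X p' q'"
    and tspM_tsp_out: "tspM D X p q p' q' \<cdot> tsp_out D X p q
      = tsp_out D X p' q' \<cdot> tle_map D (- p) (- p') X"
proof -
  let ?f = "tsp_out D X p' q' \<cdot> tle_map D (- p) (- p') X"
  have f: "?f \<in> Arr D" "Dom D ?f = tau_le D (- p) X" "Cod D ?f = tspO D X p' q'"
    using assms by simp_all
  note ge = tspO_t_ge[OF assms(2), of p']
  obtain g where g: "g \<in> Arr D" "Dom D g = tspO D X p q" "Cod D g = tspO D X p' q'"
      "g \<cdot> tsp_out D X p q = ?f"
    using tge_factor[of "tau_le D (- p) X" ?f "- q + 1"] f ge
    unfolding tsp_out_def[of D X p q] tspO_def[of D X p q]
    by (metis X trunc_simps(6))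
  have "tspM D X p q p' q' = g"
    unfolding tspM_def
  proof (rule the_equality)
    fix g'
    assume g': "g' \<in> Hom D (tspO D X p q) (tspO D X p' q') \<and> g' \<cdot> tsp_out D X p q = ?f"
    show "g' = g"
      by (rule tsp_unique[of _ p q]) (use g g' ge in auto)
  qed (use g in auto)
  then show "tspM D X p q p' q' \<in> Arr D" "Dom D (tspM D X p q p' q') = tspO D X p q"
    "Cod D (tspM D X p q p' q') = tspO D X p' q'" "tspM D X p q p' q' \<cdot> tsp_out D X p q = ?f"
    using g by auto
qed

lemma tspM_eqI:
  assumes "g \<in> Arr D" "Dom D g = tspO D X p q" "Cod D g = tspO D X p' q'" "p' \<le> p" "q' \<le> q"
    "g \<cdot> tsp_out D X p q = tsp_out D X p' q' \<cdot> tle_map D (- p) (- p') X"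
  shows "g = tspM D X p q p' q'"
  by (rule tsp_unique[of _ p q]) (use assms tspO_t_ge in \<open>simp_all add: tspM_tsp_out\<close>)

lemma tspM_Ide: "tspM D X p q p q = Ide D (tspO D X p q)"
  by (rule tspM_eqI[symmetric]) (simp_all add: tle_map_Ide)

lemma tspM_comp:
  assumes "p' \<le> p" "q' \<le> q" "p'' \<le> p'" "q'' \<le> q'"
  shows "tspM D X p' q' p'' q'' \<cdot> tspM D X p q p' q' = tspM D X p q p'' q''"
proof (rule tspM_eqI)
  have "tspM D X p' q' p'' q'' \<cdot> (tspM D X p q p' q' \<cdot> tsp_out D X p q)
      = tspM D X p' q' p'' q'' \<cdot> (tsp_out D X p' q' \<cdot> tle_map D (- p) (- p') X)"
    using assms by (simp add: tspM_tsp_out)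
  also have "\<dots> = tsp_out D X p'' q'' \<cdot> (tle_map D (- p') (- p'') X \<cdot> tle_map D (- p) (- p') X)"
    using comp_reassoc[OF tspM_tsp_out[OF assms(3,4)], of "tle_map D (- p) (- p') X"] assms
    by simp
  also have "\<dots> = tsp_out D X p'' q'' \<cdot> tle_map D (- p) (- p'') X"
    using assms by (simp add: tle_map_comp)
  finally show "(tspM D X p' q' p'' q'' \<cdot> tspM D X p q p' q') \<cdot> tsp_out D X p q
      = tsp_out D X p'' q'' \<cdot> tle_map D (- p) (- p'') X"
    using assms by simp
qed (use assms in simp_all)

lemma tsp_out_tri:
  assumes "p \<le> q"
  shows "\<exists>h. (tle_map D (- q) (- p) X, tsp_out D X p q, h) \<in> Tri D"
proof -
  let ?Y = "tau_le D (- p) X"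
  obtain \<alpha> where \<alpha>: "isomor D \<alpha>" "Dom D \<alpha> = tau_le D (- q) X" "Cod D \<alpha> = tau_le D (- q) ?Y"
    "tle_in D (- q) ?Y \<cdot> \<alpha> = tle_map D (- q) (- p) X"
    using isomor_tle_map[OF X, of "- q" "- p"] assms by auto
  note a = isomor_arr_inv[OF \<alpha>(1)]
  obtain h where t: "(tle_in D (- q) ?Y, tsp_out D X p q, h) \<in> Tri D"
    using trunc_tri_Tri[of ?Y "- q"] unfolding tsp_out_def by simp
  note t1 = triD[OF t]
  have "tle_map D (- q) (- p) X \<cdot> arr_inv D \<alpha> = tle_in D (- q) ?Y \<cdot> (\<alpha> \<cdot> arr_inv D \<alpha>)"
    using comp_reassoc[OF \<alpha>(4), of "arr_inv D \<alpha>"] \<alpha>(2,3) a(1-4) by simp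
  also have "\<dots> = tle_in D (- q) ?Y"
    using a \<alpha> by simp
  finally have *: "tle_map D (- q) (- p) X \<cdot> arr_inv D \<alpha> = tle_in D (- q) ?Y" .
  have "(tle_map D (- q) (- p) X, tsp_out D X p q, onM (Sh D 1) (arr_inv D \<alpha>) \<cdot> h) \<in> Tri D"
    by (rule TR1_iso_tri[OF t, where a = "arr_inv D \<alpha>" and b = "Ide D ?Y"
          and c = "Ide D (tspO D X p q)"])
      (use t1 a \<alpha>(2,3) assms * in \<open>simp_all add: isomor_Ide isomor_arr_inv_isomor[OF \<alpha>(1)]\<close>)
  then show ?thesis
    by blast
qed

text \<open>TR3, with identities on the first two terms, links the two triangles by an endomorphism
  \<open>c\<close> of \<open>tspO D X p q\<close>. It fixes \<open>tsp_out D X p q\<close>, which is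
  obtained by composing with the middle arrow; hence \<open>c\<close> is the identity and
  \<open>h = h'\<close>.\<close>

lemma tsp_tri_unique:
  assumes t: "(tspM D X q r p r, tspM D X p r p q, h) \<in> Tri D"
      "(tspM D X q r p r, tspM D X p r p q, h') \<in> Tri D"
    and "p \<le> q" "q \<le> r"
  shows "h = h'"
proof -
  note [simp] = assms(3,4) order.trans[OF assms(3,4)]
  note t1 = triD[OF t(1)] and t2 = triD[OF t(2)]
  obtain c where c: "c \<in> Arr D" "Dom D c = Cod D (tspM D X p r p q)"
    "Cod D c = Cod D (tspM D X p r p q)" "c \<cdot> tspM D X p r p q = tspM D X p r p q \<cdot> Ide D (tspO D X p r)"
    "onM (Sh D 1) (Ide D (tspO D X q r)) \<cdot> h = h' \<cdot> c"
    by (rule TR3_ex[OF t, of "Ide D (tspO D X q r)" "Ide D (tspO D X p r)"]) simp_all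
  have c' [simp]: "c \<in> Arr D" "Dom D c = tspO D X p q" "Cod D c = tspO D X p q"
    using c by simp_all
  have "c \<cdot> (tspM D X p r p q \<cdot> tsp_out D X p r) = tspM D X p r p q \<cdot> tsp_out D X p r"
    using comp_reassoc[OF c(4), of "tsp_out D X p r"] by simp
  then have "c \<cdot> tsp_out D X p q = tsp_out D X p q"
    by (simp add: tspM_tsp_out tle_map_Ide)
  then have co: "c \<cdot> tsp_out D X p q = Ide D (tspO D X p q) \<cdot> tsp_out D X p q"
    by simp
  have "c = Ide D (tspO D X p q)"
    by (rule tsp_unique[OF co]) (use tspO_t_ge in simp_all)
  then show ?thesis
    using c(5) t1 t2 by simp
qed

text \<open>This is the octahedral axiom for \<open>\<tau>\<^sub>\<le>\<^sub>-\<^sub>r X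
  \<rightarrow> \<tau>\<^sub>\<le>\<^sub>-\<^sub>q X \<rightarrow>
  \<tau>\<^sub>\<le>\<^sub>-\<^sub>p X\<close>: the cones of the two arrows and of their composite
  are the three objects, and the arrows supplied between them satisfy the equations that
  characterise \<open>tspM\<close>.\<close>

lemma tspD_Tri:
  assumes "p \<le> q" "q \<le> r"
  shows "(tspM D X q r p r, tspM D X p r p q, tspD D X p q r) \<in> Tri D"
proof -
  note [simp] = assms order.trans[OF assms]
  obtain h1 where h1: "(tle_map D (- r) (- q) X, tsp_out D X q r, h1) \<in> Tri D"
    using tsp_out_tri assms by blast
  obtain h2 where h2: "(tle_map D (- q) (- p) X, tsp_out D X p q, h2) \<in> Tri D"
    using tsp_out_tri assms by blast
  obtain h3 where "(tle_map D (- r) (- p) X, tsp_out D X p r, h3) \<in> Tri D"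
    using tsp_out_tri[of p r] by auto
  then have h3: "(tle_map D (- q) (- p) X \<cdot> tle_map D (- r) (- q) X, tsp_out D X p r, h3) \<in> Tri D"
    by (simp add: tle_map_comp)
  obtain a b where a: "a \<in> Hom D (Cod D (tsp_out D X q r)) (Cod D (tsp_out D X p r))"
    and b: "b \<in> Hom D (Cod D (tsp_out D X p r)) (Cod D (tsp_out D X p q))"
    and t: "(a, b, onM (Sh D 1) (tsp_out D X q r) \<cdot> h2) \<in> Tri D"
    and ab: "a \<cdot> tsp_out D X q r = tsp_out D X p r \<cdot> tle_map D (- q) (- p) X"
      "b \<cdot> tsp_out D X p r = tsp_out D X p q"
    using TR4[OF h1 h2 _ h3] by auto
  have "a = tspM D X q r p r"
    using a ab by (intro tspM_eqI) auto
  moreover have "b = tspM D X p r p q"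
    using b ab by (intro tspM_eqI) (auto simp: tle_map_Ide)
  ultimately have t': "(tspM D X q r p r, tspM D X p r p q, onM (Sh D 1) (tsp_out D X q r) \<cdot> h2) \<in> Tri D"
    using t by simp
  show ?thesis
    unfolding tspD_def 
    by (rule theI[of "\<lambda>h. (tspM D X q r p r, tspM D X p r p q, h) \<in> Tri D", OF t']) (rule tsp_tri_unique[OF _ t' assms])
qed

lemma tspD_simps [simp]:
  assumes "p \<le> q" "q \<le> r"
  shows "tspD D X p q r \<in> Arr D" "Dom D (tspD D X p q r) = tspO D X p q"
    "Cod D (tspD D X p q r) = onO (Sh D 1) (tspO D X q r)"
  using triD[OF tspD_Tri[OF assms]] assms by simp_all

lemma tspD_eqI:
  assumes "(tspM D X q r p r, tspM D X p r p q, h) \<in> Tri D" "p \<le> q" "q \<le> r"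
  shows "h = tspD D X p q r"
  by (rule tsp_tri_unique[OF assms(1) tspD_Tri[OF assms(2,3)] assms(2,3)])

text \<open>TR3 completes the structure maps on the first two terms to a map of triangles with some
  third component \<open>c\<close>. Evaluating \<open>c\<close> on \<open>tsp_out D X p q\<close>
  forces it to be the structure map.\<close>

lemma tspD_tspM:
  assumes "p \<le> q" "q \<le> r" "p' \<le> q'" "q' \<le> r'" "p' \<le> p" "q' \<le> q" "r' \<le> r"
  shows "tspD D X p' q' r' \<cdot> tspM D X p q p' q' = onM (Sh D 1) (tspM D X q r q' r') \<cdot> tspD D X p q r"
proof -
  note [simp] = assms order.trans[OF assms(1,2)] order.trans[OF assms(3,4)]
    order.trans[OF assms(5,1)] order.trans[OF assms(6,2)]
  have p'q: "p' \<le> q" "q' \<le> r"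
    using assms by linarith+
  note [simp] = p'q
  have sq: "tspM D X p r p' r' \<cdot> tspM D X q r p r = tspM D X q' r' p' r' \<cdot> tspM D X q r q' r'"
    by (simp add: tspM_comp)
  obtain c where c: "c \<in> Arr D" "Dom D c = Cod D (tspM D X p r p q)"
    "Cod D c = Cod D (tspM D X p' r' p' q')"
    "c \<cdot> tspM D X p r p q = tspM D X p' r' p' q' \<cdot> tspM D X p r p' r'"
    "onM (Sh D 1) (tspM D X q r q' r') \<cdot> tspD D X p q r = tspD D X p' q' r' \<cdot> c"
    by (rule TR3_ex[OF tspD_Tri[OF assms(1,2)] tspD_Tri[OF assms(3,4)], of "tspM D X q r q' r'"
          "tspM D X p r p' r'"]) (simp_all add: sq)
  have c' [simp]: "c \<in> Arr D" "Dom D c = tspO D X p q" "Cod D c = tspO D X p' q'"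
    using c by simp_all
  have "c = tspM D X p q p' q'"
  proof (rule tspM_eqI)
    have "c \<cdot> tsp_out D X p q = c \<cdot> (tspM D X p r p q \<cdot> tsp_out D X p r)"
      by (simp add: tspM_tsp_out tle_map_Ide)
    also have "\<dots> = tspM D X p r p' q' \<cdot> tsp_out D X p r"
      using comp_reassoc[OF c(4), of "tsp_out D X p r"]
        comp_reassoc[OF tspM_comp[of p' p r' r p' q'], of "tsp_out D X p r"] by simp
    also have "\<dots> = tsp_out D X p' q' \<cdot> tle_map D (- p) (- p') X"
      using order.trans[OF assms(4,7)] by (simp add: tspM_tsp_out)
    finally show "c \<cdot> tsp_out D X p q = tsp_out D X p' q' \<cdot> tle_map D (- p) (- p') X" .
  qed simp_all
  then show ?thesis
    using c(5) by simp
qed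

end

end

section \<open>Cohomological functors\<close>

context t_category
begin

text \<open>For \<open>q = p + 1\<close> both truncations are taken at level \<open>- p\<close>, so
  the object is a translate of the cohomology in degree \<open>- p\<close>, and translation by
  \<open>p\<close> undoes translation by \<open>- p\<close>.\<close>

lemma t_coh_zero_iff:
  assumes X: "X \<in> Obj D"
  shows "zero_object D (t_coh D (- p) X) \<longleftrightarrow> zero_object D (tspO D X p (p + 1))"
proof -
  have Z: "tspO D X p (p + 1) \<in> Obj D" and *: "t_coh D (- p) X = onO (Sh D (- p)) (tspO D X p (p + 1))"
    using X by (simp_all add: t_coh_def tspO_def)
  show ?thesis
    unfolding * using Sh.map_zero_object[of "onO (Sh D (- p)) (tspO D X p (p + 1))" p]
      Sh.map_zero_object[of "tspO D X p (p + 1)" "- p"] Z by auto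
qed

lemma t_bounded_iff:
  assumes X: "X \<in> Obj D"
  shows "t_bounded D X \<longleftrightarrow> (\<exists>N. \<forall>p. N \<le> \<bar>p\<bar> \<longrightarrow> zero_object D (tspO D X p (p + 1)))"
proof -
  have "(\<forall>l. N \<le> \<bar>l\<bar> \<longrightarrow> zero_object D (t_coh D l X))
    \<longleftrightarrow> (\<forall>p. N \<le> \<bar>p\<bar> \<longrightarrow> zero_object D (tspO D X p (p + 1)))" for N
  proof
    assume *: "\<forall>l. N \<le> \<bar>l\<bar> \<longrightarrow> zero_object D (t_coh D l X)"
    show "\<forall>p. N \<le> \<bar>p\<bar> \<longrightarrow> zero_object D (tspO D X p (p + 1))"
      using *[THEN spec, of "- p" for p] t_coh_zero_iff[OF X] by auto
  next
    assume *: "\<forall>p. N \<le> \<bar>p\<bar> \<longrightarrow> zero_object D (tspO D X p (p + 1))"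
    show "\<forall>l. N \<le> \<bar>l\<bar> \<longrightarrow> zero_object D (t_coh D l X)"
    proof (intro allI impI)
      fix l
      assume "N \<le> \<bar>l\<bar>"
      then show "zero_object D (t_coh D l X)"
        using *[THEN spec, of "- l"] t_coh_zero_iff[OF X, of "- l"] by simp
    qed
  qed
  then show ?thesis
    by (simp add: t_bounded_def)
qed

lemma isomor_t_le:
  assumes "isomor D f" "Cod D f \<in> t_le D n"
  shows "Dom D f \<in> t_le D n"
proof -
  note f = isomor_arr_inv[OF assms(1)]
  have "isomor D (onM (Sh D n) (arr_inv D f))"
    by (rule Sh.map_isomor[OF isomor_arr_inv_isomor[OF assms(1)]])
  from le0_iso[OF this] show ?thesis
    using assms(2) f by (simp add: t_le_def)
qed

text \<open>Both \<open>k\<close> and its inverse extend to the chosen truncations, and uniqueness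
  of such extensions makes them mutually inverse.\<close>

lemma tau_ge_isomor:
  assumes "isomor D k"
  obtains \<gamma> where "isomor D \<gamma>" "Dom D \<gamma> = tau_ge D n (Dom D k)" "Cod D \<gamma> = tau_ge D n (Cod D k)"
    "\<gamma> \<cdot> tge_out D n (Dom D k) = tge_out D n (Cod D k) \<cdot> k"
proof -
  note k [simp] = isomor_arr_inv[OF assms]
  let ?Y = "Dom D k" and ?Z = "Cod D k"
  have ge: "tau_ge D n ?Y \<in> t_ge D n" "tau_ge D n ?Z \<in> t_ge D n"
    by (simp_all add: tau_ge_t_ge)
  obtain \<gamma> where \<gamma>: "\<gamma> \<in> Arr D" "Dom D \<gamma> = tau_ge D n ?Y"
    "Cod D \<gamma> = Cod D (tge_out D n ?Z \<cdot> k)" "\<gamma> \<cdot> tge_out D n ?Y = tge_out D n ?Z \<cdot> k"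
    by (rule tge_factor[of ?Y "tge_out D n ?Z \<cdot> k" n]) (use ge in simp_all)
  obtain \<delta> where \<delta>: "\<delta> \<in> Arr D" "Dom D \<delta> = tau_ge D n ?Z"
    "Cod D \<delta> = Cod D (tge_out D n ?Y \<cdot> arr_inv D k)"
    "\<delta> \<cdot> tge_out D n ?Z = tge_out D n ?Y \<cdot> arr_inv D k"
    by (rule tge_factor[of ?Z "tge_out D n ?Y \<cdot> arr_inv D k" n]) (use ge in simp_all)
  have \<gamma>' [simp]: "\<gamma> \<in> Arr D" "Dom D \<gamma> = tau_ge D n ?Y" "Cod D \<gamma> = tau_ge D n ?Z"
    using \<gamma> by simp_all
  have \<delta>' [simp]: "\<delta> \<in> Arr D" "Dom D \<delta> = tau_ge D n ?Z" "Cod D \<delta> = tau_ge D n ?Y"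
    using \<delta> by simp_all
  have "(\<delta> \<cdot> \<gamma>) \<cdot> tge_out D n ?Y = Ide D (tau_ge D n ?Y) \<cdot> tge_out D n ?Y"
    using comp_reassoc[OF \<delta>(4), of k] \<gamma>(4) by simp
  then have 1: "\<delta> \<cdot> \<gamma> = Ide D (tau_ge D n ?Y)"
    by (rule tge_unique[rotated]) (use ge in simp_all)
  have "(\<gamma> \<cdot> \<delta>) \<cdot> tge_out D n ?Z = Ide D (tau_ge D n ?Z) \<cdot> tge_out D n ?Z"
    using comp_reassoc[OF \<gamma>(4), of "arr_inv D k"] \<delta>(4) by simp
  then have 2: "\<gamma> \<cdot> \<delta> = Ide D (tau_ge D n ?Z)"
    by (rule tge_unique[rotated]) (use ge in simp_all)
  have "isomor D \<gamma>"
    by (rule isomorI[of _ \<delta>]) (simp_all add: 1 2)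
  then show thesis
    using that[of \<gamma>] \<gamma>(4) by simp
qed

end

section \<open>Spectral objects of graded objects from translation and from cohomological
  functors\<close>

lemma spectral_object_translate:
  assumes "spectral_object B S"
  shows "spectral_object B (translate S l)"
proof -
  note c = assms[unfolded spectral_object_def]
  note c2 = c[THEN conjunct2] note c3 = c2[THEN conjunct2] note c4 = c3[THEN conjunct2]
  note c5 = c4[THEN conjunct2] note c6 = c5[THEN conjunct2] note c7 = c6[THEN conjunct2]
  obtain N where N: "\<And>n p. N \<le> \<bar>p\<bar> \<Longrightarrow> zero_object B (gO S n p (p + 1))"
    using c7 by blast
  \<comment> \<open>Moving the index by \<open>l\<close> enlarges the bound by at most the absolute
    value of \<open>l\<close>.\<close>
  have "zero_object B (gO S n (p + l) (p + 1 + l))" if "N + \<bar>l\<bar> \<le> \<bar>p\<bar>" for n p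
  proof -
    have N': "N \<le> \<bar>p + l\<bar>" and eq: "p + 1 + l = p + l + 1"
      using that by linarith+
    show ?thesis
      unfolding eq by (rule N[OF N'])
  qed
  then show ?thesis
    unfolding spectral_object_def translate_def gspobj.simps
    apply (intro conjI)
    subgoal using c[THEN conjunct1] by simp
    subgoal using c2[THEN conjunct1] by simp
    subgoal using c3[THEN conjunct1] by simp
    subgoal using c4[THEN conjunct1] by simp
    subgoal using c5[THEN conjunct1] by simp
    subgoal using c6[THEN conjunct1] by simp
    subgoal by blast
    done
qed

locale cohomological_functor = D: t_category D + B: abelian_category B
  for D :: "('o, 'm, 'x) tcat_scheme" and B :: "('b, 'c, 'z) acat_scheme" +
  fixes T :: "('o, 'm, 'b, 'c) functr"
  assumes cohomological: "cohomological D B T"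
begin

sublocale T: additive_functor_between D B T
  using cohomological by unfold_locales (simp add: cohomological_def)

lemma TO_Obj [simp]: "x \<in> Obj D \<Longrightarrow> TO D T n x \<in> Obj B"
  by (simp add: TO_def)

lemma TM_simps [simp]:
  assumes "f \<in> Arr D"
  shows "TM D T n f \<in> Arr B" "Dom B (TM D T n f) = TO D T n (Dom D f)"
    "Cod B (TM D T n f) = TO D T n (Cod D f)"
  using assms by (simp_all add: TM_def TO_def)

lemma TM_Ide: "x \<in> Obj D \<Longrightarrow> TM D T n (Ide D x) = Ide B (TO D T n x)"
  by (simp add: TM_def TO_def)

lemma TM_comp:
  assumes "g \<cdot>\<^bsub>D\<^esub> f = k" "f \<in> Arr D" "g \<in> Arr D" "Dom D g = Cod D f"
  shows "TM D T n g \<cdot>\<^bsub>B\<^esub> TM D T n f = TM D T n k"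
  using assms(2-4) by (simp add: TM_def flip: assms(1))

lemma TO_shift: "x \<in> Obj D \<Longrightarrow> TO D T n (onO (Sh D 1) x) = TO D T (n + 1) x"
  by (simp add: TO_def)

lemma TM_shift: "f \<in> Arr D \<Longrightarrow> TM D T n (onM (Sh D 1) f) = TM D T (n + 1) f"
  by (simp add: TM_def)

text \<open>The three pairs come from the triangle translated by \<open>n\<close> and its first two
  rotations. Each sign introduced by translating or rotating is removed by
  \<open>exact_at_hneg\<close>.\<close>

lemma tri_exact:
  assumes t: "(f, g, h) \<in> Tri D"
  shows "exact_at B (TM D T n f) (TM D T n g)" "exact_at B (TM D T n g) (TM D T n h)"
    "exact_at B (TM D T n h) (TM D T (n + 1) f)"
proof -
  note t1 = D.triD[OF t]
  have ex: "exact_at B (onM T f) (onM T g)" if "(f, g, h) \<in> Tri D" for f g h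
    using cohomological that unfolding cohomological_def by blast
  obtain h' where h': "(onM (Sh D n) f, onM (Sh D n) g, h') \<in> Tri D"
    "h' = onM (Sh D n) h \<or> h' = hneg D (onM (Sh D n) h)"
    using D.tri_shift[OF t] by blast
  show "exact_at B (TM D T n f) (TM D T n g)"
    using ex[OF h'(1)] by (simp add: TM_def)
  have *: "onM T h' = TM D T n h \<or> onM T h' = hneg B (TM D T n h)"
    using h'(2) t1 by (auto simp: TM_def)
  have "exact_at B (TM D T n g) (onM T h')"
    using ex[OF D.tri_rotate[OF h'(1)]] by (simp add: TM_def)
  then show "exact_at B (TM D T n g) (TM D T n h)"
    using * B.exact_at_hneg(1)[of "TM D T n g" "hneg B (TM D T n h)"] t1 by auto
  have "exact_at B (onM T h') (hneg B (TM D T (n + 1) f))"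
    using ex[OF D.tri_rotate[OF D.tri_rotate[OF h'(1)]]] t1 by (simp add: TM_def add.commute)
  then have "exact_at B (onM T h') (TM D T (n + 1) f)"
    using B.exact_at_hneg(1)[of "onM T h'" "hneg B (TM D T (n + 1) f)"] t1 by simp
  then show "exact_at B (TM D T n h) (TM D T (n + 1) f)"
    using * B.exact_at_hneg(2)[of "hneg B (TM D T n h)" "TM D T (n + 1) f"] t1 by auto
qed

lemma spectral_object_apply_coh:
  assumes X [simp]: "X \<in> Obj D" and "t_bounded D X"
  shows "spectral_object B (apply_coh D T (t_spobj D X))"
proof -
  obtain N where N: "\<And>p. N \<le> \<bar>p\<bar> \<Longrightarrow> zero_object D (tspO D X p (p + 1))"
    using assms D.t_bounded_iff[OF X] by blast
  show ?thesis
    unfolding spectral_object_def apply_coh_def t_spobj_def gspobj.simps spobj.simps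
  proof (intro conjI allI impI)
    fix n p q :: int
    show "TO D T n (tspO D X p q) \<in> Obj B"
      "TM D T n (tspM D X p q p q) = Ide B (TO D T n (tspO D X p q))"
      by (simp_all add: D.tspM_Ide TM_Ide)
  next
    fix n p q p' q' :: int
    assume "p \<le> q \<and> p' \<le> q' \<and> p' \<le> p \<and> q' \<le> q"
    then show "TM D T n (tspM D X p q p' q') \<in> Hom B (TO D T n (tspO D X p q)) (TO D T n (tspO D X p' q'))"
      by simp
  next
    fix n p q p' q' p'' q'' :: int
    assume "p \<le> q \<and> p' \<le> q' \<and> p'' \<le> q'' \<and> p' \<le> p \<and> q' \<le> q \<and> p'' \<le> p' \<and> q'' \<le> q'"
    then show "TM D T n (tspM D X p' q' p'' q'') \<cdot>\<^bsub>B\<^esub> TM D T n (tspM D X p q p' q')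
        = TM D T n (tspM D X p q p'' q'')"
      by (intro TM_comp) (simp_all add: D.tspM_comp)
  next
    fix n p q r :: int
    assume "p \<le> q \<and> q \<le> r"
    then show "TM D T n (tspD D X p q r) \<in> Hom B (TO D T n (tspO D X p q)) (TO D T (n + 1) (tspO D X q r))"
      by (simp add: TO_shift)
  next
    fix n p q r p' q' r' :: int
    assume *: "p \<le> q \<and> q \<le> r \<and> p' \<le> q' \<and> q' \<le> r' \<and> p' \<le> p \<and> q' \<le> q \<and> r' \<le> r"
    have "TM D T n (tspD D X p' q' r') \<cdot>\<^bsub>B\<^esub> TM D T n (tspM D X p q p' q')
        = TM D T n (onM (Sh D 1) (tspM D X q r q' r') \<cdot>\<^bsub>D\<^esub> tspD D X p q r)"
      by (rule TM_comp) (use * in \<open>simp_all add: D.tspD_tspM\<close>)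
    also have "\<dots> = TM D T n (onM (Sh D 1) (tspM D X q r q' r')) \<cdot>\<^bsub>B\<^esub> TM D T n (tspD D X p q r)"
      by (rule TM_comp[symmetric]) (use * in simp_all)
    finally show "TM D T n (tspD D X p' q' r') \<cdot>\<^bsub>B\<^esub> TM D T n (tspM D X p q p' q')
        = TM D T (n + 1) (tspM D X q r q' r') \<cdot>\<^bsub>B\<^esub> TM D T n (tspD D X p q r)"
      using * by (simp add: TM_shift)
  next
    fix n p q r :: int
    assume "p \<le> q \<and> q \<le> r"
    note ex = tri_exact[OF D.tspD_Tri[OF X conjunct1[OF this] conjunct2[OF this]]]
    show "exact_at B (TM D T n (tspM D X q r p r)) (TM D T n (tspM D X p r p q))"
      "exact_at B (TM D T n (tspM D X p r p q)) (TM D T n (tspD D X p q r))"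
      "exact_at B (TM D T n (tspD D X p q r)) (TM D T (n + 1) (tspM D X q r p r))"
      by (rule ex)+
  next
    show "\<exists>N. \<forall>n p. N \<le> \<bar>p\<bar> \<longrightarrow> zero_object B (TO D T n (tspO D X p (p + 1)))"
      using N T.map_zero_object D.Sh.map_zero_object unfolding TO_def by blast
  qed
qed

end

section \<open>Functors that are t-exact up to translation\<close>

locale shifted_t_exact_functor = D: t_category D + D': t_category D'
  for D :: "('o, 'm, 'x) tcat_scheme" and D' :: "('p, 'n, 'y) tcat_scheme" +
  fixes u :: "('o, 'm, 'p, 'n) functr" and \<phi> :: "int \<Rightarrow> 'o \<Rightarrow> 'n" and d :: int
  assumes triangulated: "triangulated_functor D D' u \<phi>"
    and shifted_t_exact: "shifted_t_exact D D' u d"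
begin

sublocale u: additive_functor_between D D' u
  using triangulated by unfold_locales (simp add: triangulated_functor_def)

lemma \<phi>_natural_iso: "natural_iso D D' (u \<circ>\<^sub>F Sh D n) (Sh D' n \<circ>\<^sub>F u) (\<phi> n)"
  using triangulated by (simp add: triangulated_functor_def)

lemma \<phi>_simps [simp]:
  assumes "x \<in> Obj D"
  shows "\<phi> n x \<in> Arr D'" "Dom D' (\<phi> n x) = onO u (onO (Sh D n) x)"
    "Cod D' (\<phi> n x) = onO (Sh D' n) (onO u x)" "isomor D' (\<phi> n x)"
  using \<phi>_natural_iso[of n] assms by (auto simp: natural_iso_def natural_def comp_functr_def)

lemma \<phi>_natural:
  assumes "f \<in> Arr D"
  shows "\<phi> n (Cod D f) \<cdot>\<^bsub>D'\<^esub> onM u (onM (Sh D n) f) = onM (Sh D' n) (onM u f) \<cdot>\<^bsub>D'\<^esub> \<phi> n (Dom D f)"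
proof -
  have "f \<in> Hom D (Dom D f) (Cod D f)" "Dom D f \<in> Obj D" "Cod D f \<in> Obj D"
    using assms by simp_all
  then have "\<phi> n (Cod D f) \<cdot>\<^bsub>D'\<^esub> onM (u \<circ>\<^sub>F Sh D n) f = onM (Sh D' n \<circ>\<^sub>F u) f \<cdot>\<^bsub>D'\<^esub> \<phi> n (Dom D f)"
    using \<phi>_natural_iso[of n] unfolding natural_iso_def natural_def by blast
  then show ?thesis
    by (simp add: comp_functr_def)
qed

lemma \<phi>_add:
  assumes "x \<in> Obj D"
  shows "\<phi> (m + n) x = onM (Sh D' m) (\<phi> n x) \<cdot>\<^bsub>D'\<^esub> \<phi> m (onO (Sh D n) x)"
  using triangulated assms unfolding triangulated_functor_def by blast

lemma u_Tri: "(f, g, h) \<in> Tri D \<Longrightarrow> (onM u f, onM u g, \<phi> 1 (Dom D f) \<cdot>\<^bsub>D'\<^esub> onM u h) \<in> Tri D'"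
  using triangulated unfolding triangulated_functor_def by blast

lemma u_tge:
  assumes "Y \<in> Obj D"
  obtains \<beta> where "isomor D' \<beta>" "Dom D' \<beta> = onO u (tau_ge D a Y)"
    "Cod D' \<beta> = tau_ge D' (a + d) (onO u Y)"
    "\<beta> \<cdot>\<^bsub>D'\<^esub> onM u (tge_out D a Y) = tge_out D' (a + d) (onO u Y)"
proof -
  have "\<exists>\<beta>\<in>Hom D' (onO u (tau_ge D a Y)) (tau_ge D' (a + d) (onO u Y)). isomor D' \<beta> \<and>
      \<beta> \<cdot>\<^bsub>D'\<^esub> onM u (tge_out D a Y) = tge_out D' (a + d) (onO u Y)"
    using shifted_t_exact assms unfolding shifted_t_exact_def by blast
  then show thesis
    using that by auto
qed

section \<open>The image under \<open>u\<close> of the spectral object of \<open>X\<close>\<close>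

context
  fixes X
  assumes X [simp]: "X \<in> Obj D"
begin

abbreviation "\<kappa> \<equiv> tle_comparison D D' u d X"
abbreviation "\<gamma> \<equiv> tsp_comparison D D' u d X"

text \<open>Existence is t-exactness. Uniqueness needs the source in \<open>t_le D' (a + d)\<close>,
  where it lies because it is isomorphic to a truncation.\<close>

lemma tle_comparison_props:
  shows tle_comparison_simps [simp]: "\<kappa> a \<in> Arr D'" "Dom D' (\<kappa> a) = onO u (tau_le D a X)"
    "Cod D' (\<kappa> a) = tau_le D' (a + d) (onO u X)"
    and tle_comparison_isomor: "isomor D' (\<kappa> a)"
    and tle_in_tle_comparison: "tle_in D' (a + d) (onO u X) \<cdot>\<^bsub>D'\<^esub> \<kappa> a = onM u (tle_in D a X)"
    and u_tau_le: "onO u (tau_le D a X) \<in> t_le D' (a + d)"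
proof -
  obtain \<alpha> where \<alpha>: "isomor D' \<alpha>" "\<alpha> \<in> Arr D'" "Dom D' \<alpha> = onO u (tau_le D a X)"
    "Cod D' \<alpha> = tau_le D' (a + d) (onO u X)"
    "tle_in D' (a + d) (onO u X) \<cdot>\<^bsub>D'\<^esub> \<alpha> = onM u (tle_in D a X)"
    using shifted_t_exact X unfolding shifted_t_exact_def by (metis mem_Hom)
  show le: "onO u (tau_le D a X) \<in> t_le D' (a + d)"
    using D'.isomor_t_le[OF \<alpha>(1)] \<alpha> D'.tau_le_t_le[of "onO u X" "a + d"] by simp
  have "\<kappa> a = \<alpha>"
    unfolding tle_comparison_def
  proof (rule the_equality)
    fix \<alpha>'
    assume \<alpha>': "\<alpha>' \<in> Hom D' (onO u (tau_le D a X)) (tau_le D' (a + d) (onO u X)) \<and>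
      tle_in D' (a + d) (onO u X) \<cdot>\<^bsub>D'\<^esub> \<alpha>' = onM u (tle_in D a X)"
    show "\<alpha>' = \<alpha>"
      by (rule D'.tle_unique[of "onO u X" "a + d"]) (use \<alpha> \<alpha>' le in simp_all)
  qed (use \<alpha> in simp)
  then show "\<kappa> a \<in> Arr D'" "Dom D' (\<kappa> a) = onO u (tau_le D a X)"
    "Cod D' (\<kappa> a) = tau_le D' (a + d) (onO u X)" "isomor D' (\<kappa> a)"
    "tle_in D' (a + d) (onO u X) \<cdot>\<^bsub>D'\<^esub> \<kappa> a = onM u (tle_in D a X)"
    using \<alpha> by simp_all
qed

lemma tle_comparison_natural:
  assumes "m \<le> n"
  shows "\<kappa> n \<cdot>\<^bsub>D'\<^esub> onM u (tle_map D m n X) = tle_map D' (m + d) (n + d) (onO u X) \<cdot>\<^bsub>D'\<^esub> \<kappa> m"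
proof (rule D'.tle_unique[of "onO u X" "n + d"])
  have "tle_in D' (n + d) (onO u X) \<cdot>\<^bsub>D'\<^esub> (\<kappa> n \<cdot>\<^bsub>D'\<^esub> onM u (tle_map D m n X))
      = onM u (tle_in D n X) \<cdot>\<^bsub>D'\<^esub> onM u (tle_map D m n X)"
    using D'.comp_reassoc[OF tle_in_tle_comparison[of n], of "onM u (tle_map D m n X)"] assms by simp
  also have "\<dots> = onM u (tle_in D m X)"
    by (rule u.map_comp_eq) (use assms in \<open>simp_all add: D.tle_in_tle_map\<close>)
  also have "\<dots> = tle_in D' (n + d) (onO u X) \<cdot>\<^bsub>D'\<^esub> (tle_map D' (m + d) (n + d) (onO u X) \<cdot>\<^bsub>D'\<^esub> \<kappa> m)"
  proof -
    have "m + d \<le> n + d"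
      using assms by simp
    from D'.comp_reassoc[OF D'.tle_in_tle_map[OF _ this, of "onO u X"], of "\<kappa> m"] this
    show ?thesis
      by (simp add: tle_in_tle_comparison)
  qed
  finally show "tle_in D' (n + d) (onO u X) \<cdot>\<^bsub>D'\<^esub> (\<kappa> n \<cdot>\<^bsub>D'\<^esub> onM u (tle_map D m n X))
    = tle_in D' (n + d) (onO u X) \<cdot>\<^bsub>D'\<^esub> (tle_map D' (m + d) (n + d) (onO u X) \<cdot>\<^bsub>D'\<^esub> \<kappa> m)" .
  show "Dom D' (\<kappa> n \<cdot>\<^bsub>D'\<^esub> onM u (tle_map D m n X)) \<in> t_le D' (n + d)"
    using u_tau_le[of m] D'.t_le_subset[of "m + d" "n + d"] assms by auto
qed (use assms in simp_all)

text \<open>By t-exactness \<open>u\<close> carries \<open>tsp_out D X p q\<close> to a truncation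
  map of \<open>onO u (tau_le D (- p) X)\<close>, up to the isomorphism \<beta>; so the uniqueness
  clause of \<open>tge_unique\<close> is available for it.\<close>

lemma u_tsp_unique:
  assumes eq: "f \<cdot>\<^bsub>D'\<^esub> onM u (tsp_out D X p q) = g \<cdot>\<^bsub>D'\<^esub> onM u (tsp_out D X p q)"
    and f: "f \<in> Arr D'" "Dom D' f = onO u (tspO D X p q)" "Cod D' f \<in> t_ge D' (- (q - d) + 1)"
    and g: "g \<in> Arr D'" "Dom D' g = onO u (tspO D X p q)" "Cod D' g = Cod D' f"
  shows "f = g"
proof -
  let ?Y = "tau_le D (- p) X"
  obtain \<beta> where \<beta>: "isomor D' \<beta>" "Dom D' \<beta> = onO u (tau_ge D (- q + 1) ?Y)"
    "Cod D' \<beta> = tau_ge D' (- q + 1 + d) (onO u ?Y)"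
    "\<beta> \<cdot>\<^bsub>D'\<^esub> onM u (tge_out D (- q + 1) ?Y) = tge_out D' (- q + 1 + d) (onO u ?Y)"
    by (rule u_tge[of ?Y "- q + 1"]) simp
  note b = isomor_arr_inv[OF \<beta>(1)]
  have u: "onM u (tsp_out D X p q) \<in> Arr D'" "Dom D' (onM u (tsp_out D X p q)) = onO u ?Y"
    "Cod D' (onM u (tsp_out D X p q)) = onO u (tspO D X p q)"
    by simp_all
  have \<beta>': "Dom D' \<beta> = onO u (tspO D X p q)"
    "\<beta> \<cdot>\<^bsub>D'\<^esub> onM u (tsp_out D X p q) = tge_out D' (- q + 1 + d) (onO u ?Y)"
    using \<beta> by (simp_all only: tspO_def tsp_out_def)
  have fac: "(h \<cdot>\<^bsub>D'\<^esub> arr_inv D' \<beta>) \<cdot>\<^bsub>D'\<^esub> tge_out D' (- q + 1 + d) (onO u ?Y) = h \<cdot>\<^bsub>D'\<^esub> onM u (tsp_out D X p q)"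
    if h: "h \<in> Arr D'" "Dom D' h = onO u (tspO D X p q)" for h
  proof -
    have "arr_inv D' \<beta> \<cdot>\<^bsub>D'\<^esub> (\<beta> \<cdot>\<^bsub>D'\<^esub> onM u (tsp_out D X p q)) = onM u (tsp_out D X p q)"
      using D'.comp_reassoc[OF b(5), of "onM u (tsp_out D X p q)"] b(1-4) \<beta>' by simp
    then show ?thesis
      unfolding \<beta>'(2)[symmetric] using b(1-4) \<beta>'(1) h by simp
  qed
  have "f \<cdot>\<^bsub>D'\<^esub> arr_inv D' \<beta> = g \<cdot>\<^bsub>D'\<^esub> arr_inv D' \<beta>"
  proof (rule D'.tge_unique[of "onO u ?Y" _ "- q + 1 + d"])
    show "(f \<cdot>\<^bsub>D'\<^esub> arr_inv D' \<beta>) \<cdot>\<^bsub>D'\<^esub> tge_out D' (- q + 1 + d) (onO u ?Y)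
        = (g \<cdot>\<^bsub>D'\<^esub> arr_inv D' \<beta>) \<cdot>\<^bsub>D'\<^esub> tge_out D' (- q + 1 + d) (onO u ?Y)"
      using fac[OF f(1,2)] fac[OF g(1,2)] eq by simp
    have "- (q - d) + 1 = - q + 1 + d"
      by simp
    then show "Cod D' (f \<cdot>\<^bsub>D'\<^esub> arr_inv D' \<beta>) \<in> t_ge D' (- q + 1 + d)"
      using f b(1-4) \<beta>'(1) by (simp only: D'.comp_simps)
  qed (use f g b(1-4) \<beta>(3) \<beta>'(1) in simp_all)
  then show ?thesis
    by (rule D'.epicD[OF D'.isomor_epic[OF D'.isomor_arr_inv_isomor[OF \<beta>(1)]]])
      (use f g b(1-4) \<beta>'(1) in simp_all)
qed

text \<open>The isomorphism has two factors: \<beta> moves \<open>u\<close> inside the truncation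
  from below, and \<open>c\<close> is that truncation applied to the isomorphism of truncations from
  above.\<close>

lemma tsp_comparison_props:
  shows tsp_comparison_simps [simp]: "\<gamma> p q \<in> Arr D'" "Dom D' (\<gamma> p q) = onO u (tspO D X p q)"
    "Cod D' (\<gamma> p q) = tspO D' (onO u X) (p - d) (q - d)"
    and tsp_comparison_isomor: "isomor D' (\<gamma> p q)"
    and tsp_comparison_tsp_out: "\<gamma> p q \<cdot>\<^bsub>D'\<^esub> onM u (tsp_out D X p q)
      = tsp_out D' (onO u X) (p - d) (q - d) \<cdot>\<^bsub>D'\<^esub> \<kappa> (- p)"
proof -
  let ?Y = "tau_le D (- p) X" and ?Z = "tau_le D' (- (p - d)) (onO u X)"
  let ?a = "- (q - d) + 1"
  \<comment> \<open>This is where the translation by \<open>- d\<close> arises: raising both levels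
    by \<open>d\<close> lowers both indices by \<open>d\<close>.\<close>
  have idx: "- p + d = - (p - d)" "- q + 1 + d = ?a"
    by simp_all
  have \<kappa>: "Dom D' (\<kappa> (- p)) = onO u ?Y" "Cod D' (\<kappa> (- p)) = ?Z"
    by (simp_all only: tle_comparison_simps idx)
  obtain \<beta> where \<beta>: "isomor D' \<beta>" "Dom D' \<beta> = onO u (tspO D X p q)"
    "Cod D' \<beta> = tau_ge D' ?a (onO u ?Y)"
    "\<beta> \<cdot>\<^bsub>D'\<^esub> onM u (tsp_out D X p q) = tge_out D' ?a (onO u ?Y)"
    using u_tge[of ?Y "- q + 1"] X unfolding idx tspO_def tsp_out_def by (metis D.trunc_simps(6))
  note b = isomor_arr_inv(1)[OF \<beta>(1)]
  obtain c where c: "isomor D' c" "Dom D' c = tau_ge D' ?a (onO u ?Y)"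
    "Cod D' c = tspO D' (onO u X) (p - d) (q - d)"
    "c \<cdot>\<^bsub>D'\<^esub> tge_out D' ?a (onO u ?Y) = tsp_out D' (onO u X) (p - d) (q - d) \<cdot>\<^bsub>D'\<^esub> \<kappa> (- p)"
    using D'.tau_ge_isomor[OF tle_comparison_isomor[of "- p"], of ?a] unfolding \<kappa>
    unfolding tspO_def tsp_out_def by metis
  note c' = isomor_arr_inv(1)[OF c(1)]
  let ?g = "c \<cdot>\<^bsub>D'\<^esub> \<beta>"
  have g: "?g \<in> Arr D'" "Dom D' ?g = onO u (tspO D X p q)"
    "Cod D' ?g = tspO D' (onO u X) (p - d) (q - d)" "isomor D' ?g"
    using b c' \<beta>(2,3) c(2,3) by (simp_all add: D'.isomor_comp[OF \<beta>(1) c(1)])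
  have g_out: "?g \<cdot>\<^bsub>D'\<^esub> onM u (tsp_out D X p q) = tsp_out D' (onO u X) (p - d) (q - d) \<cdot>\<^bsub>D'\<^esub> \<kappa> (- p)"
    using b c' \<beta>(2-4) c(2,4) by simp
  have "\<gamma> p q = ?g"
    unfolding tsp_comparison_def
  proof (rule the_equality)
    fix g'
    assume g': "g' \<in> Hom D' (onO u (tspO D X p q)) (tspO D' (onO u X) (p - d) (q - d)) \<and>
      g' \<cdot>\<^bsub>D'\<^esub> onM u (tsp_out D X p q) = tsp_out D' (onO u X) (p - d) (q - d) \<cdot>\<^bsub>D'\<^esub> \<kappa> (- p)"
    then have "g' \<cdot>\<^bsub>D'\<^esub> onM u (tsp_out D X p q) = ?g \<cdot>\<^bsub>D'\<^esub> onM u (tsp_out D X p q)"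
      using g_out by simp
    then show "g' = ?g"
      by (rule u_tsp_unique) (use g g' D'.tspO_t_ge[of "onO u X" "q - d" "q - d" "p - d"] in auto)
  qed (use g g_out in simp)
  then show "\<gamma> p q \<in> Arr D'" "Dom D' (\<gamma> p q) = onO u (tspO D X p q)"
    "Cod D' (\<gamma> p q) = tspO D' (onO u X) (p - d) (q - d)" "isomor D' (\<gamma> p q)"
    "\<gamma> p q \<cdot>\<^bsub>D'\<^esub> onM u (tsp_out D X p q) = tsp_out D' (onO u X) (p - d) (q - d) \<cdot>\<^bsub>D'\<^esub> \<kappa> (- p)"
    using g g_out by simp_all
qed

lemma tsp_comparison_natural:
  assumes "p' \<le> p" "q' \<le> q"
  shows "\<gamma> p' q' \<cdot>\<^bsub>D'\<^esub> onM u (tspM D X p q p' q')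
    = tspM D' (onO u X) (p - d) (q - d) (p' - d) (q' - d) \<cdot>\<^bsub>D'\<^esub> \<gamma> p q"
proof (rule u_tsp_unique)
  note [simp] = assms
  let ?o = "\<lambda>p q. tsp_out D' (onO u X) (p - d) (q - d)"
  let ?l = "tle_map D (- p) (- p') X" and ?l' = "tle_map D' (- (p - d)) (- (p' - d)) (onO u X)"
  let ?M = "tspM D' (onO u X) (p - d) (q - d) (p' - d) (q' - d)"
  have idx: "- p + d = - (p - d)" "- p' + d = - (p' - d)"
    by simp_all
  have \<kappa>: "Dom D' (\<kappa> (- p)) = onO u (tau_le D (- p) X)"
    "Cod D' (\<kappa> (- p)) = tau_le D' (- (p - d)) (onO u X)"
    "Cod D' (\<kappa> (- p')) = tau_le D' (- (p' - d)) (onO u X)"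
    by (simp_all only: tle_comparison_simps idx)
  have nat: "\<kappa> (- p') \<cdot>\<^bsub>D'\<^esub> onM u ?l = ?l' \<cdot>\<^bsub>D'\<^esub> \<kappa> (- p)"
    using tle_comparison_natural[of "- p" "- p'"] unfolding idx by simp
  have "onM u (tspM D X p q p' q') \<cdot>\<^bsub>D'\<^esub> onM u (tsp_out D X p q) = onM u (tsp_out D X p' q' \<cdot>\<^bsub>D\<^esub> ?l)"
    by (rule u.map_comp_eq) (simp_all add: D.tspM_tsp_out)
  then have "(\<gamma> p' q' \<cdot>\<^bsub>D'\<^esub> onM u (tspM D X p q p' q')) \<cdot>\<^bsub>D'\<^esub> onM u (tsp_out D X p q)
      = \<gamma> p' q' \<cdot>\<^bsub>D'\<^esub> (onM u (tsp_out D X p' q') \<cdot>\<^bsub>D'\<^esub> onM u ?l)"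
    by simp
  also have "\<dots> = ?o p' q' \<cdot>\<^bsub>D'\<^esub> (\<kappa> (- p') \<cdot>\<^bsub>D'\<^esub> onM u ?l)"
    using D'.comp_reassoc[OF tsp_comparison_tsp_out[of p' q'], of "onM u ?l"] by simp
  also have "\<dots> = ?o p' q' \<cdot>\<^bsub>D'\<^esub> (?l' \<cdot>\<^bsub>D'\<^esub> \<kappa> (- p))"
    by (simp only: nat)
  also have "\<dots> = ?M \<cdot>\<^bsub>D'\<^esub> (?o p q \<cdot>\<^bsub>D'\<^esub> \<kappa> (- p))"
  proof -
    have le: "p' - d \<le> p - d" "q' - d \<le> q - d"
      by simp_all
    show ?thesis
      using D'.comp_reassoc[OF D'.tspM_tsp_out[OF _ le, of "onO u X"], of "\<kappa> (- p)"] le by simp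
  qed
  also have "\<dots> = (?M \<cdot>\<^bsub>D'\<^esub> \<gamma> p q) \<cdot>\<^bsub>D'\<^esub> onM u (tsp_out D X p q)"
    by (simp add: tsp_comparison_tsp_out)
  finally show "(\<gamma> p' q' \<cdot>\<^bsub>D'\<^esub> onM u (tspM D X p q p' q')) \<cdot>\<^bsub>D'\<^esub> onM u (tsp_out D X p q)
      = (?M \<cdot>\<^bsub>D'\<^esub> \<gamma> p q) \<cdot>\<^bsub>D'\<^esub> onM u (tsp_out D X p q)" .
  have "tspO D' (onO u X) (p' - d) (q' - d) \<in> t_ge D' (- (q - d) + 1)"
    by (rule D'.tspO_t_ge) simp_all
  then show "Cod D' (\<gamma> p' q' \<cdot>\<^bsub>D'\<^esub> onM u (tspM D X p q p' q')) \<in> t_ge D' (- (q - d) + 1)"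
    by simp
qed (use assms in simp_all)

text \<open>The comparison isomorphisms transport the image triangle under \<open>u\<close> to a
  distinguished triangle on the structure maps of the spectral object of \<open>onO u X\<close>, and
  only the coboundary can be its third arrow. The factor \<open>\<phi> 1\<close> occurs because
  \<open>u\<close> of a translate is merely isomorphic to the translate of \<open>u\<close>.\<close>

lemma tsp_comparison_coboundary:
  assumes "p \<le> q" "q \<le> r"
  shows "onM (Sh D' 1) (\<gamma> q r) \<cdot>\<^bsub>D'\<^esub> (\<phi> 1 (tspO D X q r) \<cdot>\<^bsub>D'\<^esub> onM u (tspD D X p q r))
    = tspD D' (onO u X) (p - d) (q - d) (r - d) \<cdot>\<^bsub>D'\<^esub> \<gamma> p q"
proof -
  note [simp] = assms order.trans[OF assms]
  note c = isomor_arr_inv[OF tsp_comparison_isomor[of p q]]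
  have t: "(onM u (tspM D X q r p r), onM u (tspM D X p r p q),
      \<phi> 1 (tspO D X q r) \<cdot>\<^bsub>D'\<^esub> onM u (tspD D X p q r)) \<in> Tri D'"
    using u_Tri[OF D.tspD_Tri[OF X assms]] by simp
  let ?h = "\<phi> 1 (tspO D X q r) \<cdot>\<^bsub>D'\<^esub> onM u (tspD D X p q r)"
  let ?k = "(onM (Sh D' 1) (\<gamma> q r) \<cdot>\<^bsub>D'\<^esub> ?h) \<cdot>\<^bsub>D'\<^esub> arr_inv D' (\<gamma> p q)"
  have "(tspM D' (onO u X) (q - d) (r - d) (p - d) (r - d),
      tspM D' (onO u X) (p - d) (r - d) (p - d) (q - d), ?k) \<in> Tri D'"
    by (rule D'.TR1_iso_tri[OF t, where a = "\<gamma> q r" and b = "\<gamma> p r" and c = "\<gamma> p q"])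
      (use c in \<open>simp_all add: tsp_comparison_isomor tsp_comparison_natural\<close>)
  then have "?k = tspD D' (onO u X) (p - d) (q - d) (r - d)"
    by (rule D'.tspD_eqI[rotated]) simp_all
  then have "tspD D' (onO u X) (p - d) (q - d) (r - d) \<cdot>\<^bsub>D'\<^esub> \<gamma> p q = ?k \<cdot>\<^bsub>D'\<^esub> \<gamma> p q"
    by simp
  also have "\<dots> = onM (Sh D' 1) (\<gamma> q r) \<cdot>\<^bsub>D'\<^esub> ?h"
    using c by simp
  finally show ?thesis
    by simp
qed

lemma u_t_bounded:
  assumes "t_bounded D X"
  shows "t_bounded D' (onO u X)"
proof -
  obtain N where N: "\<And>p. N \<le> \<bar>p\<bar> \<Longrightarrow> zero_object D (tspO D X p (p + 1))"
    using assms D.t_bounded_iff[OF X] by blast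
  \<comment> \<open>The object of \<open>onO u X\<close> at \<open>p\<close> is the image of the one
    of \<open>X\<close> at \<open>p + d\<close>, which accounts for the enlarged bound.\<close>
  have "zero_object D' (tspO D' (onO u X) p (p + 1))" if "N + \<bar>d\<bar> \<le> \<bar>p\<bar>" for p
  proof -
    have "N \<le> \<bar>p + d\<bar>"
      using that by linarith
    then have "zero_object D' (onO u (tspO D X (p + d) (p + d + 1)))"
      using N u.map_zero_object by blast
    then have "zero_object D' (Cod D' (\<gamma> (p + d) (p + d + 1)))"
      using D'.zero_object_isomor[OF tsp_comparison_isomor[of "p + d" "p + d + 1"]] by simp
    then show ?thesis
      by (simp add: algebra_simps)
  qed
  then show ?thesis
    using D'.t_bounded_iff[of "onO u X"] by auto
qed

end

end

section \<open>Comparison of the spectral objects of \<open>T(X)\<close> and \<open>T'(u X)\<close>\<close>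

lemma natural_square:
  assumes "natural C D F G \<alpha>" "f \<in> Hom C x y" "x \<in> Obj C" "y \<in> Obj C"
  shows "\<alpha> y \<cdot>\<^bsub>D\<^esub> onM F f = onM G f \<cdot>\<^bsub>D\<^esub> \<alpha> x"
  using assms unfolding natural_def by blast

lemma (in category) arr_inv_eqI:
  assumes "isomor C f" "g \<in> Arr C" "Dom C g = Cod C f" "Cod C g = Dom C f"
    "f \<cdot> g = Ide C (Cod C f)"
  shows "arr_inv C f = g"
  using comp_reassoc[OF isomor_arr_inv(5)[OF assms(1)], of g] isomor_arr_inv(1-4)[OF assms(1)] assms
  by simp

lemma (in category) isomor_square:
  assumes "isomor C a" "isomor C b" "a \<cdot> x = y \<cdot> b"
    "x \<in> Arr C" "y \<in> Arr C" "Cod C x = Dom C a" "Dom C y = Cod C b" "Dom C x = Dom C b"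
    "Cod C y = Cod C a"
  shows "arr_inv C a \<cdot> y = x \<cdot> arr_inv C b"
proof -
  note a = isomor_arr_inv[OF assms(1)] and b = isomor_arr_inv[OF assms(2)]
  have "arr_inv C a \<cdot> y = arr_inv C a \<cdot> ((y \<cdot> b) \<cdot> arr_inv C b)"
    using a(1-4) b assms(4-9) by simp
  also have "\<dots> = (arr_inv C a \<cdot> (a \<cdot> x)) \<cdot> arr_inv C b"
    unfolding assms(3)[symmetric] using a(1-4) b(1-4) assms(4-9) by simp
  also have "arr_inv C a \<cdot> (a \<cdot> x) = x"
    using comp_reassoc[OF a(5), of x] a(1-4) assms(4-9) by simp
  finally show ?thesis .
qed

section \<open>Comparison maps built from an abstract natural transformation\<close>

locale cohomological_comparison =
  U: shifted_t_exact_functor D D' u \<phi> d + T: cohomological_functor D B T +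
  T': cohomological_functor D' B T'
  for D :: "('o, 'm, 'x) tcat_scheme" and D' :: "('p, 'n, 'y) tcat_scheme"
    and B :: "('b, 'c, 'z) acat_scheme" and u :: "('o, 'm, 'p, 'n) functr"
    and \<phi> :: "int \<Rightarrow> 'o \<Rightarrow> 'n" and T :: "('o, 'm, 'b, 'c) functr"
    and T' :: "('p, 'n, 'b, 'c) functr" and d :: int +
  fixes X
  assumes X [simp]: "X \<in> Obj D" and bounded: "t_bounded D X"
begin

abbreviation "TX \<equiv> apply_coh D T (t_spobj D X)"
abbreviation "TuX \<equiv> translate (apply_coh D' T' (t_spobj D' (onO u X))) (- d)"
abbreviation "\<kappa> \<equiv> tle_comparison D D' u d X"
abbreviation "\<gamma> \<equiv> tsp_comparison D D' u d X"

lemma spectral_object_TX: "spectral_object B TX"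
  by (rule T.spectral_object_apply_coh[OF X bounded])

lemma spectral_object_TuX: "spectral_object B TuX"
  by (intro spectral_object_translate T'.spectral_object_apply_coh U.u_t_bounded)
    (simp_all add: bounded)

lemma \<kappa>_simps [simp]:
  "Dom D' (\<kappa> (- p)) = onO u (tau_le D (- p) X)"
  "Cod D' (\<kappa> (- p)) = tau_le D' (d - p) (onO u X)"
  by simp_all

lemma tle_in_\<kappa>: "tle_in D' (d - p) (onO u X) \<cdot>\<^bsub>D'\<^esub> \<kappa> (- p) = onM u (tle_in D (- p) X)"
  using U.tle_in_tle_comparison[OF X, of "- p"] by simp

text \<open>The adjunction enters only through \<open>t\<close>, of which naturality and
  compatibility with a single translation are asked. The latter, \<open>shift\<close>, produces
  exactly the factor \<open>\<phi> 1\<close> that \<open>tsp_comparison_coboundary\<close>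
  requires.\<close>

lemma forward_comparison:
  fixes t :: "int \<Rightarrow> 'o \<Rightarrow> 'c"
  assumes t [simp]: "\<And>n Y. Y \<in> Obj D \<Longrightarrow> t n Y \<in> Arr B"
      "\<And>n Y. Y \<in> Obj D \<Longrightarrow> Dom B (t n Y) = TO D T n Y"
      "\<And>n Y. Y \<in> Obj D \<Longrightarrow> Cod B (t n Y) = TO D' T' n (onO u Y)"
    and natural: "\<And>n f. f \<in> Arr D \<Longrightarrow>
      TM D' T' n (onM u f) \<cdot>\<^bsub>B\<^esub> t n (Dom D f) = t n (Cod D f) \<cdot>\<^bsub>B\<^esub> TM D T n f"
    and shift: "\<And>n Y. Y \<in> Obj D \<Longrightarrow> t (n + 1) Y = TM D' T' n (\<phi> 1 Y) \<cdot>\<^bsub>B\<^esub> t n (onO (Sh D 1) Y)"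
    and f: "\<And>n p q. f n p q = TM D' T' n (\<gamma> p q) \<cdot>\<^bsub>B\<^esub> t n (tspO D X p q)"
  shows "spectral_object_morphism B TX TuX f"
    and "abutment_compatible B D T X 0 D' T' (onO u X) (- d) f (\<lambda>n. t n X)"
proof -
  show "spectral_object_morphism B TX TuX f"
    unfolding spectral_object_morphism_def
  proof (intro conjI allI impI spectral_object_TX spectral_object_TuX)
    fix n p q :: int
    show "f n p q \<in> Hom B (gO TX n p q) (gO TuX n p q)"
      by (simp add: f apply_coh_def t_spobj_def translate_def)
  next
    fix n p q p' q' :: int
    assume *: "p \<le> q \<and> p' \<le> q' \<and> p' \<le> p \<and> q' \<le> q"
    let ?M = "tspM D X p q p' q'" and ?M' = "tspM D' (onO u X) (p - d) (q - d) (p' - d) (q' - d)"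
    have [simp]: "?M \<in> Arr D" "Dom D ?M = tspO D X p q" "Cod D ?M = tspO D X p' q'"
      "?M' \<in> Arr D'" "Dom D' ?M' = tspO D' (onO u X) (p - d) (q - d)"
      "Cod D' ?M' = tspO D' (onO u X) (p' - d) (q' - d)"
      using * by simp_all
    have sq: "TM D' T' n (\<gamma> p' q') \<cdot>\<^bsub>B\<^esub> TM D' T' n (onM u ?M) = TM D' T' n ?M' \<cdot>\<^bsub>B\<^esub> TM D' T' n (\<gamma> p q)"
      using * T'.TM_comp[OF U.tsp_comparison_natural[OF X, of p' p q' q], of n]
        T'.TM_comp[OF refl, of "\<gamma> p q" ?M' n] by simp
    have "f n p' q' \<cdot>\<^bsub>B\<^esub> TM D T n ?M = TM D' T' n (\<gamma> p' q') \<cdot>\<^bsub>B\<^esub> (TM D' T' n (onM u ?M) \<cdot>\<^bsub>B\<^esub> t n (tspO D X p q))"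
      using natural[of ?M n] by (simp add: f)
    also have "\<dots> = TM D' T' n ?M' \<cdot>\<^bsub>B\<^esub> f n p q"
      using T.B.comp_reassoc[OF sq, of "t n (tspO D X p q)"] by (simp add: f)
    finally show "f n p' q' \<cdot>\<^bsub>B\<^esub> gM TX n p q p' q' = gM TuX n p q p' q' \<cdot>\<^bsub>B\<^esub> f n p q"
      by (simp add: apply_coh_def t_spobj_def translate_def)
  next
    fix n p q r :: int
    assume *: "p \<le> q \<and> q \<le> r"
    let ?\<delta> = "tspD D X p q r" and ?\<delta>' = "tspD D' (onO u X) (p - d) (q - d) (r - d)"
    have [simp]: "?\<delta> \<in> Arr D" "Dom D ?\<delta> = tspO D X p q" "Cod D ?\<delta> = onO (Sh D 1) (tspO D X q r)"
      "?\<delta>' \<in> Arr D'" "Dom D' ?\<delta>' = tspO D' (onO u X) (p - d) (q - d)"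
      "Cod D' ?\<delta>' = onO (Sh D' 1) (tspO D' (onO u X) (q - d) (r - d))"
      using * by simp_all
    let ?g = "\<phi> 1 (tspO D X q r)"
    have gu: "TM D' T' n (?g \<cdot>\<^bsub>D'\<^esub> onM u ?\<delta>) = TM D' T' n ?g \<cdot>\<^bsub>B\<^esub> TM D' T' n (onM u ?\<delta>)"
      by (rule T'.TM_comp[OF refl, symmetric]) simp_all
    have sq: "TM D' T' (n + 1) (\<gamma> q r) \<cdot>\<^bsub>B\<^esub> (TM D' T' n ?g \<cdot>\<^bsub>B\<^esub> TM D' T' n (onM u ?\<delta>))
        = TM D' T' n ?\<delta>' \<cdot>\<^bsub>B\<^esub> TM D' T' n (\<gamma> p q)"
      using * T'.TM_comp[OF U.tsp_comparison_coboundary[OF X, of p q r], of n]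
        T'.TM_comp[OF refl, of "\<gamma> p q" ?\<delta>' n] by (simp add: gu T'.TM_shift)
    have TOs: "TO D' T' n (onO (Sh D' 1) (onO u (tspO D X q r))) = TO D' T' (n + 1) (onO u (tspO D X q r))"
      "TO D T n (onO (Sh D 1) (tspO D X q r)) = TO D T (n + 1) (tspO D X q r)"
      by (simp_all add: T'.TO_shift T.TO_shift)
    have "f (n + 1) q r \<cdot>\<^bsub>B\<^esub> TM D T n ?\<delta>
        = TM D' T' (n + 1) (\<gamma> q r) \<cdot>\<^bsub>B\<^esub> (TM D' T' n ?g \<cdot>\<^bsub>B\<^esub> (t n (onO (Sh D 1) (tspO D X q r)) \<cdot>\<^bsub>B\<^esub> TM D T n ?\<delta>))"
      by (simp add: f shift TOs)
    also have "\<dots> = (TM D' T' (n + 1) (\<gamma> q r) \<cdot>\<^bsub>B\<^esub> (TM D' T' n ?g \<cdot>\<^bsub>B\<^esub> TM D' T' n (onM u ?\<delta>))) \<cdot>\<^bsub>B\<^esub> t n (tspO D X p q)"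
      using natural[of ?\<delta> n] by (simp add: TOs)
    also have "\<dots> = TM D' T' n ?\<delta>' \<cdot>\<^bsub>B\<^esub> f n p q"
      unfolding sq by (simp add: f)
    finally show "f (n + 1) q r \<cdot>\<^bsub>B\<^esub> gD TX n p q r = gD TuX n p q r \<cdot>\<^bsub>B\<^esub> f n p q"
      by (simp add: apply_coh_def t_spobj_def translate_def)
  qed
  show "abutment_compatible B D T X 0 D' T' (onO u X) (- d) f (\<lambda>n. t n X)"
    unfolding abutment_compatible_def
  proof (intro allI bexI conjI impI)
    fix n p :: int
    let ?Y = "tau_le D (- p) X"
    \<comment> \<open>One and the same map on the truncation covers both the map of abutments and
      the map \<open>f n p q\<close>: it is \<open>t\<close> there, followed by the comparison of
      truncations.\<close>
    let ?k = "TM D' T' n (\<kappa> (- p)) \<cdot>\<^bsub>B\<^esub> t n ?Y"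
    show "?k \<in> Hom B (TO D T n (tau_le D (- (p + 0)) X)) (TO D' T' n (tau_le D' (- (p + - d)) (onO u X)))"
      by simp
    have sq: "TM D' T' n (tle_in D' (d - p) (onO u X)) \<cdot>\<^bsub>B\<^esub> TM D' T' n (\<kappa> (- p))
        = TM D' T' n (onM u (tle_in D (- p) X))"
      by (rule T'.TM_comp) (simp_all add: tle_in_\<kappa>)
    show "TM D' T' n (tle_in D' (- (p + - d)) (onO u X)) \<cdot>\<^bsub>B\<^esub> ?k
        = t n X \<cdot>\<^bsub>B\<^esub> TM D T n (tle_in D (- (p + 0)) X)"
      using T.B.comp_reassoc[OF sq, of "t n ?Y"] natural[of "tle_in D (- p) X" n] by simp
    fix q
    let ?o = "tsp_out D X p q" and ?o' = "tsp_out D' (onO u X) (p - d) (q - d)"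
    have sq: "TM D' T' n ?o' \<cdot>\<^bsub>B\<^esub> TM D' T' n (\<kappa> (- p)) = TM D' T' n (\<gamma> p q) \<cdot>\<^bsub>B\<^esub> TM D' T' n (onM u ?o)"
      using T'.TM_comp[OF U.tsp_comparison_tsp_out[OF X, of p q], of n]
        T'.TM_comp[OF refl, of "\<kappa> (- p)" ?o' n] by simp
    show "TM D' T' n (tsp_out D' (onO u X) (p + - d) (q + - d)) \<cdot>\<^bsub>B\<^esub> ?k
        = f n p q \<cdot>\<^bsub>B\<^esub> TM D T n (tsp_out D X (p + 0) (q + 0))"
      using T.B.comp_reassoc[OF sq, of "t n ?Y"] natural[of ?o n] by (simp add: f)
  qed
qed

text \<open>With the arrows reversed, the squares for the comparison isomorphisms are first turned
  into squares for their inverses by \<open>isomor_square\<close>.\<close>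

lemma backward_comparison:
  fixes s :: "int \<Rightarrow> 'o \<Rightarrow> 'c"
  assumes s [simp]: "\<And>n Y. Y \<in> Obj D \<Longrightarrow> s n Y \<in> Arr B"
      "\<And>n Y. Y \<in> Obj D \<Longrightarrow> Dom B (s n Y) = TO D' T' n (onO u Y)"
      "\<And>n Y. Y \<in> Obj D \<Longrightarrow> Cod B (s n Y) = TO D T n Y"
    and natural: "\<And>n f. f \<in> Arr D \<Longrightarrow>
      TM D T n f \<cdot>\<^bsub>B\<^esub> s n (Dom D f) = s n (Cod D f) \<cdot>\<^bsub>B\<^esub> TM D' T' n (onM u f)"
    and shift: "\<And>n Y. Y \<in> Obj D \<Longrightarrow> s (n + 1) Y \<cdot>\<^bsub>B\<^esub> TM D' T' n (\<phi> 1 Y) = s n (onO (Sh D 1) Y)"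
    and f: "\<And>n p q. f n p q = s n (tspO D X p q) \<cdot>\<^bsub>B\<^esub> TM D' T' n (arr_inv D' (\<gamma> p q))"
  shows "spectral_object_morphism B TuX TX f"
    and "abutment_compatible B D' T' (onO u X) (- d) D T X 0 f (\<lambda>n. s n X)"
proof -
  note \<gamma>_inv [simp] = isomor_arr_inv(2-4)[OF U.tsp_comparison_isomor[OF X]]
  note \<kappa>_inv [simp] = isomor_arr_inv(2-4)[OF U.tle_comparison_isomor[OF X]]
  show "spectral_object_morphism B TuX TX f"
    unfolding spectral_object_morphism_def
  proof (intro conjI allI impI spectral_object_TX spectral_object_TuX)
    fix n p q :: int
    show "f n p q \<in> Hom B (gO TuX n p q) (gO TX n p q)"
      by (simp add: f apply_coh_def t_spobj_def translate_def)
  next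
    fix n p q p' q' :: int
    assume *: "p \<le> q \<and> p' \<le> q' \<and> p' \<le> p \<and> q' \<le> q"
    let ?M = "tspM D X p q p' q'" and ?M' = "tspM D' (onO u X) (p - d) (q - d) (p' - d) (q' - d)"
    have [simp]: "?M \<in> Arr D" "Dom D ?M = tspO D X p q" "Cod D ?M = tspO D X p' q'"
      "?M' \<in> Arr D'" "Dom D' ?M' = tspO D' (onO u X) (p - d) (q - d)"
      "Cod D' ?M' = tspO D' (onO u X) (p' - d) (q' - d)"
      using * by simp_all
    have "arr_inv D' (\<gamma> p' q') \<cdot>\<^bsub>D'\<^esub> ?M' = onM u ?M \<cdot>\<^bsub>D'\<^esub> arr_inv D' (\<gamma> p q)"
      by (rule U.D'.isomor_square)
        (use * in \<open>simp_all add: U.tsp_comparison_isomor U.tsp_comparison_natural\<close>)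
    from T'.TM_comp[OF this, of n] T'.TM_comp[OF refl, of "arr_inv D' (\<gamma> p q)" "onM u ?M" n]
    have sq: "TM D' T' n (arr_inv D' (\<gamma> p' q')) \<cdot>\<^bsub>B\<^esub> TM D' T' n ?M'
        = TM D' T' n (onM u ?M) \<cdot>\<^bsub>B\<^esub> TM D' T' n (arr_inv D' (\<gamma> p q))"
      by simp
    have nat: "s n (tspO D X p' q') \<cdot>\<^bsub>B\<^esub> TM D' T' n (onM u ?M) = TM D T n ?M \<cdot>\<^bsub>B\<^esub> s n (tspO D X p q)"
      using natural[of ?M n] by simp
    have "f n p' q' \<cdot>\<^bsub>B\<^esub> TM D' T' n ?M' = TM D T n ?M \<cdot>\<^bsub>B\<^esub> f n p q"
      using T.B.comp_reassoc[OF nat, of "TM D' T' n (arr_inv D' (\<gamma> p q))"] by (simp add: f sq)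
    then show "f n p' q' \<cdot>\<^bsub>B\<^esub> gM TuX n p q p' q' = gM TX n p q p' q' \<cdot>\<^bsub>B\<^esub> f n p q"
      by (simp add: apply_coh_def t_spobj_def translate_def)
  next
    fix n p q r :: int
    assume *: "p \<le> q \<and> q \<le> r"
    let ?\<delta> = "tspD D X p q r" and ?\<delta>' = "tspD D' (onO u X) (p - d) (q - d) (r - d)"
    have [simp]: "?\<delta> \<in> Arr D" "Dom D ?\<delta> = tspO D X p q" "Cod D ?\<delta> = onO (Sh D 1) (tspO D X q r)"
      "?\<delta>' \<in> Arr D'" "Dom D' ?\<delta>' = tspO D' (onO u X) (p - d) (q - d)"
      "Cod D' ?\<delta>' = onO (Sh D' 1) (tspO D' (onO u X) (q - d) (r - d))"
      using * by simp_all
    let ?g = "\<phi> 1 (tspO D X q r)" and ?i = "TM D' T' n (arr_inv D' (\<gamma> p q))"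
    let ?\<gamma>1 = "onM (Sh D' 1) (\<gamma> q r)"
    have iso1: "isomor D' ?\<gamma>1"
      by (intro U.D'.Sh.map_isomor U.tsp_comparison_isomor) simp
    \<comment> \<open>The inverted coboundary square contains the inverse of a translated arrow; it
      has to be recognised as the translate of the inverse, which is \<open>f\<close> in degree
      \<open>n + 1\<close>.\<close>
    have inv1: "arr_inv D' ?\<gamma>1 = onM (Sh D' 1) (arr_inv D' (\<gamma> q r))"
      by (rule U.D'.arr_inv_eqI[OF iso1])
        (use U.D'.Sh.map_comp_eq[OF isomor_arr_inv(6)[OF U.tsp_comparison_isomor[OF X, of q r]], of 1]
          in simp_all)
    have "arr_inv D' ?\<gamma>1 \<cdot>\<^bsub>D'\<^esub> ?\<delta>' = (?g \<cdot>\<^bsub>D'\<^esub> onM u ?\<delta>) \<cdot>\<^bsub>D'\<^esub> arr_inv D' (\<gamma> p q)"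
      by (rule U.D'.isomor_square[OF iso1])
        (use * in \<open>simp_all add: U.tsp_comparison_isomor U.tsp_comparison_coboundary\<close>)
    then have "onM (Sh D' 1) (arr_inv D' (\<gamma> q r)) \<cdot>\<^bsub>D'\<^esub> ?\<delta>'
        = ?g \<cdot>\<^bsub>D'\<^esub> (onM u ?\<delta> \<cdot>\<^bsub>D'\<^esub> arr_inv D' (\<gamma> p q))"
      by (simp add: inv1)
    from T'.TM_comp[OF this, of n] T'.TM_comp[OF refl, of "onM u ?\<delta> \<cdot>\<^bsub>D'\<^esub> arr_inv D' (\<gamma> p q)" ?g n]
      T'.TM_comp[OF refl, of "arr_inv D' (\<gamma> p q)" "onM u ?\<delta>" n]
    have sq: "TM D' T' (n + 1) (arr_inv D' (\<gamma> q r)) \<cdot>\<^bsub>B\<^esub> TM D' T' n ?\<delta>'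
        = TM D' T' n ?g \<cdot>\<^bsub>B\<^esub> (TM D' T' n (onM u ?\<delta>) \<cdot>\<^bsub>B\<^esub> ?i)"
      by (simp add: T'.TM_shift)
    have TOs: "TO D' T' n (onO (Sh D' 1) Y) = TO D' T' (n + 1) Y" if "Y \<in> Obj D'" for Y
      using that by (simp add: T'.TO_shift)
    have nat: "s n (onO (Sh D 1) (tspO D X q r)) \<cdot>\<^bsub>B\<^esub> TM D' T' n (onM u ?\<delta>)
        = TM D T n ?\<delta> \<cdot>\<^bsub>B\<^esub> s n (tspO D X p q)"
      using natural[of ?\<delta> n] by simp
    have "f (n + 1) q r \<cdot>\<^bsub>B\<^esub> TM D' T' n ?\<delta>'
        = s (n + 1) (tspO D X q r) \<cdot>\<^bsub>B\<^esub> (TM D' T' n ?g \<cdot>\<^bsub>B\<^esub> (TM D' T' n (onM u ?\<delta>) \<cdot>\<^bsub>B\<^esub> ?i))"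
      unfolding sq[symmetric] by (simp add: f TOs)
    also have "\<dots> = s n (onO (Sh D 1) (tspO D X q r)) \<cdot>\<^bsub>B\<^esub> (TM D' T' n (onM u ?\<delta>) \<cdot>\<^bsub>B\<^esub> ?i)"
      by (rule T.B.comp_reassoc[OF shift]) (simp_all add: TOs)
    also have "\<dots> = TM D T n ?\<delta> \<cdot>\<^bsub>B\<^esub> f n p q"
      using T.B.comp_reassoc[OF nat, of ?i] by (simp add: f)
    finally show "f (n + 1) q r \<cdot>\<^bsub>B\<^esub> gD TuX n p q r = gD TX n p q r \<cdot>\<^bsub>B\<^esub> f n p q"
      by (simp add: apply_coh_def t_spobj_def translate_def)
  qed
  show "abutment_compatible B D' T' (onO u X) (- d) D T X 0 f (\<lambda>n. s n X)"
    unfolding abutment_compatible_def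
  proof (intro allI bexI conjI impI)
    fix n p :: int
    let ?Y = "tau_le D (- p) X"
    let ?i = "arr_inv D' (\<kappa> (- p))"
    let ?k = "s n ?Y \<cdot>\<^bsub>B\<^esub> TM D' T' n ?i"
    show "?k \<in> Hom B (TO D' T' n (tau_le D' (- (p + - d)) (onO u X))) (TO D T n (tau_le D (- (p + 0)) X))"
      by simp
    have "onM u (tle_in D (- p) X) \<cdot>\<^bsub>D'\<^esub> ?i
        = tle_in D' (d - p) (onO u X) \<cdot>\<^bsub>D'\<^esub> (\<kappa> (- p) \<cdot>\<^bsub>D'\<^esub> ?i)"
      unfolding tle_in_\<kappa>[symmetric] by simp
    also have "\<dots> = tle_in D' (d - p) (onO u X)"
      using isomor_arr_inv(6)[OF U.tle_comparison_isomor[OF X, of "- p"]] by simp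
    finally have sq: "TM D' T' n (onM u (tle_in D (- p) X)) \<cdot>\<^bsub>B\<^esub> TM D' T' n ?i
        = TM D' T' n (tle_in D' (d - p) (onO u X))"
      by (rule T'.TM_comp) simp_all
    have nat: "TM D T n (tle_in D (- p) X) \<cdot>\<^bsub>B\<^esub> s n ?Y = s n X \<cdot>\<^bsub>B\<^esub> TM D' T' n (onM u (tle_in D (- p) X))"
      using natural[of "tle_in D (- p) X" n] by simp
    show "TM D T n (tle_in D (- (p + 0)) X) \<cdot>\<^bsub>B\<^esub> ?k
        = s n X \<cdot>\<^bsub>B\<^esub> TM D' T' n (tle_in D' (- (p + - d)) (onO u X))"
      using T.B.comp_reassoc[OF nat, of "TM D' T' n ?i"] sq by simp
    fix q
    let ?o = "tsp_out D X p q" and ?o' = "tsp_out D' (onO u X) (p - d) (q - d)"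
    have "arr_inv D' (\<gamma> p q) \<cdot>\<^bsub>D'\<^esub> ?o' = onM u ?o \<cdot>\<^bsub>D'\<^esub> ?i"
      by (rule U.D'.isomor_square)
        (simp_all add: U.tsp_comparison_isomor U.tle_comparison_isomor U.tsp_comparison_tsp_out)
    from T'.TM_comp[OF this, of n] T'.TM_comp[OF refl, of ?i "onM u ?o" n]
    have sq: "TM D' T' n (arr_inv D' (\<gamma> p q)) \<cdot>\<^bsub>B\<^esub> TM D' T' n ?o' = TM D' T' n (onM u ?o) \<cdot>\<^bsub>B\<^esub> TM D' T' n ?i"
      by simp
    have nat: "TM D T n ?o \<cdot>\<^bsub>B\<^esub> s n ?Y = s n (tspO D X p q) \<cdot>\<^bsub>B\<^esub> TM D' T' n (onM u ?o)"
      using natural[of ?o n] by simp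
    show "TM D T n (tsp_out D X (p + 0) (q + 0)) \<cdot>\<^bsub>B\<^esub> ?k
        = f n p q \<cdot>\<^bsub>B\<^esub> TM D' T' n (tsp_out D' (onO u X) (p + - d) (q + - d))"
      using T.B.comp_reassoc[OF nat, of "TM D' T' n ?i"] sq by (simp add: f)
  qed
qed

end

text \<open>The left-hand square of \<open>abutment_compatible\<close> is a map between the arrows
  whose images are the filtration steps, so it induces a map of images.\<close>

lemma filtered_map_abutment:
  assumes "cohomological_functor D B T" "cohomological_functor D' B T'"
    and X: "X \<in> Obj D" "X' \<in> Obj D'"
    and ab: "abutment_compatible B D T X l D' T' X' l' f g"
    and g: "g n \<in> Hom B (TO D T n X) (TO D' T' n X')"
  shows "filtered_map B (TO D T n X) (translate_filtration (L_filtration D B T X n) l)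
    (TO D' T' n X') (translate_filtration (L_filtration D' B T' X' n) l') (g n)"
proof -
  interpret T: cohomological_functor D B T by fact
  interpret T': cohomological_functor D' B T' by fact
  show ?thesis
    unfolding filtered_map_def
  proof (intro conjI allI g)
    fix s
    let ?a = "TM D T n (tle_in D (- (s - n + l)) X)"
    let ?a' = "TM D' T' n (tle_in D' (- (s - n + l')) X')"
    \<comment> \<open>By \<open>L\<^sup>p\<^sup>+\<^sup>n T\<^sup>n = F\<^sup>p T\<^sup>n\<close>,
      step \<open>s\<close> is the filtration index \<open>p = s - n\<close>, and a translation by
      \<open>l\<close> adds to it.\<close>
    have G: "translate_filtration (L_filtration D B T X n) l s = im_mono B ?a"
      "translate_filtration (L_filtration D' B T' X' n) l' s = im_mono B ?a'"
      by (simp_all add: translate_filtration_def L_filtration_def F_filtration_def algebra_simps)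
    have a: "?a \<in> Arr B" "Cod B ?a = TO D T n X" "Dom B ?a = TO D T n (tau_le D (- (s - n + l)) X)"
      "?a' \<in> Arr B" "Cod B ?a' = TO D' T' n X'" "Dom B ?a' = TO D' T' n (tau_le D' (- (s - n + l')) X')"
      using X by simp_all
    note i = T.B.image_fact_im[OF a(1)] and i' = T.B.image_fact_im[OF a(4)]
    obtain k where k: "k \<in> Arr B" "Dom B k = Dom B ?a" "Cod B k = Dom B ?a'"
      "?a' \<cdot>\<^bsub>B\<^esub> k = g n \<cdot>\<^bsub>B\<^esub> ?a"
      using ab[unfolded abutment_compatible_def, THEN spec, of n, THEN spec, of "s - n"] a(3,6)
      by auto
    obtain h where "h \<in> Arr B" "Dom B h = Cod B (im_epi B ?a)" "Cod B h = Cod B (im_epi B ?a')"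
      "im_mono B ?a' \<cdot>\<^bsub>B\<^esub> h = g n \<cdot>\<^bsub>B\<^esub> im_mono B ?a"
      by (rule T.B.image_fact_map[OF i i' k(1-3) _ _ _ k(4)]) (use g a in simp_all)
    then show "monic B (translate_filtration (L_filtration D B T X n) l s)"
      "Cod B (translate_filtration (L_filtration D B T X n) l s) = TO D T n X"
      "monic B (translate_filtration (L_filtration D' B T' X' n) l' s)"
      "Cod B (translate_filtration (L_filtration D' B T' X' n) l' s) = TO D' T' n X'"
      "\<exists>k\<in>Hom B (Dom B (translate_filtration (L_filtration D B T X n) l s))
          (Dom B (translate_filtration (L_filtration D' B T' X' n) l' s)).
        translate_filtration (L_filtration D' B T' X' n) l' s \<cdot>\<^bsub>B\<^esub> k
          = g n \<cdot>\<^bsub>B\<^esub> translate_filtration (L_filtration D B T X n) l s"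
      using T.B.image_factD[OF i] T.B.image_factD[OF i'] a unfolding G by auto
  qed
qed

section \<open>The natural transformations given by a unit or a counit\<close>

context cohomological_comparison
begin

context
  fixes v :: "('p, 'n, 'o, 'm) functr" and \<theta> :: "'p \<Rightarrow> 'c"
  assumes v: "cat_functor D' D v" and \<theta>: "natural_iso D' B (T \<circ>\<^sub>F v) T' \<theta>"
begin

lemma v_simps [simp]:
  "y \<in> Obj D' \<Longrightarrow> onO v y \<in> Obj D"
  "g \<in> Arr D' \<Longrightarrow> onM v g \<in> Arr D"
  "g \<in> Arr D' \<Longrightarrow> Dom D (onM v g) = onO v (Dom D' g)"
  "g \<in> Arr D' \<Longrightarrow> Cod D (onM v g) = onO v (Cod D' g)"
proof -
  show "y \<in> Obj D' \<Longrightarrow> onO v y \<in> Obj D"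
    using v unfolding cat_functor_def by blast
  assume g: "g \<in> Arr D'"
  then have "g \<in> Hom D' (Dom D' g) (Cod D' g)" "Dom D' g \<in> Obj D'" "Cod D' g \<in> Obj D'"
    by simp_all
  then have "onM v g \<in> Hom D (onO v (Dom D' g)) (onO v (Cod D' g))"
    using v unfolding cat_functor_def by blast
  then show "onM v g \<in> Arr D" "Dom D (onM v g) = onO v (Dom D' g)"
    "Cod D (onM v g) = onO v (Cod D' g)"
    by simp_all
qed

lemma \<theta>_simps [simp]:
  assumes "y \<in> Obj D'"
  shows "\<theta> y \<in> Arr B" "Dom B (\<theta> y) = onO T (onO v y)" "Cod B (\<theta> y) = onO T' y" "isomor B (\<theta> y)"
  using \<theta> assms by (auto simp: natural_iso_def natural_def comp_functr_def)

lemma \<theta>_natural: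
  assumes "g \<in> Arr D'"
  shows "\<theta> (Cod D' g) \<cdot>\<^bsub>B\<^esub> onM T (onM v g) = onM T' g \<cdot>\<^bsub>B\<^esub> \<theta> (Dom D' g)"
proof -
  have "g \<in> Hom D' (Dom D' g) (Cod D' g)" "Dom D' g \<in> Obj D'" "Cod D' g \<in> Obj D'"
    using assms by simp_all
  then have "\<theta> (Cod D' g) \<cdot>\<^bsub>B\<^esub> onM (T \<circ>\<^sub>F v) g = onM T' g \<cdot>\<^bsub>B\<^esub> \<theta> (Dom D' g)"
    using \<theta> unfolding natural_iso_def natural_def by blast
  then show ?thesis
    by (simp add: comp_functr_def)
qed

abbreviation "tr \<equiv> transfer_iso D B T' u \<phi> \<theta>"

lemma tr_simps [simp]:
  assumes "Y \<in> Obj D"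
  shows "tr n Y \<in> Arr B" "Dom B (tr n Y) = onO T (onO v (onO u (onO (Sh D n) Y)))"
    "Cod B (tr n Y) = TO D' T' n (onO u Y)" "isomor B (tr n Y)"
proof -
  have i: "isomor B (onM T' (\<phi> n Y))"
    using assms by (intro T'.T.map_isomor) simp
  show "tr n Y \<in> Arr B" "Dom B (tr n Y) = onO T (onO v (onO u (onO (Sh D n) Y)))"
    "Cod B (tr n Y) = TO D' T' n (onO u Y)" "isomor B (tr n Y)"
    using assms by (simp_all add: transfer_iso_def TO_def T.B.isomor_comp i)
qed

lemma tr_natural:
  assumes f: "f \<in> Arr D"
  shows "TM D' T' n (onM u f) \<cdot>\<^bsub>B\<^esub> tr n (Dom D f)
    = tr n (Cod D f) \<cdot>\<^bsub>B\<^esub> onM T (onM v (onM u (onM (Sh D n) f)))"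
proof -
  let ?g = "onM u (onM (Sh D n) f)"
  have "onM T' (\<phi> n (Cod D f) \<cdot>\<^bsub>D'\<^esub> ?g) = onM T' (onM (Sh D' n) (onM u f) \<cdot>\<^bsub>D'\<^esub> \<phi> n (Dom D f))"
    by (simp only: U.\<phi>_natural[OF f])
  then have \<phi>: "onM T' (\<phi> n (Cod D f)) \<cdot>\<^bsub>B\<^esub> onM T' ?g = TM D' T' n (onM u f) \<cdot>\<^bsub>B\<^esub> onM T' (\<phi> n (Dom D f))"
    using f by (simp add: TM_def)
  have \<theta>: "\<theta> (onO u (onO (Sh D n) (Cod D f))) \<cdot>\<^bsub>B\<^esub> onM T (onM v ?g)
      = onM T' ?g \<cdot>\<^bsub>B\<^esub> \<theta> (onO u (onO (Sh D n) (Dom D f)))"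
    using \<theta>_natural[of ?g] f by simp
  have "tr n (Cod D f) \<cdot>\<^bsub>B\<^esub> onM T (onM v ?g)
      = onM T' (\<phi> n (Cod D f)) \<cdot>\<^bsub>B\<^esub> (onM T' ?g \<cdot>\<^bsub>B\<^esub> \<theta> (onO u (onO (Sh D n) (Dom D f))))"
    unfolding transfer_iso_def \<theta>[symmetric] using f by simp
  also have "\<dots> = TM D' T' n (onM u f) \<cdot>\<^bsub>B\<^esub> tr n (Dom D f)"
    unfolding transfer_iso_def
    using T.B.comp_reassoc[OF \<phi>, of "\<theta> (onO u (onO (Sh D n) (Dom D f)))"] f by (simp add: TO_def)
  finally show ?thesis
    by simp
qed

text \<open>Additivity of \<phi> in the degree splits off \<open>\<phi> 1\<close>, and \<theta> is
  evaluated at the same object on both sides since \<open>Y[n + 1] = (Y[1])[n]\<close>.\<close>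

lemma tr_shift:
  assumes "Y \<in> Obj D"
  shows "tr (n + 1) Y = TM D' T' n (\<phi> 1 Y) \<cdot>\<^bsub>B\<^esub> tr n (onO (Sh D 1) Y)"
  unfolding transfer_iso_def using assms by (simp add: U.\<phi>_add TM_def)

text \<open>These are the hypotheses of \<open>forward_comparison\<close>. Naturality of \<eta> is
  used at the translated arrow \<open>f[n]\<close>, and \<open>tr_natural\<close> carries the result
  over to \<open>T'\<close>.\<close>

lemma forward_natural:
  assumes \<eta>: "natural D D id_functr (v \<circ>\<^sub>F u) \<eta>"
  defines "t \<equiv> \<lambda>n Y. tr n Y \<cdot>\<^bsub>B\<^esub> onM T (\<eta> (onO (Sh D n) Y))"
  shows "Y \<in> Obj D \<Longrightarrow> t n Y \<in> Arr B"
    "Y \<in> Obj D \<Longrightarrow> Dom B (t n Y) = TO D T n Y"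
    "Y \<in> Obj D \<Longrightarrow> Cod B (t n Y) = TO D' T' n (onO u Y)"
    "f \<in> Arr D \<Longrightarrow> TM D' T' n (onM u f) \<cdot>\<^bsub>B\<^esub> t n (Dom D f) = t n (Cod D f) \<cdot>\<^bsub>B\<^esub> TM D T n f"
    "Y \<in> Obj D \<Longrightarrow> t (n + 1) Y = TM D' T' n (\<phi> 1 Y) \<cdot>\<^bsub>B\<^esub> t n (onO (Sh D 1) Y)"
proof -
  have \<eta>_simps [simp]: "\<eta> Z \<in> Arr D" "Dom D (\<eta> Z) = Z" "Cod D (\<eta> Z) = onO v (onO u Z)"
    if "Z \<in> Obj D" for Z
    using \<eta> that by (auto simp: natural_def id_functr_def comp_functr_def)
  show "Y \<in> Obj D \<Longrightarrow> t n Y \<in> Arr B"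
    "Y \<in> Obj D \<Longrightarrow> Dom B (t n Y) = TO D T n Y"
    "Y \<in> Obj D \<Longrightarrow> Cod B (t n Y) = TO D' T' n (onO u Y)"
    by (simp_all add: t_def TO_def)
  show "Y \<in> Obj D \<Longrightarrow> t (n + 1) Y = TM D' T' n (\<phi> 1 Y) \<cdot>\<^bsub>B\<^esub> t n (onO (Sh D 1) Y)"
    by (simp add: t_def tr_shift TO_def)
  assume f: "f \<in> Arr D"
  let ?h = "onM (Sh D n) f"
  have "?h \<in> Hom D (Dom D ?h) (Cod D ?h)" "Dom D ?h \<in> Obj D" "Cod D ?h \<in> Obj D"
    using f by simp_all
  from natural_square[OF \<eta> this]
  have "onM T (\<eta> (Cod D ?h) \<cdot>\<^bsub>D\<^esub> ?h) = onM T (onM v (onM u ?h) \<cdot>\<^bsub>D\<^esub> \<eta> (Dom D ?h))"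
    by (simp add: id_functr_def comp_functr_def)
  then have nat: "onM T (\<eta> (onO (Sh D n) (Cod D f))) \<cdot>\<^bsub>B\<^esub> TM D T n f
      = onM T (onM v (onM u ?h)) \<cdot>\<^bsub>B\<^esub> onM T (\<eta> (onO (Sh D n) (Dom D f)))"
    using f by (simp add: TM_def)
  show "TM D' T' n (onM u f) \<cdot>\<^bsub>B\<^esub> t n (Dom D f) = t n (Cod D f) \<cdot>\<^bsub>B\<^esub> TM D T n f"
    using T.B.comp_reassoc[OF tr_natural[OF f, of n], of "onM T (\<eta> (onO (Sh D n) (Dom D f)))"] f nat
    by (simp add: t_def TO_def)
qed

text \<open>Equations for \<open>s\<close> involve an inverse; they are checked after composing with
  the isomorphism \<open>tr\<close>, which is epic and turns \<open>s\<close> back into the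
  counit.\<close>

lemma backward_natural:
  assumes \<epsilon>: "natural D D (v \<circ>\<^sub>F u) id_functr \<epsilon>"
  defines "s \<equiv> \<lambda>n Y. onM T (\<epsilon> (onO (Sh D n) Y)) \<cdot>\<^bsub>B\<^esub> arr_inv B (tr n Y)"
  shows "Y \<in> Obj D \<Longrightarrow> s n Y \<in> Arr B"
    "Y \<in> Obj D \<Longrightarrow> Dom B (s n Y) = TO D' T' n (onO u Y)"
    "Y \<in> Obj D \<Longrightarrow> Cod B (s n Y) = TO D T n Y"
    "f \<in> Arr D \<Longrightarrow> TM D T n f \<cdot>\<^bsub>B\<^esub> s n (Dom D f) = s n (Cod D f) \<cdot>\<^bsub>B\<^esub> TM D' T' n (onM u f)"
    "Y \<in> Obj D \<Longrightarrow> s (n + 1) Y \<cdot>\<^bsub>B\<^esub> TM D' T' n (\<phi> 1 Y) = s n (onO (Sh D 1) Y)"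
    "Y \<in> Obj D \<Longrightarrow> s n Y \<cdot>\<^bsub>B\<^esub> tr n Y = onM T (\<epsilon> (onO (Sh D n) Y))"
proof -
  have \<epsilon>_simps [simp]: "\<epsilon> Z \<in> Arr D" "Cod D (\<epsilon> Z) = Z" "Dom D (\<epsilon> Z) = onO v (onO u Z)"
    if "Z \<in> Obj D" for Z
    using \<epsilon> that by (auto simp: natural_def id_functr_def comp_functr_def)
  have tr_inv [simp]: "arr_inv B (tr n Y) \<in> Arr B" "Dom B (arr_inv B (tr n Y)) = TO D' T' n (onO u Y)"
    "Cod B (arr_inv B (tr n Y)) = onO T (onO v (onO u (onO (Sh D n) Y)))"
    if "Y \<in> Obj D" for n Y
    using isomor_arr_inv[OF tr_simps(4)[OF that, of n]] that by simp_all
  show s: "s n Y \<in> Arr B" "Dom B (s n Y) = TO D' T' n (onO u Y)" "Cod B (s n Y) = TO D T n Y"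
    if "Y \<in> Obj D" for n Y
    using that by (simp_all add: s_def TO_def)
  show str: "s n Y \<cdot>\<^bsub>B\<^esub> tr n Y = onM T (\<epsilon> (onO (Sh D n) Y))" if "Y \<in> Obj D" for n Y
    using isomor_arr_inv(5)[OF tr_simps(4)[OF that, of n]] that by (simp add: s_def)
  show "s (n + 1) Y \<cdot>\<^bsub>B\<^esub> TM D' T' n (\<phi> 1 Y) = s n (onO (Sh D 1) Y)" if Y: "Y \<in> Obj D"
  proof (rule T.B.epicD[OF T.B.isomor_epic[OF tr_simps(4)[of "onO (Sh D 1) Y" n]]])
    show "(s (n + 1) Y \<cdot>\<^bsub>B\<^esub> TM D' T' n (\<phi> 1 Y)) \<cdot>\<^bsub>B\<^esub> tr n (onO (Sh D 1) Y)
        = s n (onO (Sh D 1) Y) \<cdot>\<^bsub>B\<^esub> tr n (onO (Sh D 1) Y)"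
      using Y str[OF Y, of "n + 1"] str[of "onO (Sh D 1) Y" n] tr_shift[OF Y, of n]
      by (simp add: s T'.TO_shift)
  qed (use Y in \<open>simp_all add: s T'.TO_shift T.TO_shift\<close>)
  assume f: "f \<in> Arr D"
  let ?h = "onM (Sh D n) f"
  have "?h \<in> Hom D (Dom D ?h) (Cod D ?h)" "Dom D ?h \<in> Obj D" "Cod D ?h \<in> Obj D"
    using f by simp_all
  from natural_square[OF \<epsilon> this]
  have "onM T (\<epsilon> (Cod D ?h) \<cdot>\<^bsub>D\<^esub> onM v (onM u ?h)) = onM T (?h \<cdot>\<^bsub>D\<^esub> \<epsilon> (Dom D ?h))"
    by (simp add: id_functr_def comp_functr_def)
  then have nat: "onM T (\<epsilon> (onO (Sh D n) (Cod D f))) \<cdot>\<^bsub>B\<^esub> onM T (onM v (onM u ?h))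
      = TM D T n f \<cdot>\<^bsub>B\<^esub> onM T (\<epsilon> (onO (Sh D n) (Dom D f)))"
    using f by (simp add: TM_def)
  show "TM D T n f \<cdot>\<^bsub>B\<^esub> s n (Dom D f) = s n (Cod D f) \<cdot>\<^bsub>B\<^esub> TM D' T' n (onM u f)"
  proof (rule T.B.epicD[OF T.B.isomor_epic[OF tr_simps(4)[of "Dom D f" n]]])
    have "(s n (Cod D f) \<cdot>\<^bsub>B\<^esub> TM D' T' n (onM u f)) \<cdot>\<^bsub>B\<^esub> tr n (Dom D f)
        = (s n (Cod D f) \<cdot>\<^bsub>B\<^esub> tr n (Cod D f)) \<cdot>\<^bsub>B\<^esub> onM T (onM v (onM u ?h))"
      using f tr_natural[OF f, of n] by (simp add: s)
    also have "\<dots> = TM D T n f \<cdot>\<^bsub>B\<^esub> (s n (Dom D f) \<cdot>\<^bsub>B\<^esub> tr n (Dom D f))"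
      using f nat by (simp add: str)
    finally show "(TM D T n f \<cdot>\<^bsub>B\<^esub> s n (Dom D f)) \<cdot>\<^bsub>B\<^esub> tr n (Dom D f)
        = (s n (Cod D f) \<cdot>\<^bsub>B\<^esub> TM D' T' n (onM u f)) \<cdot>\<^bsub>B\<^esub> tr n (Dom D f)"
      using f by (simp add: s)
  qed (use f in \<open>simp_all add: s\<close>)
qed

end

end

section \<open>Conclusion for a right adjoint and for a left adjoint of \<open>u\<close>\<close>

theorem lemma3p2p3:
  fixes D :: "('o, 'm, 'x) tcat_scheme"
    and D' :: "('p, 'n, 'y) tcat_scheme"
    and B :: "('b, 'c, 'z) acat_scheme"
    and u :: "('o, 'm, 'p, 'n) functr"
    and \<phi> :: "int \<Rightarrow> 'o \<Rightarrow> 'n"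
    and T :: "('o, 'm, 'b, 'c) functr"
    and T' :: "('p, 'n, 'b, 'c) functr"
    and d :: int
    and X :: 'o
  assumes "t_category D" and "t_category D'" and "abelian_category B"
    and "triangulated_functor D D' u \<phi>"
    and "\<exists>\<kappa>. natural_iso D B (T' \<circ>\<^sub>F u) T \<kappa>"
    and "shifted_t_exact D D' u d"
    and "cohomological D B T" and "cohomological D' B T'"
    and "X \<in> Obj D" and "t_bounded D X"
  defines "TX \<equiv> apply_coh D T (t_spobj D X)"
    and "TuX \<equiv> translate (apply_coh D' T' (t_spobj D' (onO u X))) (- d)"
    and "L \<equiv> (\<lambda>n. L_filtration D B T X n)"
    and "L' \<equiv> (\<lambda>n. translate_filtration (L_filtration D' B T' (onO u X) n) (- d))"
  shows
    "(\<forall>v \<eta> \<epsilon> \<theta>. adjunction D D' u v \<eta> \<epsilon> \<and> natural_iso D' B (T \<circ>\<^sub>F v) T' \<theta> \<longrightarrow>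
       (\<exists>f F g.
          (\<forall>n p q. p \<le> q \<longrightarrow> f n p q
             = TM D' T' n (tsp_comparison D D' u d X p q) \<cdot>\<^bsub>B\<^esub>
               transfer_iso D B T' u \<phi> \<theta> n (tspO D X p q) \<cdot>\<^bsub>B\<^esub>
               onM T (\<eta> (onO (Sh D n) (tspO D X p q)))) \<and>
          spectral_object_morphism B TX TuX f \<and>
          (\<forall>p q. F 1 p q = f (p + q) p (p + 1)) \<and>
          spectral_sequence_morphism B (E1 B TX) (E1 B TuX) F \<and>
          (\<forall>n. g n = transfer_iso D B T' u \<phi> \<theta> n X \<cdot>\<^bsub>B\<^esub> onM T (\<eta> (onO (Sh D n) X))) \<and>
          abutment_compatible B D T X 0 D' T' (onO u X) (- d) f g \<and>
          (\<forall>n. filtered_map B (TO D T n X) (L n) (TO D' T' n (onO u X)) (L' n) (g n))))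
     \<and>
     (\<forall>v \<eta> \<epsilon> \<theta>. adjunction D' D v u \<eta> \<epsilon> \<and> natural_iso D' B (T \<circ>\<^sub>F v) T' \<theta> \<longrightarrow>
       (\<exists>f F g.
          (\<forall>n p q. p \<le> q \<longrightarrow>
             f n p q \<cdot>\<^bsub>B\<^esub> TM D' T' n (tsp_comparison D D' u d X p q) \<cdot>\<^bsub>B\<^esub>
               transfer_iso D B T' u \<phi> \<theta> n (tspO D X p q)
             = onM T (\<epsilon> (onO (Sh D n) (tspO D X p q)))) \<and>
          spectral_object_morphism B TuX TX f \<and>
          (\<forall>p q. F 1 p q = f (p + q) p (p + 1)) \<and>
          spectral_sequence_morphism B (E1 B TuX) (E1 B TX) F \<and>
          (\<forall>n. g n \<cdot>\<^bsub>B\<^esub> transfer_iso D B T' u \<phi> \<theta> n X = onM T (\<epsilon> (onO (Sh D n) X))) \<and>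
          abutment_compatible B D' T' (onO u X) (- d) D T X 0 f g \<and>
          (\<forall>n. filtered_map B (TO D' T' n (onO u X)) (L' n) (TO D T n X) (L n) (g n))))"
proof -
  interpret cohomological_comparison D D' B u \<phi> T T' d X
    using assms(1-4,6-10)
    by (simp add: cohomological_comparison_def cohomological_comparison_axioms_def
        shifted_t_exact_functor_def shifted_t_exact_functor_axioms_def
        cohomological_functor_def cohomological_functor_axioms_def)
  \<comment> \<open>Written as a translate by zero, the filtration of \<open>X\<close> fits
    \<open>filtered_map_abutment\<close>, which treats both sides alike.\<close>
  have L: "L n = translate_filtration (L_filtration D B T X n) 0" for n
    by (simp add: L_def translate_filtration_def fun_eq_iff)
  show ?thesis
  proof (intro conjI allI impI; (elim conjE)?)
    fix v \<eta> \<epsilon> \<theta>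
    assume adj: "adjunction D D' u v \<eta> \<epsilon>" and \<theta>: "natural_iso D' B (T \<circ>\<^sub>F v) T' \<theta>"
    then have v: "cat_functor D' D v" and \<eta>: "natural D D id_functr (v \<circ>\<^sub>F u) \<eta>"
      by (simp_all add: adjunction_def)
    define t where "t n Y = transfer_iso D B T' u \<phi> \<theta> n Y \<cdot>\<^bsub>B\<^esub> onM T (\<eta> (onO (Sh D n) Y))" for n Y
    note t = forward_natural[OF v \<theta> \<eta>, folded t_def]
    define f where "f = (\<lambda>n p q. TM D' T' n (tsp_comparison D D' u d X p q) \<cdot>\<^bsub>B\<^esub> t n (tspO D X p q))"
    have mor: "spectral_object_morphism B TX TuX f"
      and ab: "abutment_compatible B D T X 0 D' T' (onO u X) (- d) f (\<lambda>n. t n X)"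
      unfolding TX_def TuX_def
      using forward_comparison[of t f, OF t(1-5)] by (simp_all add: f_def)
    obtain F where F: "\<forall>p q. F 1 p q = f (p + q) p (p + 1)"
      "spectral_sequence_morphism B (E1 B TX) (E1 B TuX) F"
      using T.B.spectral_sequence_morphism_E1[OF mor] by blast
    have "filtered_map B (TO D T n X) (L n) (TO D' T' n (onO u X)) (L' n) (t n X)" for n
      unfolding L L'_def
      by (rule filtered_map_abutment[OF T.cohomological_functor_axioms T'.cohomological_functor_axioms
            _ _ ab]) (simp_all add: t)
    then show "\<exists>f F g.
          (\<forall>n p q. p \<le> q \<longrightarrow> f n p q
             = TM D' T' n (tsp_comparison D D' u d X p q) \<cdot>\<^bsub>B\<^esub>
               transfer_iso D B T' u \<phi> \<theta> n (tspO D X p q) \<cdot>\<^bsub>B\<^esub>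
               onM T (\<eta> (onO (Sh D n) (tspO D X p q)))) \<and>
          spectral_object_morphism B TX TuX f \<and>
          (\<forall>p q. F 1 p q = f (p + q) p (p + 1)) \<and>
          spectral_sequence_morphism B (E1 B TX) (E1 B TuX) F \<and>
          (\<forall>n. g n = transfer_iso D B T' u \<phi> \<theta> n X \<cdot>\<^bsub>B\<^esub> onM T (\<eta> (onO (Sh D n) X))) \<and>
          abutment_compatible B D T X 0 D' T' (onO u X) (- d) f g \<and>
          (\<forall>n. filtered_map B (TO D T n X) (L n) (TO D' T' n (onO u X)) (L' n) (g n))"
      using mor F ab
      by (intro exI[of _ f] exI[of _ F] exI[of _ "\<lambda>n. t n X"]) (simp add: f_def t_def)
  next
    fix v \<eta> \<epsilon> \<theta>
    assume adj: "adjunction D' D v u \<eta> \<epsilon>" and \<theta>: "natural_iso D' B (T \<circ>\<^sub>F v) T' \<theta>"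
    then have v: "cat_functor D' D v" and \<epsilon>: "natural D D (v \<circ>\<^sub>F u) id_functr \<epsilon>"
      by (simp_all add: adjunction_def)
    define s where "s n Y = onM T (\<epsilon> (onO (Sh D n) Y)) \<cdot>\<^bsub>B\<^esub> arr_inv B (transfer_iso D B T' u \<phi> \<theta> n Y)"
      for n Y
    note s = backward_natural[OF v \<theta> \<epsilon>, folded s_def]
    define f where "f = (\<lambda>n p q. s n (tspO D X p q) \<cdot>\<^bsub>B\<^esub>
      TM D' T' n (arr_inv D' (tsp_comparison D D' u d X p q)))"
    have mor: "spectral_object_morphism B TuX TX f"
      and ab: "abutment_compatible B D' T' (onO u X) (- d) D T X 0 f (\<lambda>n. s n X)"
      unfolding TX_def TuX_def
      using backward_comparison[of s f, OF s(1-5)] by (simp_all add: f_def)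
    obtain F where F: "\<forall>p q. F 1 p q = f (p + q) p (p + 1)"
      "spectral_sequence_morphism B (E1 B TuX) (E1 B TX) F"
      using T.B.spectral_sequence_morphism_E1[OF mor] by blast
    have fm: "filtered_map B (TO D' T' n (onO u X)) (L' n) (TO D T n X) (L n) (s n X)" for n
      unfolding L L'_def
      by (rule filtered_map_abutment[OF T'.cohomological_functor_axioms T.cohomological_functor_axioms
            _ _ ab]) (simp_all add: s)
    \<comment> \<open>The inverse comparison inside \<open>f\<close> cancels against the comparison,
      and the inverse of \<open>tr\<close> inside \<open>s\<close> against \<open>tr\<close>; only
      the counit is left.\<close>
    have fs: "f n p q \<cdot>\<^bsub>B\<^esub> TM D' T' n (tsp_comparison D D' u d X p q) \<cdot>\<^bsub>B\<^esub>
        transfer_iso D B T' u \<phi> \<theta> n (tspO D X p q) = onM T (\<epsilon> (onO (Sh D n) (tspO D X p q)))" for n p q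
    proof -
      note \<gamma> = isomor_arr_inv[OF U.tsp_comparison_isomor[OF X, of p q]]
      have "TM D' T' n (arr_inv D' (tsp_comparison D D' u d X p q)) \<cdot>\<^bsub>B\<^esub>
          TM D' T' n (tsp_comparison D D' u d X p q) = Ide B (TO D' T' n (onO u (tspO D X p q)))"
        using T'.TM_comp[OF \<gamma>(5), of n] \<gamma> by (simp add: T'.TM_Ide)
      from T.B.comp_reassoc[OF this, of "transfer_iso D B T' u \<phi> \<theta> n (tspO D X p q)"]
      show ?thesis
        using \<gamma>(1-4) s(6)[of "tspO D X p q" n] by (simp add: f_def s tr_simps[OF v \<theta>])
    qed
    show "\<exists>f F g.
          (\<forall>n p q. p \<le> q \<longrightarrow>
             f n p q \<cdot>\<^bsub>B\<^esub> TM D' T' n (tsp_comparison D D' u d X p q) \<cdot>\<^bsub>B\<^esub>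
               transfer_iso D B T' u \<phi> \<theta> n (tspO D X p q)
             = onM T (\<epsilon> (onO (Sh D n) (tspO D X p q)))) \<and>
          spectral_object_morphism B TuX TX f \<and>
          (\<forall>p q. F 1 p q = f (p + q) p (p + 1)) \<and>
          spectral_sequence_morphism B (E1 B TuX) (E1 B TX) F \<and>
          (\<forall>n. g n \<cdot>\<^bsub>B\<^esub> transfer_iso D B T' u \<phi> \<theta> n X = onM T (\<epsilon> (onO (Sh D n) X))) \<and>
          abutment_compatible B D' T' (onO u X) (- d) D T X 0 f g \<and>
          (\<forall>n. filtered_map B (TO D' T' n (onO u X)) (L' n) (TO D T n X) (L n) (g n))"
      using mor F ab fm fs s(6)[OF X]
      by (intro exI[of _ f] exI[of _ F] exI[of _ "\<lambda>n. s n X"]) simp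
  qed
qed

end
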